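(* Let $\mathbf f,\mathbf g$ and initial data $\mathring{\mathbf u}\in\mathbb R^n$, $\mathring{\mathbf v}\in\mathbb R^m$ satisfy assumptions (A1)--(A5) listed in the context, and let $(\mathbf u_\epsilon,\mathbf v_\epsilon)$ be the solution of $$\mathbf u_{\epsilon,t}=\mathbf f(\mathbf u_\epsilon,\mathbf v_\epsilon,t,\epsilon),\quad \mathbf u_\epsilon(0)=\mathring{\mathbf u},\qquad \epsilon\,\mathbf v_{\epsilon,t}=\mathbf g(\mathbf u_\epsilon,\mathbf v_\epsilon,t,\epsilon),\quad \mathbf v_\epsilon(0)=\mathring{\mathbf v}.$$ Then there is $\varrho_0>0$ such that for any $0<\varrho<\varrho_0$ there is $\epsilon_\varrho>0$ such that for any $\epsilon\in(0,\epsilon_\varrho]$ and any $t\in[0,\infty)$ $$\left\|\mathbf v_\epsilon(t)-\boldsymbol\phi(\bar{\mathbf u}(t),t)-\widetilde{\mathbf v}_0\left(\frac{t}{\epsilon}\right)\right\|\le\varrho,\qquad \left\|\mathbf u_\epsilon(t)-\bar{\mathbf u}(t)\right\|\le\varrho .$$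
   Context: Notation: a subscript preceded by a comma denotes a derivative; for a vector function $\mathbf h(\mathbf x)$, $\mathbf h_{,\mathbf x}$ is the Jacobian matrix $(h_{i,x_j})_{i,j}$. For a square matrix $A$, $\sigma(A)$ is its spectrum and $s(A)=\max\{\Re\lambda:\lambda\in\sigma(A)\}$. A continuous matrix function $A(t)$ on $[0,\infty)$, with fundamental matrix $Y_A(t)$ of $\mathbf x_{,t}=A(t)\mathbf x$, is said to have the exponential dichotomy property if there are constants $K,\alpha>0$ with $\|Y_A(t)Y_A^{-1}(s)\|\le Ke^{-\alpha(t-s)}$ for all $0\le s\le t<\infty$. Assumptions: (A1) For some $e>0$, with $I_e=[0,e]$, the functions $\mathbf f:\mathbb R^{n+m}\times\mathbb R_+\times I_e\to\mathbb R^n$ and $\mathbf g:\mathbb R^{n+m}\times\mathbb R_+\times I_e\to\mathbb R^m$ (arguments $(\mathbf u,\mathbf v,t,\epsilon)$) are $C^3$ with respect to $\mathbf u$ and $\mathbf v$ and $C^1$ with respect to $t$ and $\epsilon$, and are bounded together with all existing derivatives on $t\in[0,\infty)$, uniformly for $(\mathbf u,\mathbf v)$ in bounded subsets of $\mathbb R^{n+m}$ and $\epsilon\in I_e$. (A2) The equation $0=\mathbf g(\mathbf u,\mathbf v,t,0)$ admits an isolated solution $\mathbf v=\boldsymbol\phi(\mathbf u,t)$ for any $(\mathbf u,t)\in\mathbb R^n\times[0,\infty)$. Denote by $\bar{\mathbf u}$ the solution of $\mathbf u_{,t}=\mathbf f(\mathbf u,\boldsymbol\phi(\mathbf u,t),t,0)$,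 $\mathbf u(0)=\mathring{\mathbf u}$. It is assumed that $t\mapsto\bar{\boldsymbol\upsilon}(t):=(\bar{\mathbf u}(t),\boldsymbol\phi(\bar{\mathbf u}(t),t))$ is a bounded differentiable function on $[0,\infty)$. (A3) $\sup_{t\in[0,\infty)}s(\mathbf g_{,\mathbf v}(\bar{\boldsymbol\upsilon}(t),t,0))<0$. (A4) The solution $\hat{\mathbf v}_0$ of the auxiliary equation $\hat{\mathbf v}_{0,\tau}(\tau)=\mathbf g(\mathring{\mathbf u},\hat{\mathbf v}_0(\tau),0,0)$, $\hat{\mathbf v}_0(0)=\mathring{\mathbf v}$, satisfies $\lim_{\tau\to\infty}\hat{\mathbf v}_0(\tau)=\boldsymbol\phi(\mathring{\mathbf u},0)$. (A5) The matrix function $\mathcal J_{\mathbf f}(\bar{\mathbf u}(t)):=\mathbf f_{,\mathbf u}(\bar{\boldsymbol\upsilon}(t),t,0)+\mathbf f_{,\mathbf v}(\bar{\boldsymbol\upsilon}(t),t,0)\,\boldsymbol\phi_{,\mathbf u}(\bar{\mathbf u}(t),t)$, $t\in[0,\infty)$, has the exponential dichotomy property. The initial layer function is $\widetilde{\mathbf v}_0(\tau):=\hat{\mathbf v}_0(\tau)-\boldsymbol\phi(\mathring{\mathbf u},0)$, $\tau\ge0$. *)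

theory Defs
  imports "HOL-Analysis.Analysis"
begin

definition complex_spectrum :: "real^'n^'n \<Rightarrow> complex set" where
  "complex_spectrum A = {z. \<not> invertible (map_matrix complex_of_real A - mat z)}"

definition spectral_bound :: "real^'n^'n \<Rightarrow> real" where
  "spectral_bound A = Max (Re ` complex_spectrum A)"

definition fundamental_matrix :: "(real \<Rightarrow> real^'n^'n) \<Rightarrow> (real \<Rightarrow> real^'n^'n) \<Rightarrow> bool" where
  "fundamental_matrix A Y \<longleftrightarrow>
     (\<forall>t\<ge>0. (Y has_vector_derivative A t ** Y t) (at t within {0..}) \<and> invertible (Y t))"

text \<open>The product \<open>Y t ** matrix_inv (Y s)\<close> is the same for every fundamental matrix \<open>Y\<close>, so
  it does not matter which one is chosen.\<close>
definition exponential_dichotomy :: "(real \<Rightarrow> real^'n^'n) \<Rightarrow> bool" where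
  "exponential_dichotomy A \<longleftrightarrow>
     continuous_on {0..} A \<and>
     (\<exists>Y. fundamental_matrix A Y \<and>
       (\<exists>K>0. \<exists>\<alpha>>0. \<forall>s t. 0 \<le> s \<and> s \<le> t \<longrightarrow>
          onorm ((*v) (Y t ** matrix_inv (Y s))) \<le> K * exp (- \<alpha> * (t - s))))"

definition locally_uniformly_bounded ::
    "real \<Rightarrow> ('x::metric_space \<Rightarrow> real \<Rightarrow> real \<Rightarrow> 'y::metric_space) \<Rightarrow> bool" where
  "locally_uniformly_bounded e G \<longleftrightarrow>
     (\<forall>B. bounded B \<longrightarrow> bounded {G x t \<epsilon> | x t \<epsilon>. x \<in> B \<and> 0 \<le> t \<and> \<epsilon> \<in> {0..e}})"

text \<open>\<open>F x t \<epsilon>\<close> is \<open>C\<^sup>3\<close> in \<open>x\<close> for fixed \<open>(t, \<epsilon>)\<close> and \<open>C\<^sup>1\<close> in \<open>(t, \<epsilon>)\<close> for fixed \<open>x\<close>, with \<open>F\<close> and all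
  these derivatives bounded, uniformly in \<open>t \<ge> 0\<close>, \<open>\<epsilon> \<in> [0, e]\<close> and in \<open>x\<close> from bounded sets. Only the values
  of \<open>F\<close> for \<open>t \<ge> 0\<close> and \<open>\<epsilon> \<in> [0, e]\<close> matter; derivatives at the boundary are one-sided.
  Mixed derivatives in \<open>x\<close> and \<open>(t, \<epsilon>)\<close> are not required to exist.\<close>
definition C3_C1_bounded ::
    "real \<Rightarrow> ('x::euclidean_space \<Rightarrow> real \<Rightarrow> real \<Rightarrow> 'y::euclidean_space) \<Rightarrow> bool" where
  "C3_C1_bounded e F \<longleftrightarrow>
     (\<exists>(D1 :: 'x \<Rightarrow> real \<Rightarrow> real \<Rightarrow> 'x \<Rightarrow>\<^sub>L 'y)
       (D2 :: 'x \<Rightarrow> real \<Rightarrow> real \<Rightarrow> 'x \<Rightarrow>\<^sub>L 'x \<Rightarrow>\<^sub>L 'y)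
       (D3 :: 'x \<Rightarrow> real \<Rightarrow> real \<Rightarrow> 'x \<Rightarrow>\<^sub>L 'x \<Rightarrow>\<^sub>L 'x \<Rightarrow>\<^sub>L 'y)
       (Dt :: 'x \<Rightarrow> real \<Rightarrow> real \<Rightarrow> 'y)
       (De :: 'x \<Rightarrow> real \<Rightarrow> real \<Rightarrow> 'y).
       (\<forall>x. \<forall>t\<ge>0. \<forall>\<epsilon>\<in>{0..e}.
          ((\<lambda>y. F y t \<epsilon>) has_derivative blinfun_apply (D1 x t \<epsilon>)) (at x) \<and>
          ((\<lambda>y. D1 y t \<epsilon>) has_derivative blinfun_apply (D2 x t \<epsilon>)) (at x) \<and>
          ((\<lambda>y. D2 y t \<epsilon>) has_derivative blinfun_apply (D3 x t \<epsilon>)) (at x) \<and>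
          ((\<lambda>s. F x s \<epsilon>) has_vector_derivative Dt x t \<epsilon>) (at t within {0..}) \<and>
          ((\<lambda>\<eta>. F x t \<eta>) has_vector_derivative De x t \<epsilon>) (at \<epsilon> within {0..e})) \<and>
       (\<forall>t\<ge>0. \<forall>\<epsilon>\<in>{0..e}. continuous_on UNIV (\<lambda>x. D3 x t \<epsilon>)) \<and>
       (\<forall>x. continuous_on ({0..} \<times> {0..e}) (\<lambda>(t, \<epsilon>). Dt x t \<epsilon>) \<and>
            continuous_on ({0..} \<times> {0..e}) (\<lambda>(t, \<epsilon>). De x t \<epsilon>)) \<and>
       locally_uniformly_bounded e F \<and> locally_uniformly_bounded e D1 \<and>
       locally_uniformly_bounded e D2 \<and> locally_uniformly_bounded e D3 \<and>
       locally_uniformly_bounded e Dt \<and> locally_uniformly_bounded e De)"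

definition solves_ivp ::
    "(real \<Rightarrow> 'a \<Rightarrow> 'a) \<Rightarrow> 'a \<Rightarrow> (real \<Rightarrow> 'a::real_normed_vector) \<Rightarrow> bool" where
  "solves_ivp F x0 x \<longleftrightarrow>
     x 0 = x0 \<and> (\<forall>t\<ge>0. (x has_vector_derivative F t (x t)) (at t within {0..}))"

definition solves_perturbed ::
    "(real^'n \<Rightarrow> real^'m \<Rightarrow> real \<Rightarrow> real \<Rightarrow> real^'n) \<Rightarrow>
     (real^'n \<Rightarrow> real^'m \<Rightarrow> real \<Rightarrow> real \<Rightarrow> real^'m) \<Rightarrow>
     real^'n \<Rightarrow> real^'m \<Rightarrow> real \<Rightarrow> (real \<Rightarrow> real^'n) \<Rightarrow> (real \<Rightarrow> real^'m) \<Rightarrow> bool" where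
  "solves_perturbed f g u0 v0 \<epsilon> u v \<longleftrightarrow>
     u 0 = u0 \<and> v 0 = v0 \<and>
     (\<forall>t\<ge>0. (u has_vector_derivative f (u t) (v t) t \<epsilon>) (at t within {0..}) \<and>
       (\<exists>v'. (v has_vector_derivative v') (at t within {0..}) \<and> \<epsilon> *\<^sub>R v' = g (u t) (v t) t \<epsilon>))"

end

theory Submission
  imports Defs "HOL-Computational_Algebra.Fundamental_Theorem_Algebra"
begin

text \<open>
  Write \<open>x = u - ubar\<close> and \<open>y = v - vbar\<close> for the deviation of a solution from the reduced trajectory
  \<open>(ubar t, vbar t)\<close>, \<open>vbar t = \<phi> (ubar t) t\<close>. The natural fast variable is the residual
  \<open>\<gamma> = g(u, v, t, \<epsilon>) = \<epsilon> v'\<close> rather than \<open>v\<close> itself: differentiating it along a solution gives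
  \<open>\<epsilon> \<gamma>' = g\<^sub>v \<gamma> + \<epsilon> (g\<^sub>u f + g\<^sub>t)\<close>, a linear equation with an \<open>O(\<epsilon>)\<close> forcing. In this way \<open>\<phi>\<close> enters only through its
  values along the trajectory and its derivative there.

  While the solution stays in a thin tube, the coefficient \<open>g\<^sub>v\<close> is close to
  \<open>G(t) = g\<^sub>v(ubar t, vbar t, t, 0)\<close>, which hardly changes over times of order \<open>\<epsilon>\<close> and has its spectrum to
  the left of a fixed vertical line. The flow of such a matrix contracts a suitable norm at a rate that
  depends only on the bound for the matrix and on the line (\<open>adapted_norm\<close>); freezing \<open>G\<close> on intervals whose length
  is proportional to \<open>\<epsilon>\<close> therefore shows \<open>|\<gamma> t| \<le> C (|\<gamma> a| + \<epsilon>)\<close> for all later times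
  (\<open>slowly_varying_stability\<close>, \<open>fast_residual_bound\<close>). By Taylor expansion \<open>\<gamma>\<close> controls \<open>y\<close> up to
  its slow part, \<open>y = \<phi>\<^sub>u x + O(|\<gamma>| + \<epsilon> + |x|\<^sup>2 + |y|\<^sup>2)\<close>, and \<open>x\<close> solves the linearised reduced equation up to
  an error of the same size (\<open>linearisation\<close>). The exponential dichotomy bounds \<open>x\<close> by its initial value and
  the supremum of this error (\<open>exponential_stability_with_forcing\<close>). In a tube of small enough width the
  quadratic terms are absorbed, so the deviation stays below a constant times its initial value plus
  \<open>\<epsilon>\<close>; for small data it never leaves the tube (\<open>slow_manifold_stability\<close>).

  This is applied from the time \<open>\<epsilon> T\<close> on, where \<open>T\<close> is so large that \<open>vhat\<close> has almost reached its limit.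
  On \<open>[0, \<epsilon> T]\<close> the slow variable barely moves and \<open>v\<close> follows \<open>vhat (t / \<epsilon>)\<close> by a Gronwall argument
  (\<open>initial_layer\<close>). All these estimates use the equation only as long as the solution is in a fixed ball, so
  they also hold for the solution of a system truncated outside that ball. That solution exists globally, and
  since it never leaves the ball it solves the original system.
\<close>

section \<open>Matrices annihilated by their spectrum\<close>

definition shifted :: "complex^'n^'n \<Rightarrow> complex \<Rightarrow> complex^'n \<Rightarrow> complex^'n" where
  "shifted A \<mu> w = A *v w - \<mu> *s w"

fun shift_chain :: "complex^'n^'n \<Rightarrow> complex list \<Rightarrow> complex^'n \<Rightarrow> complex^'n" where
  "shift_chain A [] w = w"
| "shift_chain A (\<mu> # \<mu>s) w = shift_chain A \<mu>s (shifted A \<mu> w)"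

text \<open>The vector \<open>p(A) w\<close>, evaluated by Horner's scheme.\<close>
definition poly_apply :: "complex^'n^'n \<Rightarrow> complex poly \<Rightarrow> complex^'n \<Rightarrow> complex^'n" where
  "poly_apply A p w = fold_coeffs (\<lambda>a x. a *s w + A *v x) p 0"

lemma poly_apply_0 [simp]: "poly_apply A 0 w = 0"
  by (simp add: poly_apply_def)

lemma poly_apply_pCons [simp]:
  "poly_apply A (pCons a p) w = a *s w + A *v poly_apply A p w"
  by (cases "p = 0 \<and> a = 0") (auto simp: poly_apply_def)

lemma poly_apply_add: "poly_apply A (p + q) w = poly_apply A p w + poly_apply A q w"
proof (induction p arbitrary: q)
  case (pCons a p)
  obtain b r where "q = pCons b r" by (cases q)
  then show ?case
    by (simp add: pCons.IH matrix_vector_right_distrib vec.scale_left_distrib)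
qed simp

lemma poly_apply_smult: "poly_apply A (smult c p) w = c *s poly_apply A p w"
  by (induction p) (simp_all add: vector_scalar_commute vec.scale_right_distrib vector_smult_assoc)

lemma poly_apply_sum: "poly_apply A (sum p I) w = (\<Sum>i\<in>I. poly_apply A (p i) w)"
  by (induction I rule: infinite_finite_induct) (simp_all add: poly_apply_add)

lemma poly_apply_monom: "poly_apply A (monom c k) w = c *s (((*v) A ^^ k) w)"
  by (induction k) (simp_all add: monom_Suc vector_scalar_commute monom_0)

lemma poly_apply_commute: "poly_apply A p (A *v w) = A *v poly_apply A p w"
  by (induction p) (simp_all add: vector_scalar_commute matrix_vector_right_distrib)

lemma poly_apply_add_arg:
  "poly_apply A p (v + w) = poly_apply A p v + poly_apply A p w"
  by (induction p) (simp_all add: matrix_vector_right_distrib vec.scale_right_distrib)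

lemma poly_apply_scale_arg:
  "poly_apply A p (c *s w) = c *s poly_apply A p w"
  by (induction p) (simp_all add: vector_scalar_commute vec.scale_right_distrib vector_smult_assoc mult.commute)

lemma poly_apply_linear_factor:
  "poly_apply A ([:-\<mu>, 1:] * q) w = poly_apply A q (shifted A \<mu> w)"
proof -
  have "[:-\<mu>, 1:] * q = smult (-\<mu>) q + pCons 0 q"
    by (simp add: mult_pCons_left)
  moreover have "shifted A \<mu> w = A *v w + (-\<mu>) *s w"
    by (simp add: shifted_def vector_smult_lneg)
  ultimately show ?thesis
    by (simp only: poly_apply_add poly_apply_smult poly_apply_add_arg poly_apply_scale_arg poly_apply_commute)
       (simp add: add.commute)
qed

text \<open>Over the complex numbers \<open>p(A)\<close> factors into shifts \<open>A - \<mu>\<close>, one for each root: each root splits off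
  a linear factor of \<open>p\<close>.\<close>
lemma poly_apply_factors:
  assumes "p \<noteq> 0"
  obtains \<mu>s where "length \<mu>s = degree p" "\<And>w. poly_apply A p w = lead_coeff p *s shift_chain A \<mu>s w"
  using assms
proof (induction "degree p" arbitrary: p thesis)
  case 0
  then obtain a where "p = [:a:]"
    by (metis degree_eq_zeroE)
  then show ?case
    by (intro 0(2)[of "[]"]) auto
next
  case (Suc n)
  then obtain z where "poly p z = 0"
    using fundamental_theorem_of_algebra[of p] by (metis constant_degree nat.distinct(1))
  then obtain q where q: "p = [:-z, 1:] * q"
    by (metis dvdE poly_eq_0_iff_dvd)
  have "q \<noteq> 0" using q Suc by auto
  moreover have "degree p = Suc (degree q)"
    unfolding q using \<open>q \<noteq> 0\<close> by (subst degree_mult_eq) auto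
  ultimately obtain \<mu>s where *: "length \<mu>s = degree q"
     "\<And>w. poly_apply A q w = lead_coeff q *s shift_chain A \<mu>s w"
    using Suc(1)[of q] Suc(2) by auto
  have "lead_coeff p = lead_coeff q"
    unfolding q lead_coeff_mult by simp
  then have "poly_apply A p w = lead_coeff p *s shift_chain A (z # \<mu>s) w" for w
    unfolding q poly_apply_linear_factor by (simp add: *(2))
  then show ?case
    using Suc(3)[of "z # \<mu>s"] *(1) \<open>degree p = _\<close> by simp
qed

lemma sum_matrix_vector_mult: "(\<Sum>i\<in>I. P i) *v w = (\<Sum>i\<in>I. P i *v w)"
  by (induction I rule: infinite_finite_induct) (simp_all add: matrix_vector_mult_add_rdistrib)

text \<open>The powers of \<open>A\<close> up to the dimension of the space of matrices are linearly dependent. The roots of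
  this polynomial may include numbers that are not eigenvalues; they are removed below.\<close>
lemma matrix_annihilating_poly:
  fixes A :: "complex^'n^'n"
  obtains p where "p \<noteq> 0" "degree p \<le> DIM(complex^'n^'n)" "\<And>w. poly_apply A p w = 0"
proof -
  let ?D = "DIM(complex^'n^'n)"
  define P where "P k = ((**) A ^^ k) (mat 1)" for k
  have P: "P k *v w = ((*v) A ^^ k) w" for k w
    by (induction k) (simp_all add: P_def matrix_vector_mul_assoc[symmetric])
  have "\<exists>c::nat \<Rightarrow> real. (\<exists>k\<le>?D. c k \<noteq> 0) \<and> (\<Sum>k\<le>?D. c k *\<^sub>R P k) = 0"
  proof (cases "inj_on P {..?D}")
    case True
    then have "card (P ` {..?D}) = Suc ?D"
      by (simp add: card_image)
    then have "dependent (P ` {..?D})"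
      by (intro dependent_biggerset) auto
    then obtain u where u: "\<exists>v\<in>P ` {..?D}. u v \<noteq> 0" "(\<Sum>v\<in>P ` {..?D}. u v *\<^sub>R v) = 0"
      by (subst (asm) real_vector.dependent_finite) auto
    show ?thesis
      by (rule exI[of _ "u \<circ> P"]) (use u True in \<open>auto simp: sum.reindex\<close>)
  next
    case False
    then obtain i j where ij: "i \<le> ?D" "j \<le> ?D" "i \<noteq> j" "P i = P j"
      by (auto simp: inj_on_def)
    let ?c = "\<lambda>k. if k = i then 1 else if k = j then -1 else (0::real)"
    have "(\<Sum>k\<le>?D. ?c k *\<^sub>R P k) = (\<Sum>k\<in>{i,j}. ?c k *\<^sub>R P k)"
      using ij by (intro sum.mono_neutral_right) auto
    also have "\<dots> = 0"
      using ij by simp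
    finally show ?thesis
      using ij by (intro exI[of _ ?c]) auto
  qed
  then obtain c :: "nat \<Rightarrow> real" and k0 where c: "k0 \<le> ?D" "c k0 \<noteq> 0" "(\<Sum>k\<le>?D. c k *\<^sub>R P k) = 0"
    by auto
  define p where "p = (\<Sum>k\<le>?D. monom (complex_of_real (c k)) k)"
  have "coeff p k0 = c k0"
    using c(1) by (simp add: p_def coeff_sum)
  then have "p \<noteq> 0"
    using c(2) by auto
  moreover have "degree p \<le> ?D"
    unfolding p_def by (intro degree_sum_le) (auto intro: order.trans[OF degree_monom_le])
  moreover have "poly_apply A p w = 0" for w
  proof -
    have "poly_apply A p w = (\<Sum>k\<le>?D. complex_of_real (c k) *s (P k *v w))"
      by (simp add: p_def poly_apply_sum poly_apply_monom P)
    also have "\<dots> = (\<Sum>k\<le>?D. (c k *\<^sub>R P k) *v w)"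
      by (intro sum.cong) (auto simp: vec_eq_iff matrix_vector_mult_def sum_distrib_left mult.assoc scaleR_right.sum
          simp flip: scaleR_conv_of_real)
    also have "\<dots> = (\<Sum>k\<le>?D. c k *\<^sub>R P k) *v w"
      by (rule sum_matrix_vector_mult[symmetric])
    finally show ?thesis using c(3) by simp
  qed
  ultimately show ?thesis using that by blast
qed

lemma norm_vector_smult: "norm (c *s w) = cmod c * norm (w :: complex^'n)"
  by (simp add: norm_vec_def norm_mult L2_set_right_distrib)

lemma shifted_commute: "shifted A \<mu> (shifted A \<nu> w) = shifted A \<nu> (shifted A \<mu> w)"
  by (simp add: shifted_def matrix_vector_mult_diff_distrib vector_scalar_commute vec.scale_right_diff_distrib
      vector_smult_assoc mult.commute)

lemma shift_chain_shifted: "shift_chain A \<mu>s (shifted A \<nu> w) = shifted A \<nu> (shift_chain A \<mu>s w)"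
proof (induction \<mu>s arbitrary: w)
  case (Cons \<mu> \<mu>s)
  then show ?case by (simp add: shifted_commute[of A \<mu> \<nu> w])
qed simp

lemma shifted_kernel:
  fixes B :: "real^'n^'n"
  shows "z \<in> complex_spectrum B \<longleftrightarrow> (\<exists>w\<noteq>0. shifted (map_matrix complex_of_real B) z w = 0)"
proof -
  let ?A = "map_matrix complex_of_real B - mat z"
  have *: "?A *v w = shifted (map_matrix complex_of_real B) z w" for w
    by (simp add: shifted_def vec_eq_iff matrix_vector_mult_def mat_def left_diff_distrib sum_subtractf
        if_distrib[of "\<lambda>x. x * _"] sum.delta cong: if_cong)
  have "z \<in> complex_spectrum B \<longleftrightarrow> \<not> (\<exists>C. C ** ?A = mat 1)"
    by (simp add: complex_spectrum_def invertible_left_inverse)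
  also have "\<dots> \<longleftrightarrow> (\<exists>w\<noteq>0. ?A *v w = 0)"
    by (auto simp: matrix_left_invertible_ker)
  finally show ?thesis by (simp add: *)
qed

text \<open>A shift by a number outside the spectrum is injective and commutes with the other shifts, so it can be
  cancelled from a vanishing product.\<close>
lemma shift_chain_filter:
  fixes B :: "real^'n^'n"
  defines "A \<equiv> map_matrix complex_of_real B"
  assumes "shift_chain A \<mu>s w = 0"
  shows "shift_chain A (filter (\<lambda>z. z \<in> complex_spectrum B) \<mu>s) w = 0"
  using assms(2)
proof (induction \<mu>s arbitrary: w)
  case (Cons z \<mu>s)
  show ?case
  proof (cases "z \<in> complex_spectrum B")
    case True
    then show ?thesis using Cons by simp
  next
    case False
    have "shifted A z (shift_chain A \<mu>s w) = 0"
      using Cons.prems by (simp add: shift_chain_shifted)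
    then have "shift_chain A \<mu>s w = 0"
      using False by (auto simp: shifted_kernel A_def)
    then show ?thesis using False Cons.IH by simp
  qed
qed simp

text \<open>A variant of the theorem of Cayley and Hamilton. What matters later is that the factors come from the
  spectrum and that their number is bounded by the dimension alone.\<close>
lemma spectrum_annihilates:
  fixes B :: "real^'n^'n"
  shows "\<exists>\<mu>s. length \<mu>s \<le> DIM(complex^'n^'n) \<and> set \<mu>s \<subseteq> complex_spectrum B \<and>
    (\<forall>w. shift_chain (map_matrix complex_of_real B) \<mu>s w = 0)"
proof -
  let ?A = "map_matrix complex_of_real B"
  obtain p where p: "p \<noteq> 0" "degree p \<le> DIM(complex^'n^'n)" "\<And>w. poly_apply ?A p w = 0"
    using matrix_annihilating_poly[of ?A] by blast
  obtain \<mu>s where \<mu>s: "length \<mu>s = degree p" "\<And>w. poly_apply ?A p w = lead_coeff p *s shift_chain ?A \<mu>s w"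
    using poly_apply_factors[OF p(1)] by blast
  have "shift_chain ?A \<mu>s w = 0" for w
    using \<mu>s(2)[of w] p(1) p(3)[of w] by auto
  then show ?thesis
    using p(2) \<mu>s(1) shift_chain_filter[of B \<mu>s]
    by (intro exI[of _ "filter (\<lambda>z. z \<in> complex_spectrum B) \<mu>s"])
       (auto intro: order.trans[OF length_filter_le])
qed

lemma finite_complex_spectrum:
  fixes B :: "real^'n^'n"
  shows "finite (complex_spectrum B)"
proof -
  let ?A = "map_matrix complex_of_real B"
  obtain \<mu>s where \<mu>s: "\<And>w. shift_chain ?A \<mu>s w = 0"
    using spectrum_annihilates[of B] by auto
  have "z \<in> set \<mu>s" if "shifted ?A z w = 0" "w \<noteq> 0" for z w
  proof (rule ccontr)
    assume z: "z \<notin> set \<mu>s"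
    have *: "shifted ?A \<mu> (c *s w) = (c * (z - \<mu>)) *s w" for \<mu> c
      using that(1) by (simp add: shifted_def vector_scalar_commute vec_eq_iff algebra_simps)
    have "shift_chain ?A \<nu>s (c *s w) \<noteq> 0" if "c \<noteq> 0" "z \<notin> set \<nu>s" for \<nu>s c
      using that
    proof (induction \<nu>s arbitrary: c)
      case (Cons \<mu> \<nu>s)
      then show ?case by (simp add: *)
    qed (use \<open>w \<noteq> 0\<close> in simp)
    from this[of 1 \<mu>s] \<mu>s z show False by simp
  qed
  then have "complex_spectrum B \<subseteq> set \<mu>s"
    by (auto simp: shifted_kernel)
  then show ?thesis
    using finite_subset by blast
qed

lemma Re_le_spectral_bound: "z \<in> complex_spectrum B \<Longrightarrow> Re z \<le> spectral_bound B"
  unfolding spectral_bound_def by (intro Max_ge) (auto intro: finite_complex_spectrum)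

section \<open>A norm contracted by a stable matrix\<close>

text \<open>The sum of \<open>\<theta>\<^sup>j |(A - \<mu>\<^sub>j) \<dots> (A - \<mu>\<^sub>1) w|\<close> over the proper initial segments of the list of shifts.
  When all the shifts together annihilate the space, this is the norm that a triangular form of
  \<open>A\<close> suggests: one step of the chain feeds only the previous one, and a large weight \<open>\<theta>\<close> makes
  this coupling harmless.\<close>
fun chain_norm :: "real \<Rightarrow> complex^'n^'n \<Rightarrow> complex list \<Rightarrow> complex^'n \<Rightarrow> real" where
  "chain_norm \<theta> A [] w = 0"
| "chain_norm \<theta> A (\<mu> # \<mu>s) w = norm w + \<theta> * chain_norm \<theta> A \<mu>s (shifted A \<mu> w)"

lemma chain_norm_nonneg: "\<theta> \<ge> 0 \<Longrightarrow> 0 \<le> chain_norm \<theta> A \<mu>s w"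
  by (induction \<mu>s arbitrary: w) auto

lemma norm_le_chain_norm:
  "\<theta> \<ge> 0 \<Longrightarrow> shift_chain A \<mu>s w = 0 \<Longrightarrow> norm w \<le> chain_norm \<theta> A \<mu>s w"
  by (cases \<mu>s) (auto simp: chain_norm_nonneg)

lemma shifted_add: "shifted A \<mu> (v + w) = shifted A \<mu> v + shifted A \<mu> w"
  by (simp add: shifted_def matrix_vector_right_distrib vec.scale_right_distrib)

lemma chain_norm_triangle:
  "\<theta> \<ge> 0 \<Longrightarrow> chain_norm \<theta> A \<mu>s (v + w) \<le> chain_norm \<theta> A \<mu>s v + chain_norm \<theta> A \<mu>s w"
proof (induction \<mu>s arbitrary: v w)
  case (Cons \<mu> \<mu>s)
  show ?case
    using mult_left_mono[OF Cons(1)[of "shifted A \<mu> v" "shifted A \<mu> w"] Cons(2)] Cons(2)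
      norm_triangle_ineq[of v w]
    by (simp add: shifted_add algebra_simps)
qed simp

lemma chain_norm_le:
  assumes "\<theta> \<ge> 0" "0 \<le> M" "\<And>w. norm (A *v w) \<le> M * norm w" "\<And>\<mu>. \<mu> \<in> set \<mu>s \<Longrightarrow> cmod \<mu> \<le> M"
  shows "chain_norm \<theta> A \<mu>s w \<le> (\<Sum>j<length \<mu>s. (2 * M * \<theta>) ^ j) * norm w"
  using assms(4)
proof (induction \<mu>s arbitrary: w)
  case (Cons \<mu> \<mu>s)
  let ?S = "\<Sum>j<length \<mu>s. (2 * M * \<theta>) ^ j"
  have S: "0 \<le> ?S" using assms(1,2) by (intro sum_nonneg) auto
  have "norm (shifted A \<mu> w) \<le> norm (A *v w) + norm (\<mu> *s w)"
    by (simp add: shifted_def norm_triangle_ineq4)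
  also have "\<dots> \<le> M * norm w + M * norm w"
    using assms(3) Cons(2)[of \<mu>] by (intro add_mono) (auto simp: norm_vector_smult intro!: mult_right_mono)
  finally have *: "norm (shifted A \<mu> w) \<le> 2 * M * norm w" by simp
  have "chain_norm \<theta> A \<mu>s (shifted A \<mu> w) \<le> ?S * norm (shifted A \<mu> w)"
    using Cons by simp
  also have "\<dots> \<le> ?S * (2 * M * norm w)"
    using * S by (rule mult_left_mono)
  finally have "\<theta> * chain_norm \<theta> A \<mu>s (shifted A \<mu> w) \<le> \<theta> * (?S * (2 * M * norm w))"
    using assms(1) by (rule mult_left_mono)
  also have "\<dots> = (2 * M * \<theta> * ?S) * norm w" by simp
  also have "2 * M * \<theta> * ?S = (\<Sum>j<length \<mu>s. (2 * M * \<theta>) ^ Suc j)"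
    by (simp add: sum_distrib_left)
  finally show ?case
    unfolding length_Cons chain_norm.simps sum.lessThan_Suc_shift by (simp add: distrib_right)
qed simp

text \<open>In \<open>w + h A w = (1 + h \<mu>) w + h (A - \<mu>) w\<close> the last term has size \<open>h / \<theta>\<close> times the next term of
  the norm. The subtracted \<open>h / \<theta> |w|\<close> makes the induction close: it is what the first entry of a chain has
  to contribute once a further entry is put in front of it.\<close>
lemma chain_norm_Euler_step:
  assumes \<theta>: "\<theta> > 0" and h: "h \<ge> 0"
    and spec: "\<And>\<mu>. \<mu> \<in> set \<mu>s \<Longrightarrow> cmod (1 + h * \<mu>) \<le> p"
    and "shift_chain A \<mu>s w = 0"
  shows "chain_norm \<theta> A \<mu>s (w + complex_of_real h *s (A *v w))
     \<le> (p + h / \<theta>) * chain_norm \<theta> A \<mu>s w - h / \<theta> * norm w"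
  using spec assms(4)
proof (induction \<mu>s arbitrary: w)
  case (Cons \<mu> \<mu>s)
  let ?L = "shifted A \<mu> w"
  have L0: "shift_chain A \<mu>s ?L = 0" using Cons by simp
  have "w + complex_of_real h *s (A *v w) = (1 + h * \<mu>) *s w + complex_of_real h *s ?L"
    by (simp add: shifted_def vec_eq_iff algebra_simps)
  then have "norm (w + complex_of_real h *s (A *v w)) \<le> cmod (1 + h * \<mu>) * norm w + h * norm ?L"
    using norm_triangle_ineq[of "(1 + h * \<mu>) *s w" "complex_of_real h *s ?L"] h
    by (simp only: norm_vector_smult norm_of_real abs_of_nonneg)
  also have "\<dots> \<le> p * norm w + h * norm ?L"
    using Cons(2)[of \<mu>] by (intro add_mono mult_right_mono) auto
  finally have 1: "norm (w + complex_of_real h *s (A *v w)) \<le> p * norm w + h * norm ?L" .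
  have comm: "shifted A \<mu> (w + complex_of_real h *s (A *v w)) = ?L + complex_of_real h *s (A *v ?L)"
    by (simp add: shifted_def matrix_vector_right_distrib matrix_vector_mult_diff_distrib vector_scalar_commute
        vec.scale_right_diff_distrib vec.scale_right_distrib vector_smult_assoc mult.commute)
  have "chain_norm \<theta> A \<mu>s (?L + complex_of_real h *s (A *v ?L))
     \<le> (p + h / \<theta>) * chain_norm \<theta> A \<mu>s ?L - h / \<theta> * norm ?L"
    using Cons L0 by auto
  from mult_left_mono[OF this, of \<theta>]
  have "\<theta> * chain_norm \<theta> A \<mu>s (?L + complex_of_real h *s (A *v ?L))
     \<le> (p + h / \<theta>) * (\<theta> * chain_norm \<theta> A \<mu>s ?L) - h * norm ?L"
    using \<theta> by (simp add: algebra_simps)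
  with 1 show ?case
    unfolding chain_norm.simps comm by (simp add: algebra_simps)
qed simp

lemma norm_map_matrix_of_real:
  fixes B :: "real^'n^'n"
  assumes "\<And>x. norm (B *v x) \<le> M * norm x" "M \<ge> 0"
  shows "norm (map_matrix complex_of_real B *v w) \<le> M * norm w"
proof -
  let ?A = "map_matrix complex_of_real B"
  define x y where "x = (\<chi> i. Re (w $ i))" "y = (\<chi> i. Im (w $ i))"
  have sq: "(norm v)\<^sup>2 = (norm (\<chi> i. Re (v $ i)))\<^sup>2 + (norm (\<chi> i. Im (v $ i)))\<^sup>2" for v :: "complex^'n"
    by (simp add: norm_vec_def L2_set_def sum_nonneg sum.distrib[symmetric] cmod_power2)
  have "(\<chi> i. Re ((?A *v w) $ i)) = B *v x" "(\<chi> i. Im ((?A *v w) $ i)) = B *v y"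
    by (simp_all add: vec_eq_iff matrix_vector_mult_def x_y_def)
  then have "(norm (?A *v w))\<^sup>2 = (norm (B *v x))\<^sup>2 + (norm (B *v y))\<^sup>2"
    using sq[of "?A *v w"] by simp
  also have "\<dots> \<le> (M * norm x)\<^sup>2 + (M * norm y)\<^sup>2"
    using assms by (intro add_mono power_mono) auto
  also have "\<dots> = (M * norm w)\<^sup>2"
    using sq[of w] by (simp add: x_y_def power_mult_distrib algebra_simps)
  finally show ?thesis
    using assms(2) by (simp add: power2_le_iff_abs_le)
qed

text \<open>For small \<open>h\<close> the quadratic term of \<open>|1 + h \<mu>|\<^sup>2 = 1 + 2 h Re \<mu> + h\<^sup>2 |\<mu>|\<^sup>2\<close> costs a quarter of the
  linear gain.\<close>
lemma cmod_Euler_factor: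
  assumes "Re \<mu> \<le> - \<kappa>" "cmod \<mu> \<le> M" "0 \<le> h" "h * M\<^sup>2 \<le> \<kappa> / 2" "0 < \<kappa>"
  shows "cmod (1 + h * \<mu>) \<le> 1 - 3 / 4 * (h * \<kappa>)"
proof -
  have "\<kappa> \<le> M" using assms abs_Re_le_cmod[of \<mu>] by linarith
  then have "h * \<kappa> * \<kappa> \<le> h * M\<^sup>2"
    using assms by (auto simp: power2_eq_square mult.assoc intro!: mult_left_mono mult_mono)
  then have "h * \<kappa> * \<kappa> \<le> \<kappa> / 2" using assms(4) by linarith
  then have hk: "h * \<kappa> \<le> 1/2" using assms(5)
    using mult_le_cancel_right_pos[of \<kappa> "h * \<kappa>" "1/2"] by simp
  have "(cmod (1 + h * \<mu>))\<^sup>2 = 1 + 2 * h * Re \<mu> + h * (h * (cmod \<mu>)\<^sup>2)"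
    unfolding cmod_power2 by (simp add: power2_eq_square algebra_simps)
  also have "\<dots> \<le> 1 + 2 * h * (-\<kappa>) + h * (h * M\<^sup>2)"
    using assms by (intro add_mono mult_left_mono power_mono) auto
  also have "\<dots> \<le> 1 + 2 * h * (-\<kappa>) + h * (\<kappa>/2)"
    using assms by (intro add_mono mult_left_mono) auto
  also have "\<dots> = 1 - 2 * (3/4 * (h * \<kappa>))" by simp
  also have "\<dots> \<le> (1 - 3 / 4 * (h * \<kappa>))\<^sup>2"
    using zero_le_power2[of "3 / 4 * (h * \<kappa>)"] power2_diff[of 1 "3 / 4 * (h * \<kappa>)"] by simp
  finally show ?thesis
    by (rule power2_le_imp_le) (use hk in simp)
qed

text \<open>The logarithmic norm of \<open>B\<close> with respect to \<open>N\<close> is at most \<open>- \<kappa> / 4\<close>, expressed through Euler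
  steps. In this form it applies directly to a perturbed equation, one small time step after the other.\<close>
definition contracting_norm :: "real^'n^'n \<Rightarrow> real \<Rightarrow> real \<Rightarrow> real \<Rightarrow> (real^'n \<Rightarrow> real) \<Rightarrow> bool" where
  "contracting_norm B \<kappa> C h0 N \<longleftrightarrow>
     (\<forall>x. norm x \<le> N x \<and> N x \<le> C * norm x) \<and> (\<forall>x y. N (x + y) \<le> N x + N y) \<and>
     (\<forall>x h. 0 \<le> h \<and> h \<le> h0 \<longrightarrow> N (x + h *\<^sub>R (B *v x)) \<le> (1 - h * \<kappa> / 4) * N x)"

text \<open>The constants depend on \<open>M\<close> and \<open>\<kappa>\<close> but not on the matrix, which is what makes the rate uniform in time
  for a family of matrices. The weight \<open>\<theta> = 2 / \<kappa>\<close> spends \<open>\<kappa> / 2\<close> of the rate \<open>3 \<kappa> / 4\<close>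
  on the coupling inside the chain.\<close>
lemma adapted_norm:
  fixes \<kappa> M :: real
  assumes \<kappa>: "\<kappa> > 0" and M: "M > 0"
  shows "\<exists>C\<ge>1. \<exists>h0>0. \<forall>B :: real^'n^'n.
    (\<forall>x. norm (B *v x) \<le> M * norm x) \<and> (\<forall>z\<in>complex_spectrum B. Re z \<le> - \<kappa>) \<longrightarrow>
    (\<exists>N. contracting_norm B \<kappa> C h0 N)"
proof -
  define \<theta> where "\<theta> = 2 / \<kappa>"
  define D where "D = DIM(complex^'n^'n)"
  define C where "C = (\<Sum>j<Suc D. (2 * M * \<theta>) ^ j)"
  define h0 where "h0 = \<kappa> / (2 * M\<^sup>2)"
  have \<theta>: "\<theta> > 0" using \<kappa> by (simp add: \<theta>_def)
  have "C \<ge> 1"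
    unfolding C_def sum.lessThan_Suc_shift using \<theta> M by (simp add: sum_nonneg)
  moreover have "h0 > 0" using \<kappa> M by (simp add: h0_def)
  moreover have "\<exists>N. contracting_norm B \<kappa> C h0 N"
    if B: "\<And>x. norm (B *v x) \<le> M * norm x" and spec: "\<And>z. z \<in> complex_spectrum B \<Longrightarrow> Re z \<le> - \<kappa>"
    for B :: "real^'n^'n"
  proof -
    let ?A = "map_matrix complex_of_real B"
    define cv :: "real^'n \<Rightarrow> complex^'n" where "cv x = (\<chi> i. complex_of_real (x $ i))" for x
    obtain \<mu>s where \<mu>s: "length \<mu>s \<le> D" "set \<mu>s \<subseteq> complex_spectrum B" "\<And>w. shift_chain ?A \<mu>s w = 0"
      unfolding D_def using spectrum_annihilates[of B] by auto
    have A: "norm (?A *v w) \<le> M * norm w" for w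
      using norm_map_matrix_of_real[OF B] M by simp
    \<comment> \<open>The eigenvalues are bounded by \<open>M\<close>, hence each shift has norm at most \<open>2 M\<close>.\<close>
    have mod: "cmod \<mu> \<le> M" if "\<mu> \<in> set \<mu>s" for \<mu>
    proof -
      have "\<mu> \<in> complex_spectrum B"
        using that \<mu>s(2) by (rule subsetD[rotated])
      then obtain w where w: "w \<noteq> 0" "?A *v w = \<mu> *s w"
        unfolding shifted_kernel shifted_def by auto
      then show ?thesis using A[of w] by (simp add: norm_vector_smult)
    qed
    have cv: "norm (cv x) = norm x" "cv (x + y) = cv x + cv y" 
      "cv (h *\<^sub>R x) = complex_of_real h *s cv x" "cv (B *v x) = ?A *v cv x" for x y h
      by (simp_all add: cv_def norm_vec_def L2_set_def vec_eq_iff matrix_vector_mult_def)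
    define N where "N x = chain_norm \<theta> ?A \<mu>s (cv x)" for x
    have "norm x \<le> N x" for x
      using norm_le_chain_norm[of \<theta> ?A \<mu>s "cv x"] \<theta> \<mu>s(3) by (simp add: N_def cv)
    moreover have "N x \<le> C * norm x" for x
    proof -
      have "N x \<le> (\<Sum>j<length \<mu>s. (2 * M * \<theta>) ^ j) * norm x"
        using chain_norm_le[of \<theta> M ?A \<mu>s "cv x"] \<theta> M A mod by (simp add: N_def cv)
      also have "\<dots> \<le> C * norm x"
        unfolding C_def using \<mu>s(1) \<theta> M by (intro mult_right_mono sum_mono2) auto
      finally show ?thesis .
    qed
    moreover have "N (x + y) \<le> N x + N y" for x y
      using chain_norm_triangle[of \<theta>] \<theta> by (simp add: N_def cv)
    moreover have "N (x + h *\<^sub>R (B *v x)) \<le> (1 - h * \<kappa> / 4) * N x" if h: "0 \<le> h" "h \<le> h0" for x h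
    proof -
      have hM: "h * M\<^sup>2 \<le> \<kappa> / 2"
        using h(2) M by (simp add: h0_def field_simps)
      have "chain_norm \<theta> ?A \<mu>s (cv x + complex_of_real h *s (?A *v cv x))
         \<le> ((1 - 3 / 4 * (h * \<kappa>)) + h / \<theta>) * N x - h / \<theta> * norm (cv x)"
        unfolding N_def using h hM \<theta> \<kappa> mod \<mu>s(2,3) spec
        by (intro chain_norm_Euler_step cmod_Euler_factor[of _ _ M]) auto
      also have "\<dots> \<le> ((1 - 3 / 4 * (h * \<kappa>)) + h / \<theta>) * N x"
        using h \<theta> by simp
      also have "(1 - 3 / 4 * (h * \<kappa>)) + h / \<theta> = 1 - h * \<kappa> / 4"
        using \<kappa> by (simp add: \<theta>_def field_simps)
      finally show ?thesis by (simp add: N_def cv)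
    qed
    ultimately show ?thesis unfolding contracting_norm_def by (intro exI[of _ N]) auto
  qed
  ultimately show ?thesis
    by (intro exI[of _ C] conjI exI[of _ h0]) auto
qed

section \<open>Comparison principles\<close>

text \<open>A continuous function that starts below \<open>B\<close> and is pushed back whenever it touches \<open>B\<close> stays below
  \<open>B\<close>: at the last time before a violation it would touch.\<close>
lemma barrier:
  fixes \<phi> B :: "real \<Rightarrow> real"
  assumes "continuous_on {a..b} \<phi>" "continuous_on {a..b} B" and init: "\<phi> a \<le> B a"
    and touch: "\<And>t. a \<le> t \<Longrightarrow> t < b \<Longrightarrow> \<phi> t = B t \<Longrightarrow>
      \<exists>d>0. \<forall>s. t < s \<and> s < t + d \<and> s \<le> b \<longrightarrow> \<phi> s \<le> B s"
    and t: "t \<in> {a..b}"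
  shows "\<phi> t \<le> B t"
proof (rule ccontr)
  assume neg: "\<not> \<phi> t \<le> B t"
  define D where "D s = \<phi> s - B s" for s
  have cont: "continuous_on {a..t} D"
    unfolding D_def using t assms(1,2)
    by (intro continuous_on_diff) (auto intro: continuous_on_subset)
  define S where "S = {a..t} \<inter> D -` {..0}"
  have "closed S"
    unfolding S_def using cont by (intro continuous_closed_preimage) auto
  moreover have "a \<in> S" using init t by (auto simp: S_def D_def)
  moreover have bdd: "bdd_above S" by (auto simp: S_def)
  ultimately have s: "Sup S \<in> S" by (intro closed_contains_Sup) auto
  define s where "s = Sup S"
  have s1: "a \<le> s" "s \<le> t" "D s \<le> 0" using s by (auto simp: S_def s_def)
  have "s < t" using s1 neg by (cases "s = t") (auto simp: D_def)
  have pos: "D r > 0" if "s < r" "r \<le> t" for r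
    using cSup_upper[OF _ bdd, of r] that s1 by (force simp: S_def s_def)
  have "D s = 0"
  proof (rule ccontr)
    assume "D s \<noteq> 0"
    with s1 have "D s < 0" by simp
    moreover have "continuous_on {s..t} D" using cont s1 by (auto intro: continuous_on_subset)
    moreover have "D t > 0" using pos[of t] \<open>s < t\<close> by simp
    ultimately obtain r where r: "s \<le> r" "r \<le> t" "D r = 0"
      using IVT'[of D s 0 t] \<open>s < t\<close> by auto
    with \<open>D s < 0\<close> have "s < r" by (cases "s = r") auto
    with pos[of r] r show False by simp
  qed
  then obtain d where d: "d > 0" "\<And>r. s < r \<Longrightarrow> r < s + d \<Longrightarrow> r \<le> b \<Longrightarrow> \<phi> r \<le> B r"
    using touch[of s] s1 \<open>s < t\<close> t by (auto simp: D_def)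
  define r where "r = min t (s + d/2)"
  have "s < r" "r < s + d" "r \<le> t" using d(1) \<open>s < t\<close> by (auto simp: r_def min_def)
  with d(2)[of r] pos[of r] t show False by (auto simp: D_def)
qed

lemma has_vector_derivative_expansion:
  assumes "(w has_vector_derivative w') (at t within S)" "e > 0"
  obtains d where "d > 0" "\<And>s. s \<in> S \<Longrightarrow> \<bar>s - t\<bar> < d \<Longrightarrow> norm (w s - w t - (s - t) *\<^sub>R w') \<le> e * \<bar>s - t\<bar>"
  using assms unfolding has_vector_derivative_def has_derivative_within_alt by auto

text \<open>Comparison for \<open>N (w t)\<close> when \<open>N\<close> is merely subadditive: its upper right derivative along
  \<open>w\<close> is replaced by a one-sided bound for Euler steps. The hypothesis on the derivative concerns
  times of contact, where \<open>w t\<close> is as small as \<open>B t\<close>; so an equation that holds only for small \<open>w\<close> can be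
  used without a separate bootstrap argument.\<close>
lemma barrier_along_curve:
  fixes w :: "real \<Rightarrow> 'a::real_normed_vector" and N :: "'a \<Rightarrow> real"
  assumes tri: "\<And>x y. N (x + y) \<le> N x + N y" and bd: "\<And>x. N x \<le> C * norm x" and C: "C > 0"
    and w: "\<And>t. t \<in> {a..b} \<Longrightarrow> (w has_vector_derivative w' t) (at t within {a..b})"
    and B: "\<And>t. t \<in> {a..b} \<Longrightarrow> (B has_vector_derivative B' t) (at t within {a..b})"
    and init: "N (w a) \<le> B a"
    and touch: "\<And>t. a \<le> t \<Longrightarrow> t < b \<Longrightarrow> N (w t) = B t \<Longrightarrow>
       \<exists>k<B' t. \<exists>h0>0. \<forall>h. 0 < h \<and> h \<le> h0 \<longrightarrow> N (w t + h *\<^sub>R w' t) \<le> N (w t) + h * k"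
    and t: "t \<in> {a..b}"
  shows "N (w t) \<le> B t"
proof (rule barrier[where \<phi> = "\<lambda>t. N (w t)" and B = B and a = a and b = b])
  have "\<bar>N x - N y\<bar> \<le> C * norm (x - y)" for x y
    using tri[of y "x - y"] tri[of x "y - x"] bd[of "x - y"] bd[of "y - x"]
    by (auto simp: norm_minus_commute)
  then have "C-lipschitz_on UNIV N"
    using C by (intro lipschitz_onI) (auto simp: dist_norm)
  then have "continuous_on UNIV N" by (rule lipschitz_on_continuous_on)
  moreover have "continuous_on {a..b} w"
    using w by (rule continuous_on_vector_derivative)
  ultimately show "continuous_on {a..b} (\<lambda>t. N (w t))"
    by (rule continuous_on_compose2) auto
  show "continuous_on {a..b} B"
    using B by (rule continuous_on_vector_derivative)
  fix t assume t: "a \<le> t" "t < b" "N (w t) = B t"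
  then obtain k h0 where k: "k < B' t" "h0 > 0"
    "\<And>h. 0 < h \<Longrightarrow> h \<le> h0 \<Longrightarrow> N (w t + h *\<^sub>R w' t) \<le> N (w t) + h * k"
    using touch by blast
  \<comment> \<open>The gap between \<open>k\<close> and \<open>B' t\<close> absorbs the remainders of both first-order expansions.\<close>
  define e where "e = (B' t - k) / (2 * (C + 1))"
  have e: "e > 0" using k C by (simp add: e_def)
  have "C * e + e \<le> B' t - k"
  proof -
    have "C * e + e = (C + 1) * e" by (simp add: algebra_simps)
    also have "\<dots> = (B' t - k) / 2"
      using C nonzero_mult_divide_mult_cancel_left[of "C + 1" "B' t - k" 2] by (simp add: e_def mult.commute)
    finally show ?thesis using k by simp
  qed
  obtain d1 where d1: "d1 > 0"
    "\<And>s. s \<in> {a..b} \<Longrightarrow> \<bar>s - t\<bar> < d1 \<Longrightarrow> norm (w s - w t - (s - t) *\<^sub>R w' t) \<le> e * \<bar>s - t\<bar>"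
    using has_vector_derivative_expansion[OF w[of t] e] t by auto
  obtain d2 where d2: "d2 > 0"
    "\<And>s. s \<in> {a..b} \<Longrightarrow> \<bar>s - t\<bar> < d2 \<Longrightarrow> norm (B s - B t - (s - t) *\<^sub>R B' t) \<le> e * \<bar>s - t\<bar>"
    using has_vector_derivative_expansion[OF B[of t] e] t by auto
  have "N (w s) \<le> B s" if s: "t < s" "s < t + min h0 (min d1 d2)" "s \<le> b" for s
  proof -
    define h where "h = s - t"
    have h: "0 < h" "h \<le> h0" using s by (auto simp: h_def)
    have "N (w s) \<le> N (w t + h *\<^sub>R w' t) + N (w s - w t - h *\<^sub>R w' t)"
      using tri[of "w t + h *\<^sub>R w' t" "w s - w t - h *\<^sub>R w' t"] by simp
    also have "N (w s - w t - h *\<^sub>R w' t) \<le> C * norm (w s - w t - h *\<^sub>R w' t)" by (rule bd)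
    also have "\<dots> \<le> C * (e * h)"
      using d1(2)[of s] s t C by (intro mult_left_mono) (auto simp: h_def)
    also have "N (w t + h *\<^sub>R w' t) \<le> N (w t) + h * k" using k h by auto
    finally have "N (w s) \<le> B t + h * (k + C * e)" using t by (simp add: algebra_simps)
    also have "h * (k + C * e) \<le> h * (B' t - e)"
      using \<open>C * e + e \<le> B' t - k\<close> h by (intro mult_left_mono) auto
    also have "B t + h * (B' t - e) \<le> B s"
    proof -
      have "\<bar>B s - B t - h * B' t\<bar> \<le> e * h" using d2(2)[of s] s t by (auto simp: h_def)
      then show ?thesis by (simp add: algebra_simps)
    qed
    finally show ?thesis by simp
  qed
  then show "\<exists>d>0. \<forall>s. t < s \<and> s < t + d \<and> s \<le> b \<longrightarrow> N (w s) \<le> B s"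
    using k(2) d1(1) d2(1) by (intro exI[of _ "min h0 (min d1 d2)"]) auto
qed (use assms in auto)

section \<open>Stability of linear equations\<close>

text \<open>In the norm \<open>N\<close> the perturbation \<open>\<delta>\<close> uses up half of the rate \<open>\<kappa> / 4\<close>. The forcing balances the remaining
  decay at the level \<open>8 C \<beta> / \<kappa>\<close>, which is doubled to obtain a strict barrier.\<close>
lemma frozen_decay:
  fixes A :: "real^'m^'m" and \<gamma> :: "real \<Rightarrow> real^'m"
  assumes contr: "contracting_norm A \<kappa> C h0 N"
    and pos: "C \<ge> 1" "h0 > 0" "\<kappa> > 0" "\<epsilon> > 0" "\<beta> > 0" "\<delta> \<ge> 0" "C * \<delta> \<le> \<kappa> / 8"
    and \<gamma>: "\<And>t. t \<in> {a..b} \<Longrightarrow> (\<gamma> has_vector_derivative \<gamma>' t) (at t within {a..b})"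
    and near: "\<And>t. t \<in> {a..b} \<Longrightarrow> norm (\<epsilon> *\<^sub>R \<gamma>' t - A *v \<gamma> t) \<le> \<delta> * norm (\<gamma> t) + \<beta>"
    and t: "t \<in> {a..b}"
  shows "norm (\<gamma> t) \<le> C * norm (\<gamma> a) * exp (- (\<kappa> / 8) * ((t - a) / \<epsilon>)) + 16 * C * \<beta> / \<kappa>"
proof -
  have N: "\<And>x. norm x \<le> N x" "\<And>x. N x \<le> C * norm x" "\<And>x y. N (x + y) \<le> N x + N y"
      "\<And>x h. 0 \<le> h \<Longrightarrow> h \<le> h0 \<Longrightarrow> N (x + h *\<^sub>R (A *v x)) \<le> (1 - h * \<kappa> / 4) * N x"
    using contr by (auto simp: contracting_norm_def)
  define m D where "m = N (\<gamma> a)" "D = 16 * C * \<beta> / \<kappa>"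
  define B where "B t = m * exp (- (\<kappa> / 8) * ((t - a) / \<epsilon>)) + D" for t
  define E where "E t = m * exp (- (\<kappa> / 8) * ((t - a) / \<epsilon>))" for t
  have "D > 0" using pos by (simp add: m_D_def)
  have "m \<ge> 0" using N(1)[of "\<gamma> a"] norm_ge_zero order.trans unfolding m_D_def by blast
  have "N (\<gamma> t) \<le> B t"
  proof (rule barrier_along_curve[where w = \<gamma> and B = B and N = N and C = C and a = a and b = b and w' = \<gamma>' and B' = "\<lambda>t. - (\<kappa> / 8) / \<epsilon> * E t"])
    show "(B has_vector_derivative - (\<kappa> / 8) / \<epsilon> * E t) (at t within {a..b})" for t
      unfolding B_def E_def has_real_derivative_iff_has_vector_derivative[symmetric]
      using pos(4) by (auto intro!: derivative_eq_intros simp: field_simps)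
    show "N (\<gamma> a) \<le> B a" using \<open>D > 0\<close> by (simp add: B_def m_D_def)
    fix t assume t: "a \<le> t" "t < b" "N (\<gamma> t) = B t"
    define r where "r = \<epsilon> *\<^sub>R \<gamma>' t - A *v \<gamma> t"
    define k where "k = (- (\<kappa> / 8) * N (\<gamma> t) + C * \<beta>) / \<epsilon>"
    have "N (\<gamma> t + h *\<^sub>R \<gamma>' t) \<le> N (\<gamma> t) + h * k" if h: "0 < h" "h \<le> \<epsilon> * h0" for h
    proof -
      define h' where "h' = h / \<epsilon>"
      have h': "0 \<le> h'" "h' \<le> h0" "h = h' * \<epsilon>" using h pos by (auto simp: h'_def field_simps)
      have "\<gamma> t + h *\<^sub>R \<gamma>' t = (\<gamma> t + h' *\<^sub>R (A *v \<gamma> t)) + h' *\<^sub>R r"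
        by (simp add: r_def h'(3) algebra_simps)
      then have "N (\<gamma> t + h *\<^sub>R \<gamma>' t) \<le> N (\<gamma> t + h' *\<^sub>R (A *v \<gamma> t)) + N (h' *\<^sub>R r)"
        using N(3) by metis
      also have "\<dots> \<le> (1 - h' * \<kappa> / 4) * N (\<gamma> t) + C * norm (h' *\<^sub>R r)"
        using h' by (intro add_mono N)
      also have "norm (h' *\<^sub>R r) = h' * norm r" using h' by simp
      also have "C * (h' * norm r) \<le> C * (h' * (\<delta> * N (\<gamma> t) + \<beta>))"
        using near[of t] t(1,2) N(1)[of "\<gamma> t"] pos h' mult_left_mono[OF N(1)[of "\<gamma> t"], of \<delta>]
        unfolding r_def by (intro mult_left_mono) auto
      also have "\<dots> = h' * ((C * \<delta>) * N (\<gamma> t) + C * \<beta>)" by (simp add: algebra_simps)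
      also have "\<dots> \<le> h' * (\<kappa> / 8 * N (\<gamma> t) + C * \<beta>)"
        using pos h' N(1)[of "\<gamma> t"] order.trans[OF norm_ge_zero N(1)]
        by (intro mult_left_mono add_mono mult_right_mono) auto
      also have "(1 - h' * \<kappa> / 4) * N (\<gamma> t) + h' * (\<kappa> / 8 * N (\<gamma> t) + C * \<beta>) = N (\<gamma> t) + h * k"
        using pos by (simp add: k_def h'(3) field_simps)
      finally show ?thesis by simp
    qed
    moreover have "k < - (\<kappa> / 8) / \<epsilon> * E t"
    proof -
      have "- (\<kappa> / 8) * N (\<gamma> t) + C * \<beta> = - (\<kappa> / 8) * E t - C * \<beta>"
        using pos by (simp add: t(3) B_def E_def m_D_def field_simps)
      also have "\<dots> < - (\<kappa> / 8) * E t" using pos by simp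
      finally have "k < (- (\<kappa> / 8) * E t) / \<epsilon>"
        unfolding k_def using pos(4) by (rule divide_strict_right_mono)
      then show ?thesis by simp
    qed
    ultimately show "\<exists>k<(- (\<kappa> / 8) / \<epsilon> * E t). \<exists>h0>0. \<forall>h. 0 < h \<and> h \<le> h0 \<longrightarrow>
        N (\<gamma> t + h *\<^sub>R \<gamma>' t) \<le> N (\<gamma> t) + h * k"
      using mult_pos_pos[OF pos(4,2)] by blast
  qed (use N pos \<gamma> t in auto)
  also have "B t \<le> C * norm (\<gamma> a) * exp (- (\<kappa> / 8) * ((t - a) / \<epsilon>)) + D"
    unfolding B_def m_D_def using N(2) by (intro add_mono mult_right_mono) auto
  finally show ?thesis using N(1)[of "\<gamma> t"] by (simp add: m_D_def)
qed

text \<open>The adapted norm may change with \<open>G\<close> in an uncontrolled way, at the price of a factor \<open>C\<close> for each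
  change. On intervals of length \<open>\<epsilon> T\<close> with \<open>T\<close> large the exponential decay in the norm of the left
  endpoint outweighs this factor, and the values at the interval endpoints stay bounded.\<close>
lemma slowly_varying_stability:
  fixes \<kappa> M :: real
  assumes \<kappa>: "\<kappa> > 0" and M: "M > 0"
  shows "\<exists>C\<ge>1. \<exists>\<delta>>0. \<exists>T>0. \<forall>(G :: real \<Rightarrow> real^'m^'m) \<gamma> \<gamma>' a b \<epsilon> \<beta>.
      (\<forall>t\<in>{a..b}. \<forall>x. norm (G t *v x) \<le> M * norm x) \<and>
      (\<forall>t\<in>{a..b}. \<forall>z\<in>complex_spectrum (G t). Re z \<le> - \<kappa>) \<and>
      \<epsilon> > 0 \<and> \<beta> > 0 \<and>
      (\<forall>t\<in>{a..b}. (\<gamma> has_vector_derivative \<gamma>' t) (at t within {a..b})) \<and>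
      (\<forall>s\<in>{a..b}. \<forall>t\<in>{a..b}. \<bar>t - s\<bar> \<le> \<epsilon> * T \<longrightarrow>
         norm (\<epsilon> *\<^sub>R \<gamma>' t - G s *v \<gamma> t) \<le> \<delta> * norm (\<gamma> t) + \<beta>) \<longrightarrow>
      (\<forall>t\<in>{a..b}. norm (\<gamma> t) \<le> C * (norm (\<gamma> a) + \<beta>))"
proof -
  obtain C h0 where C: "C \<ge> 1" "h0 > 0"
    "\<forall>B :: real^'m^'m.
       (\<forall>x. norm (B *v x) \<le> M * norm x) \<and> (\<forall>z\<in>complex_spectrum B. Re z \<le> - \<kappa>) \<longrightarrow>
       (\<exists>N. contracting_norm B \<kappa> C h0 N)"
    using adapted_norm[OF assms] by blast
  define \<delta> where "\<delta> = \<kappa> / (8 * C)"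
  \<comment> \<open>With this \<open>T\<close> the total factor \<open>C exp (- \<kappa> T / 8)\<close> over one interval is one half.\<close>
  define T where "T = 8 / \<kappa> * ln (2 * C)"
  define D where "D = 16 * C / \<kappa>"
  have \<delta>: "\<delta> > 0" "C * \<delta> \<le> \<kappa> / 8" using \<kappa> C by (auto simp: \<delta>_def)
  have T: "T > 0" "C * exp (- (\<kappa> / 8) * T) = 1/2"
    using \<kappa> C by (auto simp: T_def exp_minus field_simps)
  have D: "D > 0" using C \<kappa> by (simp add: D_def)
  have "norm (\<gamma> t) \<le> (C * (1 + 2 * D) + D) * (norm (\<gamma> a) + \<beta>)"
    if M': "\<And>t x. t \<in> {a..b} \<Longrightarrow> norm (G t *v x) \<le> M * norm x"
    and spec: "\<And>t z. t \<in> {a..b} \<Longrightarrow> z \<in> complex_spectrum (G t) \<Longrightarrow> Re z \<le> - \<kappa>"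
    and \<epsilon>: "\<epsilon> > 0" and \<beta>: "\<beta> > 0"
    and \<gamma>: "\<And>t. t \<in> {a..b} \<Longrightarrow> (\<gamma> has_vector_derivative \<gamma>' t) (at t within {a..b})"
    and near: "\<And>s t. s \<in> {a..b} \<Longrightarrow> t \<in> {a..b} \<Longrightarrow> \<bar>t - s\<bar> \<le> \<epsilon> * T \<Longrightarrow>
         norm (\<epsilon> *\<^sub>R \<gamma>' t - G s *v \<gamma> t) \<le> \<delta> * norm (\<gamma> t) + \<beta>"
    and t: "t \<in> {a..b}"
    for G :: "real \<Rightarrow> real^'m^'m" and \<gamma> \<gamma>' a b \<epsilon> \<beta> t
  proof -
    have step: "norm (\<gamma> t) \<le> C * norm (\<gamma> s) * exp (- (\<kappa> / 8) * ((t - s) / \<epsilon>)) + D * \<beta>"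
      if st: "s \<in> {a..b}" "t \<in> {s..b}" "t \<le> s + \<epsilon> * T" for s t
    proof -
      have "\<exists>N. contracting_norm (G s) \<kappa> C h0 N"
        using M'[of s] spec[of s] st by (intro C(3)[rule_format]) auto
      then obtain N where N: "contracting_norm (G s) \<kappa> C h0 N" by blast
      have "norm (\<gamma> t) \<le> C * norm (\<gamma> s) * exp (- (\<kappa> / 8) * ((t - s) / \<epsilon>)) + 16 * C * \<beta> / \<kappa>"
      proof (rule frozen_decay[where N = N and \<gamma> = \<gamma> and a = s and A = "G s" and \<gamma>' = \<gamma>' and b = t and \<delta> = \<delta> and ?h0.0 = h0])
        show "(\<gamma> has_vector_derivative \<gamma>' r) (at r within {s..t})" if "r \<in> {s..t}" for r
          using \<gamma>[of r] that st by (auto intro: has_vector_derivative_within_subset)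
        show "norm (\<epsilon> *\<^sub>R \<gamma>' r - G s *v \<gamma> r) \<le> \<delta> * norm (\<gamma> r) + \<beta>" if "r \<in> {s..t}" for r
          using near[of s r] that st by auto
      qed (use N C(1,2) \<kappa> \<epsilon> \<beta> \<delta> st in auto)
      then show ?thesis by (simp add: D_def)
    qed
    define m where "m = norm (\<gamma> a) + 2 * D * \<beta>"
    have grid: "norm (\<gamma> (a + real k * (\<epsilon> * T))) \<le> m" if "a + real k * (\<epsilon> * T) \<le> b" for k
      using that
    proof (induction k)
      case 0
      then show ?case using D \<beta> by (simp add: m_def)
    next
      case (Suc k)
      let ?s = "a + real k * (\<epsilon> * T)"
      have pos: "\<epsilon> * T > 0" using \<epsilon> T by simp
      have eq: "a + real (Suc k) * (\<epsilon> * T) = ?s + \<epsilon> * T" by (simp add: algebra_simps)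
      have IH: "norm (\<gamma> ?s) \<le> m" using Suc eq pos by auto
      have "norm (\<gamma> (?s + \<epsilon> * T)) \<le> C * norm (\<gamma> ?s) * exp (- (\<kappa> / 8) * ((?s + \<epsilon> * T - ?s) / \<epsilon>)) + D * \<beta>"
        using Suc(2) eq pos by (intro step) auto
      also have "(?s + \<epsilon> * T - ?s) / \<epsilon> = T" using \<epsilon> by simp
      also have "C * norm (\<gamma> ?s) * exp (- (\<kappa> / 8) * T) = (C * exp (- (\<kappa> / 8) * T)) * norm (\<gamma> ?s)" by simp
      also have "\<dots> = norm (\<gamma> ?s) / 2" unfolding T(2) by simp
      also have "\<dots> + D * \<beta> \<le> m"
        using IH norm_ge_zero[of "\<gamma> a"] unfolding m_def by linarith
      finally show ?case unfolding eq .
    qed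
    define k where "k = nat \<lfloor>(t - a) / (\<epsilon> * T)\<rfloor>"
    have pos: "\<epsilon> * T > 0" using \<epsilon> T by simp
    have "real k = \<lfloor>(t - a) / (\<epsilon> * T)\<rfloor>" using t pos by (simp add: k_def)
    then have "real k \<le> (t - a) / (\<epsilon> * T)" "(t - a) / (\<epsilon> * T) \<le> real k + 1" by linarith+
    then have k: "a + real k * (\<epsilon> * T) \<le> t" "t \<le> a + real k * (\<epsilon> * T) + \<epsilon> * T"
      using pos by (simp_all add: field_simps)
    let ?s = "a + real k * (\<epsilon> * T)"
    have "norm (\<gamma> t) \<le> C * norm (\<gamma> ?s) * exp (- (\<kappa> / 8) * ((t - ?s) / \<epsilon>)) + D * \<beta>"
      using k t pos by (intro step) auto
    also have "\<dots> \<le> C * m * 1 + D * \<beta>"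
    proof (intro add_mono mult_mono order.refl)
      show "norm (\<gamma> ?s) \<le> m" using grid[of k] k t by auto
      show "exp (- (\<kappa> / 8) * ((t - ?s) / \<epsilon>)) \<le> 1" using k \<epsilon> \<kappa> by simp
      show "0 \<le> C * m" using C D \<beta> by (simp add: m_def)
    qed (use C D \<beta> in auto)
    finally have le: "norm (\<gamma> t) \<le> C * m * 1 + D * \<beta>" .
    have eq: "C * m * 1 + D * \<beta> + ((2 * C * D + D) * norm (\<gamma> a) + C * \<beta>) = (C * (1 + 2 * D) + D) * (norm (\<gamma> a) + \<beta>)"
      by (simp add: m_def algebra_simps)
    have "C * m * 1 + D * \<beta> \<le> (C * (1 + 2 * D) + D) * (norm (\<gamma> a) + \<beta>)"
    proof -
      have "0 \<le> (2 * C * D + D) * norm (\<gamma> a) + C * \<beta>" using C D \<beta> by (simp add: add_nonneg_nonneg)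
      with eq show ?thesis by linarith
    qed
    with le show ?thesis by linarith
  qed
  note bound = this
  have "1 \<le> C * (1 + 2 * D) + D"
  proof -
    have "C * (1 + 2 * D) \<ge> 1 * 1" using C D by (intro mult_mono) auto
    then show ?thesis using D by linarith
  qed
  show ?thesis
  proof (rule exI[of _ "C * (1 + 2 * D) + D"], rule conjI, fact, rule exI[of _ \<delta>], rule conjI, fact,
      rule exI[of _ T], rule conjI, fact, intro allI impI ballI, goal_cases)
    case (1 G \<gamma> \<gamma>' a b \<epsilon> \<beta> t)
    then show ?case by (intro bound[of a b G \<epsilon> \<beta> \<gamma> \<gamma>' t]) blast+
  qed
qed

text \<open>Variation of constants: \<open>\<psi> s = Y b (Y s)\<^sup>-\<^sup>1 x s\<close> moves only because of the forcing, with speed at most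
  \<open>K exp (- \<alpha> (b - s)) \<beta>\<close>. The dichotomy bounds the increments of \<open>\<psi>\<close> directly, which avoids differentiating
  the inverse of \<open>Y\<close>; the factor 3 leaves room for the error terms of this discrete estimate.\<close>
lemma exponential_stability_with_forcing:
  fixes J Y :: "real \<Rightarrow> real^'n^'n" and x x' :: "real \<Rightarrow> real^'n"
  assumes Y: "fundamental_matrix J Y"
    and K: "K > 0" "\<alpha> > 0"
      "\<And>s t. 0 \<le> s \<Longrightarrow> s \<le> t \<Longrightarrow> onorm ((*v) (Y t ** matrix_inv (Y s))) \<le> K * exp (- \<alpha> * (t - s))"
    and ab: "0 \<le> a" "a \<le> b"
    and x: "\<And>t. t \<in> {a..b} \<Longrightarrow> (x has_vector_derivative x' t) (at t within {a..b})"
    and \<beta>: "\<beta> > 0" "\<And>t. t \<in> {a..b} \<Longrightarrow> norm (x' t - J t *v x t) \<le> \<beta>"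
  shows "norm (x b) \<le> K * norm (x a) + 3 * K * \<beta> / \<alpha>"
proof -
  define W where "W t = matrix_inv (Y t)" for t
  have WY: "W t ** Y t = mat 1" "Y t ** W t = mat 1" if "t \<ge> 0" for t
  proof -
    have "\<exists>B. Y t ** B = mat 1 \<and> B ** Y t = mat 1"
      using Y that by (auto simp: fundamental_matrix_def invertible_def)
    from someI_ex[OF this] show "W t ** Y t = mat 1" "Y t ** W t = mat 1"
      by (auto simp: W_def matrix_inv_def)
  qed
  have KW: "norm (Y t *v (W s *v z)) \<le> K * exp (- \<alpha> * (t - s)) * norm z" if "0 \<le> s" "s \<le> t" for s t z
  proof -
    have "norm ((Y t ** W s) *v z) \<le> onorm ((*v) (Y t ** W s)) * norm z"
      by (rule onorm) (rule matrix_vector_mul_bounded_linear)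
    also have "\<dots> \<le> K * exp (- \<alpha> * (t - s)) * norm z"
      using K(3)[OF that] by (intro mult_right_mono) (auto simp: W_def)
    finally show ?thesis by (simp add: matrix_vector_mul_assoc)
  qed
  define \<psi> where "\<psi> s = Y b *v (W s *v x s)" for s
  have diff: "\<psi> s - \<psi> t = Y b *v (W s *v (x s - Y s *v (W t *v x t)))" if "s \<ge> 0" "t \<ge> 0" for s t
  proof -
    have "W s *v (Y s *v (W t *v x t)) = W t *v x t"
      using WY(1)[OF that(1)] by (metis matrix_vector_mul_assoc matrix_vector_mul_lid)
    then show ?thesis by (simp add: \<psi>_def matrix_vector_mult_diff_distrib)
  qed
  have bracket: "((\<lambda>s. x s - Y s *v (W t *v x t)) has_vector_derivative x' t - J t *v x t) (at t within {a..b})"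
    if t: "t \<in> {a..b}" for t
  proof -
    have "bounded_linear (\<lambda>M. M *v (W t *v x t))"
      by (subst linear_conv_bounded_linear[symmetric])
         (simp add: linear_iff matrix_vector_mult_add_rdistrib scaleR_matrix_vector_assoc)
    moreover have "(Y has_vector_derivative J t ** Y t) (at t within {a..b})"
    proof (rule has_vector_derivative_within_subset)
      show "(Y has_vector_derivative J t ** Y t) (at t within {0..})"
        using Y t ab unfolding fundamental_matrix_def by auto
    qed (use ab in auto)
    ultimately have "((\<lambda>s. Y s *v (W t *v x t)) has_vector_derivative (J t ** Y t) *v (W t *v x t)) (at t within {a..b})"
      by (rule bounded_linear.has_vector_derivative)
    also have "(J t ** Y t) *v (W t *v x t) = J t *v x t"
      using WY(2)[of t] t ab by (simp add: matrix_vector_mul_assoc matrix_mul_assoc[symmetric])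
    finally show ?thesis using x[OF t] by (intro has_vector_derivative_diff)
  qed
  have bracket0: "x t - Y t *v (W t *v x t) = 0" if "t \<in> {a..b}" for t
    using WY(2)[of t] that ab by (simp add: matrix_vector_mul_assoc)
  have small: "\<exists>d>0. \<forall>s\<in>{a..b}. \<bar>s - t\<bar> < d \<longrightarrow>
      norm (\<psi> s - \<psi> t) \<le> K * exp (- \<alpha> * (b - s)) * (2 * \<beta> * \<bar>s - t\<bar>)" if t: "t \<in> {a..b}" for t
  proof -
    obtain d where d: "d > 0" "\<And>s. s \<in> {a..b} \<Longrightarrow> \<bar>s - t\<bar> < d \<Longrightarrow>
       norm (x s - Y s *v (W t *v x t) - (s - t) *\<^sub>R (x' t - J t *v x t)) \<le> \<beta> * \<bar>s - t\<bar>"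
      using has_vector_derivative_expansion[OF bracket[OF t] \<beta>(1)] bracket0[OF t]
      by (metis diff_zero)
    have "norm (\<psi> s - \<psi> t) \<le> K * exp (- \<alpha> * (b - s)) * (2 * \<beta> * \<bar>s - t\<bar>)"
      if s: "s \<in> {a..b}" "\<bar>s - t\<bar> < d" for s
    proof -
      have "norm (x s - Y s *v (W t *v x t)) \<le> norm ((s - t) *\<^sub>R (x' t - J t *v x t)) + \<beta> * \<bar>s - t\<bar>"
        using norm_triangle_sub[of "x s - Y s *v (W t *v x t)" "(s - t) *\<^sub>R (x' t - J t *v x t)"] d(2)[OF s]
        by simp
      also have "norm ((s - t) *\<^sub>R (x' t - J t *v x t)) \<le> \<bar>s - t\<bar> * \<beta>"
        using \<beta>(2)[OF t] by (simp add: mult_left_mono)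
      finally have *: "norm (x s - Y s *v (W t *v x t)) \<le> 2 * \<beta> * \<bar>s - t\<bar>" by simp
      have "norm (\<psi> s - \<psi> t) \<le> K * exp (- \<alpha> * (b - s)) * norm (x s - Y s *v (W t *v x t))"
        using diff[of s t] KW[of s b] s t ab by simp
      also have "\<dots> \<le> K * exp (- \<alpha> * (b - s)) * (2 * \<beta> * \<bar>s - t\<bar>)"
        using * K(1) by (intro mult_left_mono) auto
      finally show ?thesis .
    qed
    then show ?thesis using d(1) by blast
  qed
  have cont: "continuous_on {a..b} \<psi>"
    unfolding continuous_on_iff
  proof (intro ballI allI impI)
    fix t e :: real assume t: "t \<in> {a..b}" and e: "e > 0"
    obtain d where d: "d > 0" "\<And>s. s \<in> {a..b} \<Longrightarrow> \<bar>s - t\<bar> < d \<Longrightarrow>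
      norm (\<psi> s - \<psi> t) \<le> K * exp (- \<alpha> * (b - s)) * (2 * \<beta> * \<bar>s - t\<bar>)"
      using small[OF t] by blast
    define d' where "d' = min d (e / (2 * K * \<beta>))"
    have "dist (\<psi> s) (\<psi> t) < e" if s: "s \<in> {a..b}" "dist s t < d'" for s
    proof -
      have "norm (\<psi> s - \<psi> t) \<le> K * exp (- \<alpha> * (b - s)) * (2 * \<beta> * \<bar>s - t\<bar>)"
        using d s by (auto simp: d'_def dist_real_def)
      also have "\<dots> \<le> K * 1 * (2 * \<beta> * \<bar>s - t\<bar>)"
        using K \<beta>(1) s by (intro mult_mono) auto
      also have "\<dots> < e"
        using s K \<beta>(1) by (simp add: d'_def dist_real_def field_simps)
      finally show ?thesis by (simp add: dist_norm)
    qed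
    then show "\<exists>d>0. \<forall>s\<in>{a..b}. dist s t < d \<longrightarrow> dist (\<psi> s) (\<psi> t) < e"
      using d(1) e K \<beta>(1) by (intro exI[of _ d']) (auto simp: d'_def)
  qed
  define B where "B s = 3 * K * \<beta> / \<alpha> * exp (- \<alpha> * (b - s))" for s
  have "norm (\<psi> b - \<psi> a) \<le> B b"
  proof (rule barrier[where \<phi> = "\<lambda>s. norm (\<psi> s - \<psi> a)" and B = B and a = a and b = b])
    show "continuous_on {a..b} (\<lambda>s. norm (\<psi> s - \<psi> a))"
      using cont by (intro continuous_intros)
    show "continuous_on {a..b} B" unfolding B_def by (intro continuous_intros)
    show "norm (\<psi> a - \<psi> a) \<le> B a" using K \<beta>(1) by (simp add: B_def)
    fix t assume t: "a \<le> t" "t < b" "norm (\<psi> t - \<psi> a) = B t"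
    obtain d where d: "d > 0" "\<And>s. s \<in> {a..b} \<Longrightarrow> \<bar>s - t\<bar> < d \<Longrightarrow>
      norm (\<psi> s - \<psi> t) \<le> K * exp (- \<alpha> * (b - s)) * (2 * \<beta> * \<bar>s - t\<bar>)"
      using small[of t] t by auto
    have "norm (\<psi> s - \<psi> a) \<le> B s" if s: "t < s" "s < t + min d (1 / (2 * \<alpha>))" "s \<le> b" for s
    proof -
      define h where "h = s - t"
      have "h < 1 / (2 * \<alpha>)" using s by (auto simp: h_def)
      then have h: "0 < h" "h < d" "\<alpha> * h \<le> 1/2" using s K(2) by (auto simp: h_def field_simps)
      have "norm (\<psi> s - \<psi> a) \<le> norm (\<psi> t - \<psi> a) + norm (\<psi> s - \<psi> t)"
        using norm_triangle_ineq[of "\<psi> t - \<psi> a" "\<psi> s - \<psi> t"] by simp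
      also have "\<dots> \<le> B t + K * exp (- \<alpha> * (b - s)) * (2 * \<beta> * h)"
        using d(2)[of s] s t by (auto simp: h_def)
      also have "B t = exp (- (\<alpha> * h)) * B s"
        by (simp add: B_def h_def exp_add[symmetric] algebra_simps)
      also have "K * exp (- \<alpha> * (b - s)) * (2 * \<beta> * h) = 2/3 * (\<alpha> * h) * B s"
        using K(2) by (simp add: B_def)
      also have "exp (- (\<alpha> * h)) * B s \<le> (1 / (1 + \<alpha> * h)) * B s"
      proof (rule mult_right_mono)
        have "0 < 1 + \<alpha> * h" using K h by (simp add: add_pos_nonneg)
        then show "exp (- (\<alpha> * h)) \<le> 1 / (1 + \<alpha> * h)"
          using exp_ge_add_one_self[of "\<alpha> * h"] by (simp add: exp_minus inverse_eq_divide frac_le)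
      qed (use K \<beta>(1) in \<open>simp add: B_def\<close>)
      also have "1 / (1 + \<alpha> * h) * B s + 2/3 * (\<alpha> * h) * B s = (1 / (1 + \<alpha> * h) + 2/3 * (\<alpha> * h)) * B s"
        by (simp add: algebra_simps)
      also have "\<dots> \<le> 1 * B s"
      proof (intro mult_right_mono)
        define y where "y = \<alpha> * h"
        have y: "0 < y" "y \<le> 1/2" using h K by (auto simp: y_def)
        have "y * y \<le> 1/2 * y" using y by (intro mult_right_mono) auto
        then show "1 / (1 + \<alpha> * h) + 2/3 * (\<alpha> * h) \<le> 1"
          unfolding y_def[symmetric] using y by (simp add: field_simps)
      qed (use K \<beta>(1) in \<open>auto simp: B_def\<close>)
      finally show ?thesis by simp
    qed
    then show "\<exists>d>0. \<forall>s. t < s \<and> s < t + d \<and> s \<le> b \<longrightarrow> norm (\<psi> s - \<psi> a) \<le> B s"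
      using d(1) K by (intro exI[of _ "min d (1 / (2 * \<alpha>))"]) auto
  qed (use ab in auto)
  moreover have "\<psi> b = x b" using bracket0[of b] ab by (simp add: \<psi>_def)
  moreover have "norm (\<psi> a) \<le> K * norm (x a)"
  proof -
    have "norm (\<psi> a) \<le> K * exp (- \<alpha> * (b - a)) * norm (x a)"
      unfolding \<psi>_def using KW[of a b] ab by simp
    also have "\<dots> \<le> K * 1 * norm (x a)"
      using K ab by (intro mult_right_mono mult_left_mono) auto
    finally show ?thesis by simp
  qed
  moreover have "norm (\<psi> b) \<le> norm (\<psi> b - \<psi> a) + norm (\<psi> a)"
    by (metis norm_triangle_ineq diff_add_cancel)
  ultimately show ?thesis by (simp add: B_def)
qed

section \<open>Quantitative regularity of the right-hand side\<close>

text \<open>One constant for all estimates in a ball. The derivative in \<open>x\<close> is Hoelder continuous with exponent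
  one half in \<open>t\<close> and \<open>\<epsilon>\<close>, because mixed derivatives need not exist.\<close>
definition regular_on_ball ::
    "real \<Rightarrow> real \<Rightarrow> real \<Rightarrow> ('x::euclidean_space \<Rightarrow> real \<Rightarrow> real \<Rightarrow> 'y::euclidean_space) \<Rightarrow>
     ('x \<Rightarrow> real \<Rightarrow> real \<Rightarrow> 'x \<Rightarrow>\<^sub>L 'y) \<Rightarrow> ('x \<Rightarrow> real \<Rightarrow> real \<Rightarrow> 'y) \<Rightarrow> bool" where
  "regular_on_ball e R L F D Dt \<longleftrightarrow>
     (\<forall>x\<in>cball 0 R. \<forall>t\<ge>0. \<forall>\<epsilon>\<in>{0..e}.
        norm (F x t \<epsilon>) \<le> L \<and> norm (D x t \<epsilon>) \<le> L \<and> norm (Dt x t \<epsilon>) \<le> L \<and>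
        ((\<lambda>y. F y t \<epsilon>) has_derivative blinfun_apply (D x t \<epsilon>)) (at x) \<and>
        ((\<lambda>s. F x s \<epsilon>) has_vector_derivative Dt x t \<epsilon>) (at t within {0..})) \<and>
     (\<forall>x\<in>cball 0 R. \<forall>x'\<in>cball 0 R. \<forall>t\<ge>0. \<forall>t'\<ge>0. \<forall>\<epsilon>\<in>{0..e}. \<forall>\<epsilon>'\<in>{0..e}.
        norm (F x t \<epsilon> - F x' t' \<epsilon>') \<le> L * (norm (x - x') + \<bar>t - t'\<bar> + \<bar>\<epsilon> - \<epsilon>'\<bar>) \<and>
        norm (D x t \<epsilon> - D x' t' \<epsilon>') \<le> L * (norm (x - x') + sqrt \<bar>t - t'\<bar> + sqrt \<bar>\<epsilon> - \<epsilon>'\<bar>)) \<and>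
     (\<forall>x\<in>cball 0 R. \<forall>x'\<in>cball 0 R. \<forall>t\<ge>0. \<forall>\<epsilon>\<in>{0..e}.
        norm (F x' t \<epsilon> - F x t \<epsilon> - D x t \<epsilon> (x' - x)) \<le> L * (norm (x' - x))\<^sup>2)"

text \<open>Two functions that differ by \<open>\<delta>\<close> and have a quadratic Taylor remainder have derivatives that differ by
  a multiple of \<open>\<surd>\<delta>\<close>: compare difference quotients with step \<open>\<surd>\<delta>\<close>.\<close>
lemma derivative_interpolation:
  fixes P Q :: "'x::real_normed_vector \<Rightarrow> 'y::real_normed_vector" and A B :: "'x \<Rightarrow>\<^sub>L 'y"
  assumes P: "\<And>u. norm u \<le> 1 \<Longrightarrow> norm (P (x + u) - P x - A u) \<le> \<Lambda> * (norm u)\<^sup>2"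
    and Q: "\<And>u. norm u \<le> 1 \<Longrightarrow> norm (Q (x + u) - Q x - B u) \<le> \<Lambda> * (norm u)\<^sup>2"
    and PQ: "\<And>u. norm u \<le> 1 \<Longrightarrow> norm (P (x + u) - Q (x + u)) \<le> \<Lambda> * \<delta>"
    and \<delta>: "0 < \<delta>" "\<delta> \<le> 1" and \<Lambda>: "0 \<le> \<Lambda>"
  shows "norm (A - B) \<le> 4 * \<Lambda> * sqrt \<delta>"
proof (rule norm_blinfun_bound)
  fix k :: 'x
  show "norm (blinfun_apply (A - B) k) \<le> 4 * \<Lambda> * sqrt \<delta> * norm k"
  proof (cases "k = 0")
    case False
    define u where "u = (sqrt \<delta> / norm k) *\<^sub>R k"
    have u: "norm u = sqrt \<delta>" "norm u \<le> 1" using False \<delta> by (auto simp: u_def)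
    have eq: "blinfun_apply (A - B) u = (Q (x + u) - Q x - B u) - (P (x + u) - P x - A u)
        + (P (x + u) - Q (x + u)) - (P (x + 0) - Q (x + 0))"
      by (simp add: blinfun.diff_left)
    have "norm (blinfun_apply (A - B) u) \<le> \<Lambda> * (norm u)\<^sup>2 + \<Lambda> * (norm u)\<^sup>2 + \<Lambda> * \<delta> + \<Lambda> * \<delta>"
    proof -
      have "norm (b - a + c - d) \<le> norm b + norm a + norm c + norm d" for a b c d :: 'y
        using norm_triangle_ineq4[of "b - a + c" d] norm_triangle_ineq[of "b - a" c] norm_triangle_ineq4[of b a]
        by linarith
      then show ?thesis
        unfolding eq by (rule order.trans) (use P[OF u(2)] Q[OF u(2)] PQ[OF u(2)] PQ[of 0] in auto)
    qed
    also have "\<dots> = 4 * \<Lambda> * \<delta>" using u(1) \<delta> by simp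
    finally have "norm (blinfun_apply (A - B) u) \<le> 4 * \<Lambda> * \<delta>" .
    moreover have "norm (blinfun_apply (A - B) u) = sqrt \<delta> / norm k * norm (blinfun_apply (A - B) k)"
      using \<delta> by (simp add: u_def blinfun.scaleR_right)
    ultimately have "sqrt \<delta> * norm (blinfun_apply (A - B) k) \<le> 4 * \<Lambda> * \<delta> * norm k"
      using False by (simp add: field_simps)
    also have "4 * \<Lambda> * \<delta> * norm k = 4 * \<Lambda> * (sqrt \<delta> * sqrt \<delta>) * norm k"
      using \<delta> by (simp only: real_sqrt_mult_self abs_of_pos)
    also have "\<dots> = sqrt \<delta> * (4 * \<Lambda> * sqrt \<delta> * norm k)" by (simp only: ac_simps)
    finally show ?thesis
      by (rule mult_left_le_imp_le) (use \<delta> in simp)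
  qed (simp add: blinfun.zero_right)
qed (use assms in auto)

lemma locally_uniformly_bounded_cball:
  assumes "locally_uniformly_bounded e (G :: 'x::euclidean_space \<Rightarrow> real \<Rightarrow> real \<Rightarrow> 'y::real_normed_vector)"
  shows "\<exists>b. \<forall>x\<in>cball 0 R. \<forall>t\<ge>0. \<forall>\<epsilon>\<in>{0..e}. norm (G x t \<epsilon>) \<le> b"
proof -
  have "bounded {G x t \<epsilon> | x t \<epsilon>. x \<in> cball 0 R \<and> 0 \<le> t \<and> \<epsilon> \<in> {0..e}}"
    using assms bounded_cball unfolding locally_uniformly_bounded_def by blast
  then obtain b where b: "\<And>y. y \<in> {G x t \<epsilon> | x t \<epsilon>. x \<in> cball 0 R \<and> 0 \<le> t \<and> \<epsilon> \<in> {0..e}} \<Longrightarrow> norm y \<le> b"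
    unfolding bounded_iff by auto
  show ?thesis
    by (intro exI[of _ b] ballI allI impI b) auto
qed

text \<open>Mean value inequalities in a ball that is larger by one, except for the Hoelder bound, which comes from the
  interpolation above. The derivatives themselves serve all radii.\<close>
lemma C3_C1_bounded_regular:
  fixes F :: "'x::euclidean_space \<Rightarrow> real \<Rightarrow> real \<Rightarrow> 'y::euclidean_space"
  assumes "C3_C1_bounded e F"
  shows "\<exists>D Dt. \<forall>R\<ge>0. \<exists>L\<ge>1. regular_on_ball e R L F D Dt"
proof -
  obtain D D2 D3 Dt De where
    der: "\<And>x t \<epsilon>. t \<ge> 0 \<Longrightarrow> \<epsilon> \<in> {0..e} \<Longrightarrow>
          ((\<lambda>y. F y t \<epsilon>) has_derivative blinfun_apply (D x t \<epsilon>)) (at x) \<and>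
          ((\<lambda>y. D y t \<epsilon>) has_derivative blinfun_apply (D2 x t \<epsilon>)) (at x) \<and>
          ((\<lambda>y. D2 y t \<epsilon>) has_derivative blinfun_apply (D3 x t \<epsilon>)) (at x) \<and>
          ((\<lambda>s. F x s \<epsilon>) has_vector_derivative Dt x t \<epsilon>) (at t within {0..}) \<and>
          ((\<lambda>\<eta>. F x t \<eta>) has_vector_derivative De x t \<epsilon>) (at \<epsilon> within {0..e})"
    and bdd: "locally_uniformly_bounded e F" "locally_uniformly_bounded e D"
       "locally_uniformly_bounded e D2" "locally_uniformly_bounded e Dt" "locally_uniformly_bounded e De"
    using assms unfolding C3_C1_bounded_def by metis
  have "\<exists>L\<ge>1. regular_on_ball e R L F D Dt" if "R \<ge> 0" for R
  proof -
    \<comment> \<open>Difference quotients at points of norm \<open>R\<close> use steps of length up to one.\<close>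
    define S where "S = cball (0::'x) (R + 1)"
    obtain b1 where b1: "\<forall>x\<in>S. \<forall>t\<ge>0. \<forall>\<epsilon>\<in>{0..e}. norm (F x t \<epsilon>) \<le> b1"
      using locally_uniformly_bounded_cball[OF bdd(1)] unfolding S_def by blast
    obtain b2 where b2: "\<forall>x\<in>S. \<forall>t\<ge>0. \<forall>\<epsilon>\<in>{0..e}. norm (D x t \<epsilon>) \<le> b2"
      using locally_uniformly_bounded_cball[OF bdd(2)] unfolding S_def by blast
    obtain b3 where b3: "\<forall>x\<in>S. \<forall>t\<ge>0. \<forall>\<epsilon>\<in>{0..e}. norm (D2 x t \<epsilon>) \<le> b3"
      using locally_uniformly_bounded_cball[OF bdd(3)] unfolding S_def by blast
    obtain b4 where b4: "\<forall>x\<in>S. \<forall>t\<ge>0. \<forall>\<epsilon>\<in>{0..e}. norm (Dt x t \<epsilon>) \<le> b4"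
      using locally_uniformly_bounded_cball[OF bdd(4)] unfolding S_def by blast
    obtain b5 where b5: "\<forall>x\<in>S. \<forall>t\<ge>0. \<forall>\<epsilon>\<in>{0..e}. norm (De x t \<epsilon>) \<le> b5"
      using locally_uniformly_bounded_cball[OF bdd(5)] unfolding S_def by blast
    define \<Lambda> where "\<Lambda> = Max {1, b1, b2, b3, b4, b5}"
    have \<Lambda>: "1 \<le> \<Lambda>" "b1 \<le> \<Lambda>" "b2 \<le> \<Lambda>" "b3 \<le> \<Lambda>" "b4 \<le> \<Lambda>" "b5 \<le> \<Lambda>"
      by (simp_all add: \<Lambda>_def)
    have bound: "norm (F x t \<epsilon>) \<le> \<Lambda>" "norm (D x t \<epsilon>) \<le> \<Lambda>" "norm (D2 x t \<epsilon>) \<le> \<Lambda>"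
      "norm (Dt x t \<epsilon>) \<le> \<Lambda>" "norm (De x t \<epsilon>) \<le> \<Lambda>" if "x \<in> S" "t \<ge> 0" "\<epsilon> \<in> {0..e}" for x t \<epsilon>
      using b1[rule_format, OF that] b2[rule_format, OF that] b3[rule_format, OF that]
        b4[rule_format, OF that] b5[rule_format, OF that] \<Lambda> by linarith+
    have "convex S" by (simp add: S_def)
    have Fx: "norm (F x t \<epsilon> - F y t \<epsilon>) \<le> \<Lambda> * norm (x - y)"
      if "x \<in> S" "y \<in> S" "t \<ge> 0" "\<epsilon> \<in> {0..e}" for x y t \<epsilon>
    proof (rule differentiable_bound[OF \<open>convex S\<close>])
      show "((\<lambda>y. F y t \<epsilon>) has_derivative blinfun_apply (D x t \<epsilon>)) (at x within S)" for x
        using der that by (blast intro: has_derivative_at_withinI)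
      show "onorm (blinfun_apply (D x t \<epsilon>)) \<le> \<Lambda>" if "x \<in> S" for x
        using bound(2) that \<open>t \<ge> 0\<close> \<open>\<epsilon> \<in> _\<close> by (simp add: norm_blinfun.rep_eq[symmetric])
    qed (use that in auto)
    have Dx: "norm (D x t \<epsilon> - D y t \<epsilon>) \<le> \<Lambda> * norm (x - y)"
      if "x \<in> S" "y \<in> S" "t \<ge> 0" "\<epsilon> \<in> {0..e}" for x y t \<epsilon>
    proof (rule differentiable_bound[OF \<open>convex S\<close>])
      show "((\<lambda>y. D y t \<epsilon>) has_derivative blinfun_apply (D2 x t \<epsilon>)) (at x within S)" for x
        using der that by (blast intro: has_derivative_at_withinI)
      show "onorm (blinfun_apply (D2 x t \<epsilon>)) \<le> \<Lambda>" if "x \<in> S" for x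
        using bound(3) that \<open>t \<ge> 0\<close> \<open>\<epsilon> \<in> _\<close> by (simp add: norm_blinfun.rep_eq[symmetric])
    qed (use that in auto)
    have onorm_scaleR: "onorm (\<lambda>h. h *\<^sub>R v) \<le> norm v" for v :: 'y
      by (rule onorm_le) simp
    have Ft: "norm (F x t \<epsilon> - F x t' \<epsilon>) \<le> \<Lambda> * \<bar>t - t'\<bar>"
      if "x \<in> S" "t \<ge> 0" "t' \<ge> 0" "\<epsilon> \<in> {0..e}" for x t t' \<epsilon>
      using differentiable_bound[of "{0..}" "\<lambda>s. F x s \<epsilon>" "\<lambda>s h. h *\<^sub>R Dt x s \<epsilon>" \<Lambda> t t']
        der[of _ \<epsilon> x] that order.trans[OF onorm_scaleR bound(4)]
      by (simp add: has_vector_derivative_def)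
    have Fe: "norm (F x t \<epsilon> - F x t \<epsilon>') \<le> \<Lambda> * \<bar>\<epsilon> - \<epsilon>'\<bar>"
      if "x \<in> S" "t \<ge> 0" "\<epsilon> \<in> {0..e}" "\<epsilon>' \<in> {0..e}" for x t \<epsilon> \<epsilon>'
      using differentiable_bound[of "{0..e}" "\<lambda>s. F x t s" "\<lambda>s h. h *\<^sub>R De x t s" \<Lambda> \<epsilon> \<epsilon>']
        der[of t _ x] that order.trans[OF onorm_scaleR bound(5)]
      by (simp add: has_vector_derivative_def)
    have taylor: "norm (F x' t \<epsilon> - F x t \<epsilon> - D x t \<epsilon> (x' - x)) \<le> \<Lambda> * (norm (x' - x))\<^sup>2"
      if x: "x \<in> S" "x' \<in> S" and t: "t \<ge> 0" "\<epsilon> \<in> {0..e}" for x x' t \<epsilon>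
    proof -
      have seg: "x + r *\<^sub>R (x' - x) \<in> S" if "r \<in> {0..1}" for r
      proof -
        have "(1 - r) *\<^sub>R x + r *\<^sub>R x' \<in> S"
          using \<open>convex S\<close> x that by (intro convexD_alt) auto
        then show ?thesis by (simp add: algebra_simps)
      qed
      define Z where "Z = (\<lambda>r. x + r *\<^sub>R (x' - x)) ` {0..1}"
      have "Z \<subseteq> S" using seg by (auto simp: Z_def)
      have "x \<in> Z" by (auto simp: Z_def image_iff intro!: bexI[of _ 0])
      have "norm (F x' t \<epsilon> - F x t \<epsilon> - blinfun_apply (D x t \<epsilon>) (x' - x)) \<le> norm (x' - x) * (\<Lambda> * norm (x' - x))"
      proof (rule differentiable_bound_linearization[where S = Z and f = "\<lambda>y. F y t \<epsilon>" and f' = "\<lambda>y. blinfun_apply (D y t \<epsilon>)"])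
        show "((\<lambda>y. F y t \<epsilon>) has_derivative blinfun_apply (D y t \<epsilon>)) (at y within Z)" for y
          using der t by (blast intro: has_derivative_at_withinI)
        fix y assume "y \<in> Z"
        then obtain r where r: "r \<in> {0..1}" "y = x + r *\<^sub>R (x' - x)" by (auto simp: Z_def)
        have "blinfun_apply (D y t \<epsilon>) - blinfun_apply (D x t \<epsilon>) = blinfun_apply (D y t \<epsilon> - D x t \<epsilon>)"
          by (simp add: fun_eq_iff blinfun.diff_left)
        then have "onorm (blinfun_apply (D y t \<epsilon>) - blinfun_apply (D x t \<epsilon>)) = norm (D y t \<epsilon> - D x t \<epsilon>)"
          by (simp add: norm_blinfun.rep_eq)
        also have "\<dots> \<le> \<Lambda> * norm (y - x)" using Dx[of y x] \<open>y \<in> Z\<close> \<open>Z \<subseteq> S\<close> x t by auto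
        also have "\<dots> \<le> \<Lambda> * norm (x' - x)"
          using r \<Lambda> by (intro mult_left_mono) (auto simp: mult_left_le_one_le)
        finally show "onorm (blinfun_apply (D y t \<epsilon>) - blinfun_apply (D x t \<epsilon>)) \<le> \<Lambda> * norm (x' - x)" .
      qed (use \<open>x \<in> Z\<close> in \<open>auto simp: Z_def\<close>)
      then show ?thesis by (simp add: power2_eq_square algebra_simps)
    qed
    have SR: "x + u \<in> S" if "x \<in> cball 0 R" "norm u \<le> 1" for x u :: 'x
      using that norm_triangle_ineq[of x u] by (simp add: S_def)
    have holder: "norm (D x t \<epsilon> - D x t' \<epsilon>') \<le> 4 * \<Lambda> * sqrt \<delta>"
      if x: "x \<in> cball 0 R" and t: "t \<ge> 0" "\<epsilon> \<in> {0..e}" "t' \<ge> 0" "\<epsilon>' \<in> {0..e}"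
      and \<delta>: "\<delta> > 0" "\<And>y. y \<in> S \<Longrightarrow> norm (F y t \<epsilon> - F y t' \<epsilon>') \<le> \<Lambda> * \<delta>" for x t t' \<epsilon> \<epsilon>' \<delta>
    proof (cases "\<delta> \<le> 1")
      case True
      have xS: "x \<in> S" using SR[OF x, of 0] by simp
      show ?thesis
      proof (rule derivative_interpolation[where P = "\<lambda>y. F y t \<epsilon>" and Q = "\<lambda>y. F y t' \<epsilon>'" and x = x])
        fix u :: 'x assume u: "norm u \<le> 1"
        show "norm (F (x + u) t \<epsilon> - F x t \<epsilon> - blinfun_apply (D x t \<epsilon>) u) \<le> \<Lambda> * (norm u)\<^sup>2"
          using taylor[OF xS SR[OF x u] t(1,2)] by simp
        show "norm (F (x + u) t' \<epsilon>' - F x t' \<epsilon>' - blinfun_apply (D x t' \<epsilon>') u) \<le> \<Lambda> * (norm u)\<^sup>2"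
          using taylor[OF xS SR[OF x u] t(3,4)] by simp
        show "norm (F (x + u) t \<epsilon> - F (x + u) t' \<epsilon>') \<le> \<Lambda> * \<delta>"
          by (rule \<delta>(2)[OF SR[OF x u]])
      qed (use \<delta> True \<Lambda> in auto)
    next
      case False
      have xS: "x \<in> S" using SR[OF x, of 0] by simp
      have "norm (D x t \<epsilon> - D x t' \<epsilon>') \<le> norm (D x t \<epsilon>) + norm (D x t' \<epsilon>')" by (rule norm_triangle_ineq4)
      also have "\<dots> \<le> \<Lambda> + \<Lambda>" using bound(2) xS t by (intro add_mono) auto
      also have "\<dots> \<le> 4 * \<Lambda> * 1" using \<Lambda> by simp
      also have "\<dots> \<le> 4 * \<Lambda> * sqrt \<delta>" using \<Lambda> False by (intro mult_left_mono) auto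
      finally show ?thesis .
    qed
    have Dt: "norm (D x t \<epsilon> - D x t' \<epsilon>) \<le> 4 * \<Lambda> * sqrt \<bar>t - t'\<bar>"
      if "x \<in> cball 0 R" "t \<ge> 0" "t' \<ge> 0" "\<epsilon> \<in> {0..e}" for x t t' \<epsilon>
    proof (cases "t = t'")
      case False
      then show ?thesis using that Ft by (intro holder) auto
    qed simp
    have De: "norm (D x t \<epsilon> - D x t \<epsilon>') \<le> 4 * \<Lambda> * sqrt \<bar>\<epsilon> - \<epsilon>'\<bar>"
      if "x \<in> cball 0 R" "t \<ge> 0" "\<epsilon> \<in> {0..e}" "\<epsilon>' \<in> {0..e}" for x t \<epsilon> \<epsilon>'
    proof (cases "\<epsilon> = \<epsilon>'")
      case False
      then show ?thesis using that Fe by (intro holder) auto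
    qed simp
    have sub: "x \<in> S" if "x \<in> cball 0 R" for x using SR[OF that, of 0] by simp
    have "regular_on_ball e R (4 * \<Lambda>) F D Dt"
      unfolding regular_on_ball_def
    proof (intro conjI ballI allI impI)
      fix x x' :: 'x and t t' \<epsilon> \<epsilon>' :: real
      assume *: "x \<in> cball 0 R" "x' \<in> cball 0 R" "t \<ge> 0" "t' \<ge> 0" "\<epsilon> \<in> {0..e}" "\<epsilon>' \<in> {0..e}"
      have "norm (F x t \<epsilon> - F x' t' \<epsilon>') \<le>
          norm (F x t \<epsilon> - F x' t \<epsilon>) + norm (F x' t \<epsilon> - F x' t' \<epsilon>) + norm (F x' t' \<epsilon> - F x' t' \<epsilon>')"
        using norm_triangle_ineq[of "F x t \<epsilon> - F x' t \<epsilon>" "F x' t \<epsilon> - F x' t' \<epsilon>'"]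
          norm_triangle_ineq[of "F x' t \<epsilon> - F x' t' \<epsilon>" "F x' t' \<epsilon> - F x' t' \<epsilon>'"] by simp
      also have "\<dots> \<le> \<Lambda> * norm (x - x') + \<Lambda> * \<bar>t - t'\<bar> + \<Lambda> * \<bar>\<epsilon> - \<epsilon>'\<bar>"
        using * sub by (intro add_mono Fx Ft Fe) auto
      also have "\<dots> = \<Lambda> * (norm (x - x') + \<bar>t - t'\<bar> + \<bar>\<epsilon> - \<epsilon>'\<bar>)" by (simp add: algebra_simps)
      also have "\<dots> \<le> 4 * \<Lambda> * (norm (x - x') + \<bar>t - t'\<bar> + \<bar>\<epsilon> - \<epsilon>'\<bar>)"
        using \<Lambda> by (intro mult_right_mono) auto
      finally show "norm (F x t \<epsilon> - F x' t' \<epsilon>') \<le> 4 * \<Lambda> * (norm (x - x') + \<bar>t - t'\<bar> + \<bar>\<epsilon> - \<epsilon>'\<bar>)" .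
      have "norm (D x t \<epsilon> - D x' t' \<epsilon>') \<le>
          norm (D x t \<epsilon> - D x' t \<epsilon>) + norm (D x' t \<epsilon> - D x' t' \<epsilon>) + norm (D x' t' \<epsilon> - D x' t' \<epsilon>')"
        using norm_triangle_ineq[of "D x t \<epsilon> - D x' t \<epsilon>" "D x' t \<epsilon> - D x' t' \<epsilon>'"]
          norm_triangle_ineq[of "D x' t \<epsilon> - D x' t' \<epsilon>" "D x' t' \<epsilon> - D x' t' \<epsilon>'"] by simp
      also have "\<dots> \<le> 4 * \<Lambda> * norm (x - x') + 4 * \<Lambda> * sqrt \<bar>t - t'\<bar> + 4 * \<Lambda> * sqrt \<bar>\<epsilon> - \<epsilon>'\<bar>"
      proof (intro add_mono Dt De)
        have "norm (D x t \<epsilon> - D x' t \<epsilon>) \<le> \<Lambda> * norm (x - x')" using * sub by (intro Dx) auto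
        also have "\<dots> \<le> 4 * \<Lambda> * norm (x - x')" using \<Lambda> by (intro mult_right_mono) auto
        finally show "norm (D x t \<epsilon> - D x' t \<epsilon>) \<le> 4 * \<Lambda> * norm (x - x')" .
      qed (use * in auto)
      finally show "norm (D x t \<epsilon> - D x' t' \<epsilon>') \<le> 4 * \<Lambda> * (norm (x - x') + sqrt \<bar>t - t'\<bar> + sqrt \<bar>\<epsilon> - \<epsilon>'\<bar>)"
        by (simp add: algebra_simps)
    next
      fix x x' :: 'x and t \<epsilon> :: real
      assume *: "x \<in> cball 0 R" "x' \<in> cball 0 R" "t \<ge> 0" "\<epsilon> \<in> {0..e}"
      have "norm (F x' t \<epsilon> - F x t \<epsilon> - D x t \<epsilon> (x' - x)) \<le> \<Lambda> * (norm (x' - x))\<^sup>2"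
        using taylor[of x x'] * sub by auto
      also have "\<dots> \<le> 4 * \<Lambda> * (norm (x' - x))\<^sup>2" using \<Lambda> by (intro mult_right_mono) auto
      finally show "norm (F x' t \<epsilon> - F x t \<epsilon> - D x t \<epsilon> (x' - x)) \<le> 4 * \<Lambda> * (norm (x' - x))\<^sup>2" .
    qed (use der bound sub \<Lambda> in \<open>auto intro: order.trans[of _ \<Lambda> "4 * \<Lambda>"]\<close>)
    then show ?thesis using \<Lambda> by (intro exI[of _ "4 * \<Lambda>"]) auto
  qed
  then show ?thesis by blast
qed

lemma regular_on_ballD:
  assumes "regular_on_ball e R L F D Dt" "norm x \<le> R" "t \<ge> 0" "\<epsilon> \<in> {0..e}"
  shows "norm (F x t \<epsilon>) \<le> L" "norm (D x t \<epsilon>) \<le> L" "norm (Dt x t \<epsilon>) \<le> L"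
    "((\<lambda>y. F y t \<epsilon>) has_derivative blinfun_apply (D x t \<epsilon>)) (at x)"
    "((\<lambda>s. F x s \<epsilon>) has_vector_derivative Dt x t \<epsilon>) (at t within {0..})"
    "\<And>x' t' \<epsilon>'. norm x' \<le> R \<Longrightarrow> t' \<ge> 0 \<Longrightarrow> \<epsilon>' \<in> {0..e} \<Longrightarrow>
       norm (F x t \<epsilon> - F x' t' \<epsilon>') \<le> L * (norm (x - x') + \<bar>t - t'\<bar> + \<bar>\<epsilon> - \<epsilon>'\<bar>)"
    "\<And>x' t' \<epsilon>'. norm x' \<le> R \<Longrightarrow> t' \<ge> 0 \<Longrightarrow> \<epsilon>' \<in> {0..e} \<Longrightarrow>
       norm (D x t \<epsilon> - D x' t' \<epsilon>') \<le> L * (norm (x - x') + sqrt \<bar>t - t'\<bar> + sqrt \<bar>\<epsilon> - \<epsilon>'\<bar>)"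
    "\<And>x'. norm x' \<le> R \<Longrightarrow> norm (F x' t \<epsilon> - F x t \<epsilon> - D x t \<epsilon> (x' - x)) \<le> L * (norm (x' - x))\<^sup>2"
  using assms unfolding regular_on_ball_def by auto

lemma regular_on_ball_mono:
  assumes "regular_on_ball e R L F D Dt" "L \<le> L'"
  shows "regular_on_ball e R L' F D Dt"
proof -
  have aux: "a \<le> L' * b" if "a \<le> L * b" "0 \<le> b" for a b :: real
    using mult_right_mono[OF assms(2) that(2)] that(1) by linarith
  show ?thesis
    unfolding regular_on_ball_def
    by (intro conjI ballI allI impI)
       (rule regular_on_ballD[OF assms(1)] aux[OF regular_on_ballD(6)[OF assms(1)]]
          aux[OF regular_on_ballD(7)[OF assms(1)]] aux[OF regular_on_ballD(8)[OF assms(1)]]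
          order.trans[OF regular_on_ballD(1)[OF assms(1)] assms(2)]
          order.trans[OF regular_on_ballD(2)[OF assms(1)] assms(2)]
          order.trans[OF regular_on_ballD(3)[OF assms(1)] assms(2)]; simp)+
qed

text \<open>\<open>F\<close> is jointly differentiable in \<open>x\<close> and \<open>t\<close> since its derivative in \<open>x\<close> is jointly continuous.\<close>
lemma regular_chain_rule:
  fixes F :: "'x::euclidean_space \<Rightarrow> real \<Rightarrow> real \<Rightarrow> 'y::euclidean_space"
  assumes reg: "regular_on_ball e R L F D Dt" and \<epsilon>: "\<epsilon> \<in> {0..e}"
    and S: "S \<subseteq> {0..}" "t \<in> S" "\<And>s. s \<in> S \<Longrightarrow> norm (X s) \<le> R"
    and X: "(X has_vector_derivative X') (at t within S)"
  shows "((\<lambda>s. F (X s) s \<epsilon>) has_vector_derivative D (X t) t \<epsilon> X' + Dt (X t) t \<epsilon>) (at t within S)"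
proof -
  let ?Y = "cball (0::'x) R"
  have "((\<lambda>(s, y). F y s \<epsilon>) has_derivative (\<lambda>(ds, dy). ds *\<^sub>R Dt (X t) t \<epsilon> + D (X t) t \<epsilon> dy))
      (at (t, X t) within S \<times> ?Y)"
  proof (rule has_derivative_partialsI)
    show "((\<lambda>s. F (X t) s \<epsilon>) has_derivative (\<lambda>ds. ds *\<^sub>R Dt (X t) t \<epsilon>)) (at t within S)"
    proof (rule has_derivative_subset)
      show "((\<lambda>s. F (X t) s \<epsilon>) has_derivative (\<lambda>ds. ds *\<^sub>R Dt (X t) t \<epsilon>)) (at t within {0..})"
        unfolding has_vector_derivative_def[symmetric]
        by (rule regular_on_ballD(5)[OF reg S(3)[OF S(2)] _ \<epsilon>]) (use S in auto)
    qed (rule S(1))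
    show "((\<lambda>y. F y s \<epsilon>) has_derivative blinfun_apply (D y s \<epsilon>)) (at y within ?Y)"
      if "s \<in> S" "y \<in> ?Y" for s y
      by (rule has_derivative_at_withinI, rule regular_on_ballD(4)[OF reg _ _ \<epsilon>]) (use S that in auto)
    have key: "norm (D y s \<epsilon> - D (X t) t \<epsilon>) \<le> L * (norm (y - X t) + sqrt \<bar>s - t\<bar>)"
      if "s \<in> S" "norm y \<le> R" for s y
      using regular_on_ballD(7)[OF reg that(2) _ \<epsilon> S(3)[OF S(2)] _ \<epsilon>, of s t] S that by auto
    show "continuous (at (t, X t) within S \<times> ?Y) (\<lambda>(s, y). D y s \<epsilon>)"
      unfolding continuous_within
    proof (rule LIM_zero_cancel, rule Lim_null_comparison)
      show "((\<lambda>p. L * (norm (snd p - X t) + sqrt \<bar>fst p - t\<bar> + sqrt \<bar>\<epsilon> - \<epsilon>\<bar>)) \<longlongrightarrow> 0) (at (t, X t) within S \<times> ?Y)"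
        by (auto intro!: tendsto_eq_intros)
      show "\<forall>\<^sub>F p in at (t, X t) within S \<times> ?Y. norm ((case p of (s, y) \<Rightarrow> D y s \<epsilon>) - (case (t, X t) of (s, y) \<Rightarrow> D y s \<epsilon>))
          \<le> L * (norm (snd p - X t) + sqrt \<bar>fst p - t\<bar> + sqrt \<bar>\<epsilon> - \<epsilon>\<bar>)"
        unfolding eventually_at_filter by (rule always_eventually) (auto simp: key)
    qed
  qed (use S in auto)
  then have "((\<lambda>(s, y). F y s \<epsilon>) has_derivative (\<lambda>(ds, dy). ds *\<^sub>R Dt (X t) t \<epsilon> + D (X t) t \<epsilon> dy))
      (at (t, X t) within (\<lambda>s. (s, X s)) ` S)"
    by (rule has_derivative_subset) (use S in auto)
  moreover have "((\<lambda>s. (s, X s)) has_derivative (\<lambda>h. (h, h *\<^sub>R X'))) (at t within S)"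
    using X unfolding has_vector_derivative_def by (intro has_derivative_Pair has_derivative_ident)
  ultimately have "((\<lambda>s. case (s, X s) of (s, y) \<Rightarrow> F y s \<epsilon>) has_derivative
     (\<lambda>h. case (h, h *\<^sub>R X') of (ds, dy) \<Rightarrow> ds *\<^sub>R Dt (X t) t \<epsilon> + D (X t) t \<epsilon> dy)) (at t within S)"
    by (rule has_derivative_in_compose[rotated])
  then show ?thesis
    by (simp add: has_vector_derivative_def blinfun.scaleR_right scaleR_add_right add.commute)
qed

section \<open>Stability of the slow manifold\<close>

lemma norm_blinfun_partial_le:
  fixes D :: "('a::real_normed_vector \<times> 'b::real_normed_vector) \<Rightarrow>\<^sub>L 'c::real_normed_vector"
  assumes "norm D \<le> L"
  shows "norm (D (x, 0)) \<le> L * norm x" and "norm (D (0, y)) \<le> L * norm y"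
  using norm_blinfun[of D "(x, 0)"] norm_blinfun[of D "(0, y)"]
    mult_right_mono[OF assms norm_ge_zero[of x]] mult_right_mono[OF assms norm_ge_zero[of y]]
  by (simp_all add: norm_Pair)

lemma at_within_Ici_nontrivial: "0 \<le> t \<Longrightarrow> at t within {0..} \<noteq> (bot :: real filter)"
proof -
  assume "0 \<le> t"
  then have "{t<..} \<subseteq> {0..}" by auto
  then have "at_right t \<le> at t within {0..}" by (rule at_le)
  then show ?thesis using trivial_limit_at_right_real[of t] bot_unique by metis
qed

text \<open>The data of the problem in the form in which the estimates use them. Here \<open>Gv t\<close> is the derivative of
  \<open>G\<close> in the fast variable along the reduced trajectory, \<open>P t\<close> stands for the derivative of \<open>\<phi>\<close> in the slow
  variable, characterised by implicit differentiation, and \<open>J\<close> is the matrix of the linearised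
  reduced equation. The ball of radius \<open>R\<close> leaves a margin of one around the trajectory.\<close>
locale slow_fast_system =
  fixes F :: "(real^'n) \<times> (real^'m) \<Rightarrow> real \<Rightarrow> real \<Rightarrow> real^'n"
    and G :: "(real^'n) \<times> (real^'m) \<Rightarrow> real \<Rightarrow> real \<Rightarrow> real^'m"
    and DF DtF DG DtG and e R L :: real
    and ubar :: "real \<Rightarrow> real^'n" and vbar vbar' :: "real \<Rightarrow> real^'m"
    and Gv :: "real \<Rightarrow> real^'m^'m" and P :: "real \<Rightarrow> real^'n \<Rightarrow> real^'m"
    and J Y :: "real \<Rightarrow> real^'n^'n" and \<kappa> K \<alpha> :: real
  assumes e: "e > 0" and L: "L \<ge> 1" and \<kappa>: "\<kappa> > 0"
    and regF: "regular_on_ball e R L F DF DtF" and regG: "regular_on_ball e R L G DG DtG"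
    and ubar: "\<And>t. t \<ge> 0 \<Longrightarrow> (ubar has_vector_derivative F (ubar t, vbar t) t 0) (at t within {0..})"
    and vbar: "\<And>t. t \<ge> 0 \<Longrightarrow> (vbar has_vector_derivative vbar' t) (at t within {0..})"
    and bar_root: "\<And>t. t \<ge> 0 \<Longrightarrow> G (ubar t, vbar t) t 0 = 0"
    and bar_bound: "\<And>t. t \<ge> 0 \<Longrightarrow> norm (ubar t, vbar t) + 1 \<le> R"
    and Gv: "\<And>t y. t \<ge> 0 \<Longrightarrow> Gv t *v y = DG (ubar t, vbar t) t 0 (0, y)"
    and spectrum: "\<And>t z. t \<ge> 0 \<Longrightarrow> z \<in> complex_spectrum (Gv t) \<Longrightarrow> Re z \<le> - \<kappa>"
    and P: "\<And>t x. t \<ge> 0 \<Longrightarrow> Gv t *v P t x = - DG (ubar t, vbar t) t 0 (x, 0)"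
    and J: "\<And>t x. t \<ge> 0 \<Longrightarrow> J t *v x = DF (ubar t, vbar t) t 0 (x, P t x)"
    and Y: "fundamental_matrix J Y" and K: "K > 0" and \<alpha>: "\<alpha> > 0"
    and dichotomy: "\<And>s t. 0 \<le> s \<Longrightarrow> s \<le> t \<Longrightarrow>
      onorm ((*v) (Y t ** matrix_inv (Y s))) \<le> K * exp (- \<alpha> * (t - s))"
begin

abbreviation bar :: "real \<Rightarrow> (real^'n) \<times> (real^'m)" where
  "bar t \<equiv> (ubar t, vbar t)"

lemma bar_in_ball: "t \<ge> 0 \<Longrightarrow> norm (bar t) \<le> R"
  using bar_bound[of t] by simp

lemma zero_param: "0 \<in> {0..e}"
  using e by simp

lemma Gv_bound: "t \<ge> 0 \<Longrightarrow> norm (Gv t *v y) \<le> L * norm y"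
  unfolding Gv
  by (intro norm_blinfun_partial_le regular_on_ballD(2)[OF regG] bar_in_ball zero_param)

text \<open>A contraction of a norm in one Euler step is also a quantitative invertibility statement:
  \<open>N y \<le> N (y + h Gv y) + N (- h Gv y)\<close>.\<close>
lemma Gv_lower_bound: "\<exists>C\<ge>1. \<forall>t\<ge>0. \<forall>y. norm y \<le> C * norm (Gv t *v y)"
proof -
  have "0 < L" using L by simp
  obtain C h0 where C: "C \<ge> 1" "h0 > 0"
    "\<forall>B :: real^'m^'m.
       (\<forall>x. norm (B *v x) \<le> L * norm x) \<and> (\<forall>z\<in>complex_spectrum B. Re z \<le> - \<kappa>) \<longrightarrow>
       (\<exists>N. contracting_norm B \<kappa> C h0 N)"
    using adapted_norm[OF \<kappa> \<open>0 < L\<close>] by blast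
  have "norm y \<le> max 1 (4 * C / \<kappa>) * norm (Gv t *v y)" if t: "t \<ge> 0" for t y
  proof -
    have "\<exists>N. contracting_norm (Gv t) \<kappa> C h0 N"
      using Gv_bound[OF t] spectrum[OF t] by (intro C(3)[rule_format]) auto
    then obtain N where "contracting_norm (Gv t) \<kappa> C h0 N" by blast
    then have N: "\<And>x. norm x \<le> N x" "\<And>x. N x \<le> C * norm x" "\<And>x y. N (x + y) \<le> N x + N y"
      "N (y + h0 *\<^sub>R (Gv t *v y)) \<le> (1 - h0 * \<kappa> / 4) * N y"
      using C(2) by (auto simp: contracting_norm_def)
    have "N y \<le> N (y + h0 *\<^sub>R (Gv t *v y)) + N (- h0 *\<^sub>R (Gv t *v y))"
      using N(3)[of "y + h0 *\<^sub>R (Gv t *v y)" "- h0 *\<^sub>R (Gv t *v y)"] by simp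
    also have "\<dots> \<le> (1 - h0 * \<kappa> / 4) * N y + C * (h0 * norm (Gv t *v y))"
      using N(4) N(2)[of "- h0 *\<^sub>R (Gv t *v y)"] C(2) by simp
    finally have "h0 * (\<kappa> * N y) \<le> h0 * (4 * C * norm (Gv t *v y))" by (simp add: algebra_simps)
    then have "\<kappa> * N y \<le> 4 * C * norm (Gv t *v y)" using C(2) by simp
    then have "N y \<le> 4 * C / \<kappa> * norm (Gv t *v y)" using \<kappa> by (simp add: field_simps)
    also have "\<dots> \<le> max 1 (4 * C / \<kappa>) * norm (Gv t *v y)" by (intro mult_right_mono) auto
    finally show ?thesis using N(1)[of y] by simp
  qed
  then show ?thesis by (intro exI[of _ "max 1 (4 * C / \<kappa>)"]) auto
qed

text \<open>Differentiating \<open>G (ubar t, vbar t) t 0 = 0\<close> and inverting \<open>Gv\<close> bounds the derivative of \<open>vbar\<close>.\<close>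
lemma bar_lipschitz: "\<exists>C\<ge>1. \<forall>s\<ge>0. \<forall>t\<ge>0. norm (bar s - bar t) \<le> C * \<bar>s - t\<bar>"
proof -
  obtain C where C: "C \<ge> 1" "\<And>t y. t \<ge> 0 \<Longrightarrow> norm y \<le> C * norm (Gv t *v y)"
    using Gv_lower_bound by blast
  define B where "B = L + C * (L * L + L)"
  have u': "norm (F (bar t) t 0) \<le> L" if "t \<ge> 0" for t
    using regular_on_ballD(1)[OF regF bar_in_ball[OF that] that zero_param] .
  have v': "norm (vbar' t) \<le> C * (L * L + L)" if t: "t \<ge> 0" for t
  proof -
    have "((\<lambda>s. G (bar s) s 0) has_vector_derivative
        DG (bar t) t 0 (F (bar t) t 0, vbar' t) + DtG (bar t) t 0) (at t within {0..})"
      by (rule regular_chain_rule[OF regG zero_param])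
         (use t bar_in_ball ubar vbar in \<open>auto intro!: has_vector_derivative_Pair\<close>)
    moreover have "((\<lambda>s. G (bar s) s 0) has_vector_derivative 0) (at t within {0..})"
      by (rule has_vector_derivative_transform[where f = "\<lambda>_. 0"]) (use t bar_root in auto)
    ultimately have "DG (bar t) t 0 (F (bar t) t 0, vbar' t) + DtG (bar t) t 0 = 0"
      by (rule vector_derivative_unique_within[rotated])
         (use at_within_Ici_nontrivial[OF t] in auto)
    moreover have "DG (bar t) t 0 (F (bar t) t 0, vbar' t)
        = DG (bar t) t 0 (F (bar t) t 0, 0) + Gv t *v vbar' t"
      unfolding Gv[OF t] by (simp flip: blinfun.add_right)
    moreover have "y = - x - d" if "A + d = 0" "A = x + y" for A d x y :: "real^'m"
    proof -
      have "A = - d" using that(1) by (simp add: eq_neg_iff_add_eq_0)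
      moreover have "y = A - x" using that(2) by simp
      ultimately show ?thesis by simp
    qed
    ultimately have "Gv t *v vbar' t = - DG (bar t) t 0 (F (bar t) t 0, 0) - DtG (bar t) t 0"
      by blast
    then have "norm (Gv t *v vbar' t) \<le> norm (DG (bar t) t 0 (F (bar t) t 0, 0)) + norm (DtG (bar t) t 0)"
      by (metis norm_minus_cancel norm_triangle_ineq4)
    also have "\<dots> \<le> L * L + L"
    proof (rule add_mono)
      have "norm (DG (bar t) t 0 (F (bar t) t 0, 0)) \<le> L * norm (F (bar t) t 0)"
        by (intro norm_blinfun_partial_le regular_on_ballD(2)[OF regG] bar_in_ball t zero_param)
      also have "\<dots> \<le> L * L" using u'[OF t] L by (intro mult_left_mono) auto
      finally show "norm (DG (bar t) t 0 (F (bar t) t 0, 0)) \<le> L * L" .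
      show "norm (DtG (bar t) t 0) \<le> L"
        using regular_on_ballD(3)[OF regG bar_in_ball[OF t] t zero_param] .
    qed
    finally have "C * norm (Gv t *v vbar' t) \<le> C * (L * L + L)" using C(1) by (intro mult_left_mono) auto
    then show ?thesis using C(2)[OF t, of "vbar' t"] by simp
  qed
  have "norm (bar s - bar t) \<le> B * norm (s - t)" if st: "s \<ge> 0" "t \<ge> 0" for s t
  proof (rule differentiable_bound[where S = "{0..}" and f' = "\<lambda>t h. h *\<^sub>R (F (bar t) t 0, vbar' t)"])
    fix r :: real assume r: "r \<in> {0..}"
    show "(bar has_derivative (\<lambda>h. h *\<^sub>R (F (bar r) r 0, vbar' r))) (at r within {0..})"
      unfolding has_vector_derivative_def[symmetric] using ubar vbar r
      by (auto intro: has_vector_derivative_Pair)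
    have "norm (F (bar r) r 0, vbar' r) \<le> B"
      using u'[of r] v'[of r] r norm_Pair_le[of "F (bar r) r 0" "vbar' r"] by (simp add: B_def)
    moreover have "onorm (\<lambda>h. h *\<^sub>R z) \<le> B" if "norm z \<le> B" for z :: "(real^'n) \<times> (real^'m)"
    proof (rule onorm_le)
      fix h :: real
      show "norm (h *\<^sub>R z) \<le> B * norm h"
        using mult_left_mono[OF that, of "\<bar>h\<bar>"] by (simp add: mult.commute)
    qed
    ultimately show "onorm (\<lambda>h. h *\<^sub>R (F (bar r) r 0, vbar' r)) \<le> B" by blast
  qed (use st in auto)
  moreover have "B \<ge> 1" using L C(1) by (simp add: B_def add_increasing2)
  ultimately show ?thesis by (intro exI[of _ B]) auto
qed

lemma near_bar_in_ball:
  assumes "t \<ge> 0" "norm (u - ubar t) + norm (v - vbar t) \<le> 1"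
  shows "norm (u, v) \<le> R"
proof -
  have "norm (u, v) \<le> norm (bar t) + norm ((u, v) - bar t)" by (metis norm_triangle_sub)
  also have "norm ((u, v) - bar t) \<le> 1"
    using norm_Pair_le[of "u - ubar t" "v - vbar t"] assms(2) by simp
  finally show ?thesis using bar_bound[OF assms(1)] by simp
qed

text \<open>The residual \<open>G (u, v) t \<epsilon>\<close> equals \<open>Gv (y - P x)\<close> up to \<open>O(\<epsilon> + q\<^sup>2)\<close>, so it controls the distance of
  \<open>y\<close> from the slow direction \<open>P x\<close>; the increment of the slow vector field differs from \<open>J x\<close> by an error of
  the same size.\<close>
lemma linearisation:
  "\<exists>C\<ge>1. \<forall>t\<ge>0. \<forall>\<epsilon>\<in>{0..e}. \<forall>u v. norm (u - ubar t) + norm (v - vbar t) \<le> 1 \<longrightarrow>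
     (let q = norm (u - ubar t) + norm (v - vbar t); d = norm (G (u, v) t \<epsilon>) + \<epsilon> + q\<^sup>2 in
      norm (v - vbar t) \<le> C * (norm (u - ubar t) + d) \<and>
      norm (F (u, v) t \<epsilon> - F (bar t) t 0 - J t *v (u - ubar t)) \<le> C * d)"
proof -
  obtain C where C: "C \<ge> 1" "\<And>t y. t \<ge> 0 \<Longrightarrow> norm y \<le> C * norm (Gv t *v y)"
    using Gv_lower_bound by blast
  define C' where "C' = L + L * (C * L) + C * L"
  have L0: "0 < L" using L by simp
  have CL: "1 \<le> C * L" using mult_mono[of 1 C 1 L] C L by simp
  have main: "norm y \<le> C' * (norm x + d) \<and> norm (F (u, v) t \<epsilon> - F (bar t) t 0 - J t *v x) \<le> C' * d"
    if t: "t \<ge> 0" and \<epsilon>: "\<epsilon> \<in> {0..e}" and q1: "norm (u - ubar t) + norm (v - vbar t) \<le> 1"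
    and x: "x = u - ubar t" and y: "y = v - vbar t" and q: "q = norm x + norm y"
    and d: "d = norm (G (u, v) t \<epsilon>) + \<epsilon> + q\<^sup>2" for t \<epsilon> u v x y q d
  proof -
    have in_ball: "norm (u, v) \<le> R" using near_bar_in_ball[OF t q1] .
    have xy: "(u, v) - bar t = (x, y)" by (simp add: x y)
    have nq: "norm ((x, y) :: (real^'n) \<times> (real^'m)) \<le> q" using norm_Pair_le[of x y] by (simp add: q)
    have taylor: "norm (H (u, v) t \<epsilon> - H (bar t) t 0 - DH (bar t) t 0 (x, y)) \<le> L * (\<epsilon> + q\<^sup>2)"
      if reg: "regular_on_ball e R L H DH DtH" 
      for H :: "(real^'n) \<times> (real^'m) \<Rightarrow> real \<Rightarrow> real \<Rightarrow> 'c::euclidean_space" and DH DtH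
    proof -
      have "norm (H (u, v) t \<epsilon> - H (u, v) t 0) \<le> L * \<epsilon>"
        using regular_on_ballD(6)[OF reg in_ball t \<epsilon> in_ball t zero_param] \<epsilon> by simp
      moreover have "norm (H (u, v) t 0 - H (bar t) t 0 - DH (bar t) t 0 (x, y)) \<le> L * (norm (x, y))\<^sup>2"
        using regular_on_ballD(8)[OF reg bar_in_ball[OF t] t zero_param in_ball] unfolding xy .
      moreover have "L * (norm (x, y))\<^sup>2 \<le> L * q\<^sup>2"
        using nq L0 by (intro mult_left_mono power_mono) auto
      moreover have "H (u, v) t \<epsilon> - H (bar t) t 0 - DH (bar t) t 0 (x, y) =
        (H (u, v) t \<epsilon> - H (u, v) t 0) + (H (u, v) t 0 - H (bar t) t 0 - DH (bar t) t 0 (x, y))"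
        by simp
      then have "norm (H (u, v) t \<epsilon> - H (bar t) t 0 - DH (bar t) t 0 (x, y)) \<le>
        norm (H (u, v) t \<epsilon> - H (u, v) t 0) + norm (H (u, v) t 0 - H (bar t) t 0 - DH (bar t) t 0 (x, y))"
        by (simp only: norm_triangle_ineq)
      ultimately show ?thesis unfolding distrib_left by linarith
    qed
    define w where "w = y - P t x"
    have "DG (bar t) t 0 (x, y) = DG (bar t) t 0 (x, 0) + DG (bar t) t 0 (0, y)"
      by (simp flip: blinfun.add_right)
    also have "\<dots> = Gv t *v w"
      using P[OF t, of x] Gv[OF t, of y] by (simp add: w_def matrix_vector_mult_diff_distrib)
    finally have DGw: "DG (bar t) t 0 (x, y) = Gv t *v w" .
    have "norm (Gv t *v w) \<le> norm (G (u, v) t \<epsilon>) + L * (\<epsilon> + q\<^sup>2)"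
      using taylor[OF regG] norm_triangle_sub[of "DG (bar t) t 0 (x, y)" "G (u, v) t \<epsilon>"] bar_root[OF t] DGw
      by (simp add: norm_minus_commute)
    also have "\<dots> \<le> L * norm (G (u, v) t \<epsilon>) + L * (\<epsilon> + q\<^sup>2)"
      using mult_right_mono[OF L norm_ge_zero[of "G (u, v) t \<epsilon>"]] by simp
    also have "\<dots> = L * d" by (simp add: d algebra_simps)
    finally have "C * norm (Gv t *v w) \<le> C * (L * d)" using C(1) by (intro mult_left_mono) auto
    then have w: "norm w \<le> C * L * d" using C(2)[OF t, of w] by simp
    have d0: "d \<ge> 0" using \<epsilon> by (simp add: d)
    have DGx: "norm (DG (bar t) t 0 (x, 0)) \<le> L * norm x"
      by (intro norm_blinfun_partial_le regular_on_ballD(2)[OF regG] bar_in_ball t zero_param)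
    have "C * norm (DG (bar t) t 0 (x, 0)) \<le> C * (L * norm x)"
      using DGx C(1) by (intro mult_left_mono) auto
    then have "norm (P t x) \<le> C * (L * norm x)"
      using C(2)[OF t, of "P t x"] P[OF t, of x] by simp
    moreover have "norm y \<le> norm w + norm (P t x)"
      using norm_triangle_ineq[of w "P t x"] by (simp add: w_def)
    ultimately have "norm y \<le> C * L * (norm x + d)" using w by (simp add: algebra_simps)
    also have "\<dots> \<le> C' * (norm x + d)"
      using d0 L0 CL by (intro mult_right_mono) (auto simp: C'_def)
    finally have 1: "norm y \<le> C' * (norm x + d)" .
    have "DF (bar t) t 0 (x, y) = DF (bar t) t 0 (x, P t x) + DF (bar t) t 0 (0, w)"
      by (simp add: w_def flip: blinfun.add_right)
    then have eq: "F (u, v) t \<epsilon> - F (bar t) t 0 - J t *v x =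
        (F (u, v) t \<epsilon> - F (bar t) t 0 - DF (bar t) t 0 (x, y)) + DF (bar t) t 0 (0, w)"
      using J[OF t, of x] by simp
    have "norm (DF (bar t) t 0 (0, w)) \<le> L * norm w"
      by (intro norm_blinfun_partial_le regular_on_ballD(2)[OF regF] bar_in_ball t zero_param)
    also have "\<dots> \<le> L * (C * L * d)" using w L0 by (intro mult_left_mono) auto
    finally have "norm (DF (bar t) t 0 (0, w)) \<le> L * (C * L) * d" by simp
    moreover have "L * (\<epsilon> + q\<^sup>2) \<le> L * d" using L0 by (intro mult_left_mono) (auto simp: d)
    ultimately have "norm (F (u, v) t \<epsilon> - F (bar t) t 0 - J t *v x) \<le> (L + L * (C * L)) * d"
      unfolding eq distrib_right using taylor[OF regF] norm_triangle_ineq[of "F (u, v) t \<epsilon> - F (bar t) t 0 - DF (bar t) t 0 (x, y)" "DF (bar t) t 0 (0, w)"]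
      by linarith
    also have "\<dots> \<le> C' * d" using d0 CL by (intro mult_right_mono) (auto simp: C'_def)
    finally show ?thesis using 1 by simp
  qed
  have "C' \<ge> 1" using L CL L0 unfolding C'_def by (simp add: add_increasing2)
  then show ?thesis
    unfolding Let_def by (intro exI[of _ C'] conjI allI ballI impI) (use main in auto)
qed

definition exact_solution :: "real \<Rightarrow> real \<Rightarrow> real \<Rightarrow> (real \<Rightarrow> real^'n) \<Rightarrow> (real \<Rightarrow> real^'m) \<Rightarrow> bool" where
  "exact_solution \<epsilon> a b u v \<longleftrightarrow> 0 \<le> a \<and> a \<le> b \<and>
     (\<forall>t\<in>{a..b}. (u has_vector_derivative F (u t, v t) t \<epsilon>) (at t within {a..b}) \<and>
        (v has_vector_derivative (1 / \<epsilon>) *\<^sub>R G (u t, v t) t \<epsilon>) (at t within {a..b}))"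

definition deviation :: "(real \<Rightarrow> real^'n) \<Rightarrow> (real \<Rightarrow> real^'m) \<Rightarrow> real \<Rightarrow> real" where
  "deviation u v t = norm (u t - ubar t) + norm (v t - vbar t)"

text \<open>The chain rule for \<open>\<gamma> t = G (u t, v t) t \<epsilon>\<close> gives \<open>\<epsilon> \<gamma>' = DG (0, \<gamma>) + O(\<epsilon>)\<close>, and \<open>DG (0, _)\<close> differs from
  \<open>Gv s\<close> by little in a thin tube if \<open>|t - s| \<le> \<epsilon> T\<close>.\<close>
lemma fast_residual_bound:
  "\<exists>C\<ge>1. \<exists>r>0. \<exists>\<epsilon>1>0. r \<le> 1 \<and> \<epsilon>1 \<le> e \<and> (\<forall>\<epsilon> a b u v. 0 < \<epsilon> \<and> \<epsilon> \<le> \<epsilon>1 \<and>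
     exact_solution \<epsilon> a b u v \<and> (\<forall>t\<in>{a..b}. deviation u v t \<le> r) \<longrightarrow>
     (\<forall>t\<in>{a..b}. norm (G (u t, v t) t \<epsilon>) \<le> C * (deviation u v a + \<epsilon>)))"
proof -
  have L0: "0 < L" using L by simp
  obtain C \<delta> T where C: "C \<ge> 1" and \<delta>: "\<delta> > 0" and T: "T > 0" and
    stab: "\<forall>(G :: real \<Rightarrow> real^'m^'m) \<gamma> \<gamma>' a b \<epsilon> \<beta>.
      (\<forall>t\<in>{a..b}. \<forall>x. norm (G t *v x) \<le> L * norm x) \<and>
      (\<forall>t\<in>{a..b}. \<forall>z\<in>complex_spectrum (G t). Re z \<le> - \<kappa>) \<and>
      \<epsilon> > 0 \<and> \<beta> > 0 \<and>
      (\<forall>t\<in>{a..b}. (\<gamma> has_vector_derivative \<gamma>' t) (at t within {a..b})) \<and>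
      (\<forall>s\<in>{a..b}. \<forall>t\<in>{a..b}. \<bar>t - s\<bar> \<le> \<epsilon> * T \<longrightarrow>
         norm (\<epsilon> *\<^sub>R \<gamma>' t - G s *v \<gamma> t) \<le> \<delta> * norm (\<gamma> t) + \<beta>) \<longrightarrow>
      (\<forall>t\<in>{a..b}. norm (\<gamma> t) \<le> C * (norm (\<gamma> a) + \<beta>))"
    using slowly_varying_stability[OF \<kappa> L0] by blast
  obtain B where B: "B \<ge> 1" "\<And>s t. s \<ge> 0 \<Longrightarrow> t \<ge> 0 \<Longrightarrow> norm (bar s - bar t) \<le> B * \<bar>s - t\<bar>"
    using bar_lipschitz by blast
  define r where "r = min 1 (\<delta> / (2 * L))"
  define D where "D = L * (B * T + sqrt T + 1)"
  define \<epsilon>1 where "\<epsilon>1 = min (min 1 e) ((\<delta> / (2 * D))\<^sup>2)"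
  have D: "D > 0" using L0 B T by (simp add: D_def add_nonneg_pos)
  have \<epsilon>1: "\<epsilon>1 > 0" "\<epsilon>1 \<le> e" "\<epsilon>1 \<le> 1" using e \<delta> D by (auto simp: \<epsilon>1_def)
  have r: "r > 0" "r \<le> 1" "L * r \<le> \<delta> / 2"
  proof -
    show "r > 0" "r \<le> 1" using \<delta> L0 by (auto simp: r_def)
    have "L * r \<le> L * (\<delta> / (2 * L))" using L0 by (intro mult_left_mono) (auto simp: r_def)
    then show "L * r \<le> \<delta> / 2" using L0 by simp
  qed
  have main: "norm (G (u t, v t) t \<epsilon>) \<le> C * (L + 2 * L\<^sup>2) * (deviation u v a + \<epsilon>)"
    if \<epsilon>: "0 < \<epsilon>" "\<epsilon> \<le> \<epsilon>1" and sol: "exact_solution \<epsilon> a b u v"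
    and tube: "\<forall>t\<in>{a..b}. deviation u v t \<le> r" and t: "t \<in> {a..b}" for \<epsilon> a b u v t
  proof -
    have \<epsilon>e: "\<epsilon> \<in> {0..e}" using \<epsilon> \<epsilon>1 by auto
    have ab: "0 \<le> a" "a \<le> b" using sol by (auto simp: exact_solution_def)
    have pos: "0 \<le> t" if "t \<in> {a..b}" for t using that ab by auto
    have ball: "norm (u t, v t) \<le> R" if "t \<in> {a..b}" for t
      using near_bar_in_ball[OF pos[OF that], of "u t" "v t"] tube that r by (force simp: deviation_def)
    define \<gamma> where "\<gamma> t = G (u t, v t) t \<epsilon>" for t
    define \<gamma>' where "\<gamma>' t = DG (u t, v t) t \<epsilon> (F (u t, v t) t \<epsilon>, (1 / \<epsilon>) *\<^sub>R \<gamma> t) + DtG (u t, v t) t \<epsilon>" for t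
    have der: "(\<gamma> has_vector_derivative \<gamma>' t) (at t within {a..b})" if t: "t \<in> {a..b}" for t
      unfolding \<gamma>_def \<gamma>'_def
    proof (rule regular_chain_rule[OF regG \<epsilon>e])
      show "((\<lambda>t. (u t, v t)) has_vector_derivative (F (u t, v t) t \<epsilon>, (1 / \<epsilon>) *\<^sub>R G (u t, v t) t \<epsilon>)) (at t within {a..b})"
        using sol t by (intro has_vector_derivative_Pair) (auto simp: exact_solution_def)
    qed (use t ball ab in auto)
    have near: "norm (\<epsilon> *\<^sub>R \<gamma>' t - Gv s *v \<gamma> t) \<le> \<delta> * norm (\<gamma> t) + 2 * L\<^sup>2 * \<epsilon>"
      if s: "s \<in> {a..b}" and t: "t \<in> {a..b}" and st: "\<bar>t - s\<bar> \<le> \<epsilon> * T" for s t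
    proof -
      define X where "X = (u t, v t)"
      have XR: "norm X \<le> R" using ball[OF t] by (simp add: X_def)
      have "DG X t \<epsilon> (F X t \<epsilon>, (1 / \<epsilon>) *\<^sub>R \<gamma> t) = DG X t \<epsilon> (F X t \<epsilon>, 0) + (1 / \<epsilon>) *\<^sub>R DG X t \<epsilon> (0, \<gamma> t)"
        by (simp flip: blinfun.add_right blinfun.scaleR_right)
      then have eq: "\<epsilon> *\<^sub>R \<gamma>' t - Gv s *v \<gamma> t =
          \<epsilon> *\<^sub>R DG X t \<epsilon> (F X t \<epsilon>, 0) + \<epsilon> *\<^sub>R DtG X t \<epsilon> + (DG X t \<epsilon> - DG (bar s) s 0) (0, \<gamma> t)"
        using \<epsilon> by (simp add: \<gamma>'_def X_def Gv[OF pos[OF s]] scaleR_add_right blinfun.diff_left)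
      have 1: "norm (\<epsilon> *\<^sub>R DG X t \<epsilon> (F X t \<epsilon>, 0)) \<le> \<epsilon> * L\<^sup>2"
      proof -
        have "norm (DG X t \<epsilon> (F X t \<epsilon>, 0)) \<le> L * norm (F X t \<epsilon>)"
          by (intro norm_blinfun_partial_le regular_on_ballD(2)[OF regG XR pos[OF t] \<epsilon>e])
        also have "\<dots> \<le> L * L"
          using regular_on_ballD(1)[OF regF XR pos[OF t] \<epsilon>e] L0 by (intro mult_left_mono) auto
        finally show ?thesis using \<epsilon> by (simp add: power2_eq_square)
      qed
      have 2: "norm (\<epsilon> *\<^sub>R DtG X t \<epsilon>) \<le> \<epsilon> * L\<^sup>2"
      proof -
        have "norm (DtG X t \<epsilon>) \<le> L" using regular_on_ballD(3)[OF regG XR pos[OF t] \<epsilon>e] .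
        also have "L \<le> L\<^sup>2" using L by (simp add: power2_eq_square)
        finally show ?thesis using \<epsilon> by simp
      qed
      have 3: "norm ((DG X t \<epsilon> - DG (bar s) s 0) (0, \<gamma> t)) \<le> \<delta> * norm (\<gamma> t)"
      proof -
        have "norm (X - bar s) \<le> norm (X - bar t) + norm (bar t - bar s)"
          using dist_triangle[of X "bar s" "bar t"] unfolding dist_norm .
        also have "\<dots> \<le> r + B * \<bar>t - s\<bar>"
          using norm_Pair_le[of "u t - ubar t" "v t - vbar t"] tube t B(2)[OF pos[OF t] pos[OF s]]
          by (intro add_mono) (force simp: X_def deviation_def)+
        finally have X: "norm (X - bar s) \<le> r + B * \<bar>t - s\<bar>" .
        \<comment> \<open>All small terms are expressed through \<open>sqrt \<epsilon>\<close>, the order that the Hoelder bound gives.\<close>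
        have \<epsilon>s: "\<epsilon> \<le> sqrt \<epsilon>"
          using \<epsilon> \<epsilon>1 real_le_rsqrt[of \<epsilon> \<epsilon>] by (simp add: power2_eq_square mult_left_le)
        have "norm (DG X t \<epsilon> - DG (bar s) s 0) \<le> L * (norm (X - bar s) + sqrt \<bar>t - s\<bar> + sqrt \<epsilon>)"
          using regular_on_ballD(7)[OF regG XR pos[OF t] \<epsilon>e bar_in_ball[OF pos[OF s]] pos[OF s] zero_param] \<epsilon> by simp
        also have "\<dots> \<le> L * ((r + B * (T * sqrt \<epsilon>)) + sqrt T * sqrt \<epsilon> + sqrt \<epsilon>)"
        proof (intro mult_left_mono add_mono order.refl)
          have "\<bar>t - s\<bar> \<le> T * sqrt \<epsilon>"
          proof -
            have "\<epsilon> * T \<le> sqrt \<epsilon> * T" using \<epsilon>s T by (intro mult_right_mono) auto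
            then show ?thesis using st by (simp add: mult.commute)
          qed
          then show "norm (X - bar s) \<le> r + B * (T * sqrt \<epsilon>)"
          proof -
            assume "\<bar>t - s\<bar> \<le> T * sqrt \<epsilon>"
            then have "B * \<bar>t - s\<bar> \<le> B * (T * sqrt \<epsilon>)" using B(1) by (intro mult_left_mono) auto
            then show ?thesis using X by linarith
          qed
          show "sqrt \<bar>t - s\<bar> \<le> sqrt T * sqrt \<epsilon>"
            using real_sqrt_le_mono[OF st] by (simp add: real_sqrt_mult mult.commute)
        qed (use L0 in auto)
        also have "\<dots> = L * r + D * sqrt \<epsilon>" by (simp add: D_def algebra_simps)
        also have "\<dots> \<le> \<delta> / 2 + D * (\<delta> / (2 * D))"
        proof (intro add_mono r(3) mult_left_mono)
          have "sqrt \<epsilon> \<le> sqrt ((\<delta> / (2 * D))\<^sup>2)" using \<epsilon> by (intro real_sqrt_le_mono) (simp add: \<epsilon>1_def)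
          then show "sqrt \<epsilon> \<le> \<delta> / (2 * D)" using \<delta> D by simp
        qed (use D in auto)
        also have "\<dots> = \<delta>" using D by simp
        finally have "norm (DG X t \<epsilon> - DG (bar s) s 0) * norm (\<gamma> t) \<le> \<delta> * norm (\<gamma> t)"
          by (rule mult_right_mono) simp
        then show ?thesis
          using norm_blinfun[of "DG X t \<epsilon> - DG (bar s) s 0" "(0, \<gamma> t)"] by (simp add: norm_Pair)
      qed
      show ?thesis
        unfolding eq mult.commute[of "2 * L\<^sup>2" \<epsilon>] using 1 2 3
          norm_triangle_ineq[of "\<epsilon> *\<^sub>R DG X t \<epsilon> (F X t \<epsilon>, 0) + \<epsilon> *\<^sub>R DtG X t \<epsilon>" "(DG X t \<epsilon> - DG (bar s) s 0) (0, \<gamma> t)"]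
          norm_triangle_ineq[of "\<epsilon> *\<^sub>R DG X t \<epsilon> (F X t \<epsilon>, 0)" "\<epsilon> *\<^sub>R DtG X t \<epsilon>"]
        by simp
    qed
    have "norm (\<gamma> t) \<le> C * (norm (\<gamma> a) + 2 * L\<^sup>2 * \<epsilon>)"
    proof (rule stab[rule_format, of a b Gv \<epsilon> "2 * L\<^sup>2 * \<epsilon>" \<gamma> \<gamma>'], intro conjI ballI allI impI)
      show "Re z \<le> - \<kappa>" if "t \<in> {a..b}" "z \<in> complex_spectrum (Gv t)" for t z
        using spectrum[OF pos[OF that(1)] that(2)] .
      show "norm (Gv t *v x) \<le> L * norm x" if "t \<in> {a..b}" for t x
        by (rule Gv_bound[OF pos[OF that]])
      show "norm (\<epsilon> *\<^sub>R \<gamma>' t - Gv s *v \<gamma> t) \<le> \<delta> * norm (\<gamma> t) + 2 * L\<^sup>2 * \<epsilon>"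
        if "s \<in> {a..b}" "t \<in> {a..b}" "\<bar>t - s\<bar> \<le> \<epsilon> * T" for s t
        using near[OF that] .
    qed (use der \<epsilon> L0 t in auto)
    also have "norm (\<gamma> a) \<le> L * (deviation u v a + \<epsilon>)"
    proof -
      have a: "a \<in> {a..b}" using ab by simp
      have "norm (\<gamma> a) \<le> L * (norm ((u a, v a) - bar a) + \<epsilon>)"
        using regular_on_ballD(6)[OF regG ball[OF a] ab(1) \<epsilon>e bar_in_ball[OF ab(1)] ab(1) zero_param]
          bar_root[OF ab(1)] \<epsilon> by (simp add: \<gamma>_def)
      also have "\<dots> \<le> L * (deviation u v a + \<epsilon>)"
        using norm_Pair_le[of "u a - ubar a" "v a - vbar a"] L0 by (simp add: deviation_def)
      finally show ?thesis .
    qed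
    also have "L * (deviation u v a + \<epsilon>) + 2 * L\<^sup>2 * \<epsilon> \<le> L * (deviation u v a + \<epsilon>) + 2 * L\<^sup>2 * (deviation u v a + \<epsilon>)"
      by (simp add: deviation_def mult_left_mono)
    finally show ?thesis using C by (simp add: \<gamma>_def algebra_simps)
  qed
  have "1 \<le> C * (L + 2 * L\<^sup>2)"
    using mult_mono[of 1 C 1 "L + 2 * L\<^sup>2"] C L by (simp add: add_increasing2)
  then show ?thesis
    using main \<epsilon>1(1,2) r(1,2) by blast
qed

text \<open>The three estimates are combined at the time \<open>s\<close> where \<open>|x|\<close> is largest: the bound for \<open>S = |x s|\<close>
  contains \<open>S\<close> itself, but with a factor proportional to the width \<open>r\<close> of the tube, which is chosen to make this
  factor at most one half.\<close>
lemma a_priori_estimate: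
  "\<exists>C\<ge>1. \<exists>r>0. \<exists>\<epsilon>1>0. r \<le> 1 \<and> \<epsilon>1 \<le> e \<and> (\<forall>\<epsilon> a b u v. 0 < \<epsilon> \<and> \<epsilon> \<le> \<epsilon>1 \<and>
     exact_solution \<epsilon> a b u v \<and> (\<forall>t\<in>{a..b}. deviation u v t \<le> r) \<longrightarrow>
     deviation u v b \<le> C * (deviation u v a + \<epsilon>))"
proof -
  obtain Cg r0 \<epsilon>1 where Cg: "Cg \<ge> 1" and r0: "r0 > 0" "r0 \<le> 1" and \<epsilon>1: "\<epsilon>1 > 0" "\<epsilon>1 \<le> e" and
    fast: "\<And>\<epsilon> a b u v t. 0 < \<epsilon> \<Longrightarrow> \<epsilon> \<le> \<epsilon>1 \<Longrightarrow> exact_solution \<epsilon> a b u v \<Longrightarrow>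
      \<forall>t\<in>{a..b}. deviation u v t \<le> r0 \<Longrightarrow> t \<in> {a..b} \<Longrightarrow>
      norm (G (u t, v t) t \<epsilon>) \<le> Cg * (deviation u v a + \<epsilon>)"
    using fast_residual_bound by blast
  obtain C1 where C1: "C1 \<ge> 1" and
    lin: "\<And>t \<epsilon> u v q d. t \<ge> 0 \<Longrightarrow> \<epsilon> \<in> {0..e} \<Longrightarrow> q = norm (u - ubar t) + norm (v - vbar t) \<Longrightarrow> q \<le> 1 \<Longrightarrow>
       d = norm (G (u, v) t \<epsilon>) + \<epsilon> + q\<^sup>2 \<Longrightarrow>
       norm (v - vbar t) \<le> C1 * (norm (u - ubar t) + d) \<and>
       norm (F (u, v) t \<epsilon> - F (bar t) t 0 - J t *v (u - ubar t)) \<le> C1 * d"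
    using linearisation unfolding Let_def by blast
  define C3 where "C3 = 4 * C1 * (Cg + 1)"
  define c where "c = 3 * K / \<alpha>"
  \<comment> \<open>The second entry absorbs \<open>q\<^sup>2\<close> in the bound for \<open>q\<close>, the third one the feedback of \<open>S\<close> on itself.\<close>
  define r where "r = Min {r0, 1 / (2 * C1), 1 / (2 * (c * C1 * C3))}"
  have c: "c > 0" using K \<alpha> by (simp add: c_def)
  have C3: "C3 \<ge> 1" using mult_mono[of 1 C1 1 "Cg + 1"] C1 Cg by (simp add: C3_def)
  have r: "r > 0" "r \<le> r0" "C1 * r \<le> 1 / 2" "c * C1 * C3 * r \<le> 1 / 2"
  proof -
    have pos: "0 < c * C1 * C3" using c C1 C3 by simp
    show "r > 0" using r0 C1 pos by (simp add: r_def)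
    show "r \<le> r0" by (simp add: r_def)
    have "r \<le> 1 / (2 * C1)" by (simp add: r_def)
    then show "C1 * r \<le> 1 / 2" using C1 by (simp add: field_simps)
    have "r \<le> 1 / (2 * (c * C1 * C3))" by (simp add: r_def)
    then show "c * C1 * C3 * r \<le> 1 / 2" using pos by (simp add: field_simps)
  qed
  define C6 where "C6 = 2 * K + 2 * c * C1 * (Cg + 1) + 1"
  have C6: "C6 \<ge> 1" using K c C1 Cg by (simp add: C6_def)
  have main: "deviation u v b \<le> C3 * (C6 + 1) * (deviation u v a + \<epsilon>)"
    if \<epsilon>: "0 < \<epsilon>" "\<epsilon> \<le> \<epsilon>1" and sol: "exact_solution \<epsilon> a b u v"
    and tube: "\<forall>t\<in>{a..b}. deviation u v t \<le> r" for \<epsilon> a b u v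
  proof -
    have ab: "0 \<le> a" "a \<le> b" using sol by (auto simp: exact_solution_def)
    have \<epsilon>e: "\<epsilon> \<in> {0..e}" using \<epsilon> \<epsilon>1 by auto
    define m where "m = deviation u v a + \<epsilon>"
    define q where "q t = deviation u v t" for t
    define x where "x t = u t - ubar t" for t
    have q0: "0 \<le> q t" for t by (simp add: q_def deviation_def)
    have m: "m > 0" "\<epsilon> \<le> m" "norm (x a) \<le> m"
      using \<epsilon> q0[of a] by (auto simp: m_def q_def deviation_def x_def add_nonneg_pos)
    have qr: "q t \<le> r" if "t \<in> {a..b}" for t using tube that by (simp add: q_def)
    define d where "d t = norm (G (u t, v t) t \<epsilon>) + \<epsilon> + (q t)\<^sup>2" for t
    have d: "d t \<le> (Cg + 1) * m + r * q t" if t: "t \<in> {a..b}" for t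
    proof -
      have "norm (G (u t, v t) t \<epsilon>) \<le> Cg * m"
        unfolding m_def using tube r(2) t by (intro fast[OF \<epsilon> sol]) force+
      moreover have "(q t)\<^sup>2 \<le> r * q t"
        using mult_right_mono[OF qr[OF t] q0[of t]] by (simp add: power2_eq_square)
      ultimately show ?thesis using m by (simp add: d_def algebra_simps)
    qed
    have lin_t: "norm (v t - vbar t) \<le> C1 * (norm (x t) + d t)"
      "norm (F (u t, v t) t \<epsilon> - F (bar t) t 0 - J t *v x t) \<le> C1 * d t" if t: "t \<in> {a..b}" for t
    proof -
      have "q t \<le> 1" using qr[OF t] r(2) r0(2) by linarith
      then show "norm (v t - vbar t) \<le> C1 * (norm (x t) + d t)"
        "norm (F (u t, v t) t \<epsilon> - F (bar t) t 0 - J t *v x t) \<le> C1 * d t"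
        using lin[of t \<epsilon> "q t" "u t" "v t" "d t"] t ab \<epsilon>e
        by (auto simp: q_def d_def deviation_def x_def)
    qed
    have q_le: "q t \<le> C3 * (norm (x t) + m)" if t: "t \<in> {a..b}" for t
    proof -
      have "q t \<le> norm (x t) + C1 * (norm (x t) + d t)"
        using lin_t(1)[OF t] by (simp add: q_def deviation_def x_def)
      also have "\<dots> \<le> norm (x t) + C1 * (norm (x t) + ((Cg + 1) * m + r * q t))"
        using d[OF t] C1 by (intro add_left_mono mult_left_mono) auto
      also have "\<dots> = norm (x t) + C1 * norm (x t) + C1 * (Cg + 1) * m + C1 * r * q t"
        by (simp add: algebra_simps)
      also have "C1 * r * q t \<le> 1 / 2 * q t" using r(3) q0 by (intro mult_right_mono) auto
      finally have "q t \<le> 2 * (norm (x t) + C1 * norm (x t) + C1 * (Cg + 1) * m)" by simp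
      also have "\<dots> \<le> 2 * (C1 * (Cg + 1) * norm (x t) + C1 * (Cg + 1) * norm (x t) + C1 * (Cg + 1) * m + C1 * (Cg + 1) * m)"
      proof -
        have "1 * norm (x t) \<le> C1 * (Cg + 1) * norm (x t)"
          using mult_mono[of 1 C1 1 "Cg + 1"] C1 Cg by (intro mult_right_mono) auto
        moreover have "C1 * norm (x t) \<le> C1 * (Cg + 1) * norm (x t)"
          using C1 Cg by (intro mult_right_mono) auto
        moreover have "0 \<le> C1 * (Cg + 1) * m" using C1 Cg m by simp
        moreover have "2 * (p + c + w) \<le> 2 * (A + A + w + w)" if "1 * p \<le> A" "c \<le> A" "0 \<le> w" for p c w A :: real
          using that by simp
        ultimately show ?thesis by blast
      qed
      also have "\<dots> = C3 * (norm (x t) + m)" by (simp add: C3_def algebra_simps)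
      finally show ?thesis .
    qed
    have x_der: "(x has_vector_derivative F (u t, v t) t \<epsilon> - F (bar t) t 0) (at t within {a..b})"
      if t: "t \<in> {a..b}" for t
    proof -
      have "(ubar has_vector_derivative F (bar t) t 0) (at t within {a..b})"
        by (rule has_vector_derivative_within_subset[OF ubar]) (use t ab in auto)
      then show ?thesis
        unfolding x_def using sol t by (intro has_vector_derivative_diff) (auto simp: exact_solution_def)
    qed
    have "continuous_on {a..b} x" using x_der by (rule continuous_on_vector_derivative)
    then have "continuous_on {a..b} (\<lambda>t. norm (x t))" by (rule continuous_on_norm)
    then obtain s where s: "s \<in> {a..b}" "\<forall>t\<in>{a..b}. norm (x t) \<le> norm (x s)"
      using continuous_attains_sup[of "{a..b}" "\<lambda>t. norm (x t)"] ab by auto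
    define S where "S = norm (x s)"
    define \<beta> where "\<beta> = C1 * ((Cg + 1) * m + r * (C3 * (S + m)))"
    have "norm (x s) \<le> K * norm (x a) + 3 * K * \<beta> / \<alpha>"
    proof (rule exponential_stability_with_forcing[OF Y K \<alpha> dichotomy])
      show "0 \<le> a" "a \<le> s" using ab s by auto
      show "(x has_vector_derivative F (u t, v t) t \<epsilon> - F (bar t) t 0) (at t within {a..s})"
        if "t \<in> {a..s}" for t
        by (rule has_vector_derivative_within_subset[OF x_der]) (use that s in auto)
      have "0 < (Cg + 1) * m" using Cg m by simp
      moreover have "0 \<le> r * (C3 * (S + m))" using r(1) C3 m by (simp add: S_def)
      ultimately show "\<beta> > 0" using C1 by (simp add: \<beta>_def add_pos_nonneg)
      fix t assume "t \<in> {a..s}"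
      then have t: "t \<in> {a..b}" using s by auto
      have "norm (F (u t, v t) t \<epsilon> - F (bar t) t 0 - J t *v x t) \<le> C1 * d t" by (rule lin_t(2)[OF t])
      also have "\<dots> \<le> C1 * ((Cg + 1) * m + r * q t)" using d[OF t] C1 by (intro mult_left_mono) auto
      also have "\<dots> \<le> \<beta>"
        unfolding \<beta>_def
      proof (intro mult_left_mono add_left_mono)
        have "C3 * (norm (x t) + m) \<le> C3 * (S + m)"
          using s(2) t C3 by (intro mult_left_mono) (auto simp: S_def)
        then show "q t \<le> C3 * (S + m)" using q_le[OF t] by linarith
      qed (use C1 r in auto)
      finally show "norm (F (u t, v t) t \<epsilon> - F (bar t) t 0 - J t *v x t) \<le> \<beta>" .
    qed
    also have "3 * K * \<beta> / \<alpha> = c * C1 * (Cg + 1) * m + (c * C1 * C3 * r) * (S + m)"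
      by (simp add: c_def \<beta>_def algebra_simps add_divide_distrib)
    also have "(c * C1 * C3 * r) * (S + m) \<le> 1 / 2 * (S + m)"
      using r(4) m by (intro mult_right_mono) (auto simp: S_def)
    also have "K * norm (x a) \<le> K * m" using m K by simp
    finally have "S \<le> K * m + (c * C1 * (Cg + 1) * m + 1 / 2 * (S + m))" by (simp add: S_def)
    moreover have "S \<le> 2 * k + 2 * w + m" if "S \<le> k + (w + 1 / 2 * (S + m))" for k w :: real
      using that by argo
    ultimately have "S \<le> 2 * (K * m) + 2 * (c * C1 * (Cg + 1) * m) + m" by blast
    also have "\<dots> = C6 * m" by (simp add: C6_def algebra_simps)
    finally have S: "S \<le> C6 * m" .
    have b: "b \<in> {a..b}" using ab by simp
    have "q b \<le> C3 * (norm (x b) + m)" by (rule q_le[OF b])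
    also have "\<dots> \<le> C3 * (C6 * m + m)"
      using bspec[OF s(2) b] S C3 unfolding S_def by (intro mult_left_mono add_mono) auto
    also have "\<dots> = C3 * (C6 + 1) * m" by (simp add: algebra_simps)
    finally show ?thesis by (simp add: q_def m_def)
  qed
  have "1 \<le> C3 * (C6 + 1)" using mult_mono[of 1 C3 1 "C6 + 1"] C3 C6 by simp
  moreover have "r \<le> 1" using r(2) r0(2) by linarith
  ultimately show ?thesis using main \<epsilon>1 r(1) by blast
qed

text \<open>The continuity method: at the first time of reaching \<open>r\<close> the value would be at most \<open>M < r\<close>.\<close>
lemma no_exit:
  fixes \<phi> :: "real \<Rightarrow> real"
  assumes cont: "continuous_on {a..} \<phi>" and "\<phi> a < r" "M < r"
    and step: "\<And>b. a \<le> b \<Longrightarrow> (\<And>t. t \<in> {a..b} \<Longrightarrow> \<phi> t \<le> r) \<Longrightarrow> \<phi> b \<le> M"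
    and "a \<le> t"
  shows "\<phi> t \<le> M"
proof -
  have "\<phi> s \<le> r" if "a \<le> s" for s
  proof (rule ccontr)
    assume neg: "\<not> \<phi> s \<le> r"
    define Z where "Z = {t \<in> {a..s}. \<phi> t = r}"
    have cs: "continuous_on {a..s} \<phi>" using cont by (rule continuous_on_subset) auto
    have ivt: "\<exists>z\<in>{a..b}. \<phi> z = r" if "a \<le> b" "b \<le> s" "\<phi> b > r" for b
      using IVT'[of \<phi> a r b] that assms(2) continuous_on_subset[OF cs, of "{a..b}"] by fastforce
    have "Z = {a..s} \<inter> \<phi> -` {r}" by (auto simp: Z_def)
    moreover have "closed \<dots>" using cs by (intro continuous_closed_preimage) auto
    ultimately have "closed Z" by simp
    moreover have "Z \<noteq> {}" using ivt[of s] neg \<open>a \<le> s\<close> by (auto simp: Z_def)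
    moreover have bb: "bdd_below Z" by (auto simp: Z_def)
    ultimately have z: "Inf Z \<in> Z" by (intro closed_contains_Inf) auto
    have "\<phi> (Inf Z) \<le> M"
    proof (rule step)
      show "a \<le> Inf Z" using z by (auto simp: Z_def)
      fix t assume t: "t \<in> {a..Inf Z}"
      show "\<phi> t \<le> r"
      proof (rule ccontr)
        assume "\<not> \<phi> t \<le> r"
        moreover have "t \<le> s" using t z by (auto simp: Z_def)
        ultimately obtain y where y: "y \<in> {a..t}" "\<phi> y = r" using ivt[of t] t by auto
        then have "y \<in> Z" using \<open>t \<le> s\<close> by (auto simp: Z_def)
        then have "Inf Z \<le> y" using bb by (intro cInf_lower)
        then have "y = t" using y t by auto
        then show False using y \<open>\<not> \<phi> t \<le> r\<close> by simp
      qed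
    qed
    then show False using z assms(3) by (auto simp: Z_def)
  qed
  then show ?thesis using step[of t] assms(5) by auto
qed

text \<open>Common to the solutions of the original system and those of a system truncated outside the ball, so that
  one set of estimates serves both.\<close>
definition solution_in_ball :: "real \<Rightarrow> (real \<Rightarrow> real^'n) \<Rightarrow> (real \<Rightarrow> real^'m) \<Rightarrow> bool" where
  "solution_in_ball \<epsilon> u v \<longleftrightarrow> (\<exists>u' v'. \<forall>t\<ge>0.
     (u has_vector_derivative u' t) (at t within {0..}) \<and> (v has_vector_derivative v' t) (at t within {0..}) \<and>
     (norm (u t, v t) \<le> R \<longrightarrow> u' t = F (u t, v t) t \<epsilon> \<and> v' t = (1 / \<epsilon>) *\<^sub>R G (u t, v t) t \<epsilon>))"

lemma slow_manifold_stability: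
  "\<exists>C\<ge>1. \<exists>r>0. \<exists>\<epsilon>1>0. r \<le> 1 \<and> \<epsilon>1 \<le> e \<and> (\<forall>\<epsilon> a t u v. 0 < \<epsilon> \<and> \<epsilon> \<le> \<epsilon>1 \<and> 0 \<le> a \<and> a \<le> t \<and>
     solution_in_ball \<epsilon> u v \<and> C * (deviation u v a + \<epsilon>) < r \<longrightarrow>
     deviation u v t \<le> C * (deviation u v a + \<epsilon>))"
proof -
  obtain C r \<epsilon>1 where C: "C \<ge> 1" and r: "r > 0" "r \<le> 1" and \<epsilon>1: "\<epsilon>1 > 0" "\<epsilon>1 \<le> e" and
    apriori: "\<And>\<epsilon> a b u v. 0 < \<epsilon> \<Longrightarrow> \<epsilon> \<le> \<epsilon>1 \<Longrightarrow> exact_solution \<epsilon> a b u v \<Longrightarrow>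
      \<forall>t\<in>{a..b}. deviation u v t \<le> r \<Longrightarrow> deviation u v b \<le> C * (deviation u v a + \<epsilon>)"
    using a_priori_estimate by blast
  have main: "deviation u v t \<le> C * (deviation u v a + \<epsilon>)"
    if \<epsilon>: "0 < \<epsilon>" "\<epsilon> \<le> \<epsilon>1" and at: "0 \<le> a" "a \<le> t" and sol: "solution_in_ball \<epsilon> u v"
    and small: "C * (deviation u v a + \<epsilon>) < r" for \<epsilon> a t u v
  proof (rule no_exit[where \<phi> = "deviation u v" and a = a and r = r])
    obtain u' v' where u: "\<And>t. t \<ge> 0 \<Longrightarrow> (u has_vector_derivative u' t) (at t within {0..})"
      and v: "\<And>t. t \<ge> 0 \<Longrightarrow> (v has_vector_derivative v' t) (at t within {0..})"
      and ode: "\<And>t. t \<ge> 0 \<Longrightarrow> norm (u t, v t) \<le> R \<Longrightarrow>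
         u' t = F (u t, v t) t \<epsilon> \<and> v' t = (1 / \<epsilon>) *\<^sub>R G (u t, v t) t \<epsilon>"
      using sol unfolding solution_in_ball_def by blast
    have "continuous_on {0..} u" "continuous_on {0..} v" "continuous_on {0..} ubar" "continuous_on {0..} vbar"
      using continuous_on_vector_derivative[of "{0..}" u u'] continuous_on_vector_derivative[of "{0..}" v v']
        continuous_on_vector_derivative[of "{0..}" ubar "\<lambda>t. F (bar t) t 0"]
        continuous_on_vector_derivative[of "{0..}" vbar vbar'] u v ubar vbar by auto
    then have "continuous_on {0..} (deviation u v)"
      unfolding deviation_def by (intro continuous_intros)
    then show "continuous_on {a..} (deviation u v)"
      by (rule continuous_on_subset) (use at in auto)
    have dev0: "0 \<le> deviation u v a" by (simp add: deviation_def)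
    have "1 * deviation u v a \<le> C * (deviation u v a + \<epsilon>)"
      using C \<epsilon> dev0 by (intro mult_mono) auto
    then show "deviation u v a < r" using small by simp
    fix b assume b: "a \<le> b" and tube: "\<And>t. t \<in> {a..b} \<Longrightarrow> deviation u v t \<le> r"
    show "deviation u v b \<le> C * (deviation u v a + \<epsilon>)"
    proof (rule apriori[OF \<epsilon>])
      show "exact_solution \<epsilon> a b u v"
        unfolding exact_solution_def
      proof (intro conjI ballI)
        fix t assume t: "t \<in> {a..b}"
        then have t0: "0 \<le> t" using at by auto
        have "norm (u t, v t) \<le> R"
          using near_bar_in_ball[OF t0, of "u t" "v t"] tube[OF t] r(2) by (simp add: deviation_def)
        then have eq: "u' t = F (u t, v t) t \<epsilon>" "v' t = (1 / \<epsilon>) *\<^sub>R G (u t, v t) t \<epsilon>"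
          using ode[OF t0] by auto
        have sub: "{a..b} \<subseteq> {0..}" using at by auto
        show "(u has_vector_derivative F (u t, v t) t \<epsilon>) (at t within {a..b})"
          using has_vector_derivative_within_subset[OF u[OF t0] sub] unfolding eq .
        show "(v has_vector_derivative (1 / \<epsilon>) *\<^sub>R G (u t, v t) t \<epsilon>) (at t within {a..b})"
          using has_vector_derivative_within_subset[OF v[OF t0] sub] unfolding eq .
      qed (use at b in auto)
    qed (use tube in auto)
  qed (use small at in auto)
  then show ?thesis using C r \<epsilon>1 by blast
qed

end

section \<open>Global existence\<close>

lemma has_integral_exp_scaled:
  fixes \<omega> t :: real
  assumes "\<omega> > 0" "t \<ge> 0"
  shows "((\<lambda>s. c * exp (\<omega> * s)) has_integral c * (exp (\<omega> * t) - 1) / \<omega>) {0..t}"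
proof -
  have "((\<lambda>s. c * exp (\<omega> * s)) has_integral (c / \<omega> * exp (\<omega> * t) - c / \<omega> * exp (\<omega> * 0))) {0..t}"
  proof (rule fundamental_theorem_of_calculus[OF assms(2)])
    fix s assume "s \<in> {0..t}"
    have "((\<lambda>s. c / \<omega> * exp (\<omega> * s)) has_real_derivative c / \<omega> * (exp (\<omega> * s) * \<omega>)) (at s within {0..t})"
      by (auto intro!: derivative_eq_intros)
    then show "((\<lambda>s. c / \<omega> * exp (\<omega> * s)) has_vector_derivative c * exp (\<omega> * s)) (at s within {0..t})"
      using assms(1) by (simp add: has_real_derivative_iff_has_vector_derivative)
  qed
  then show ?thesis by (simp add: algebra_simps diff_divide_distrib)
qed

text \<open>In the norm weighted by \<open>exp (- 2 L t)\<close> the Picard operator contracts with factor one half on the whole half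
  line at once. The unknown is \<open>y t = exp (- 2 L t) x t\<close>, a bounded continuous function on the real line,
  where negative times are sent to 0.\<close>
lemma Picard_Lindelof_global:
  fixes \<Phi> :: "real \<Rightarrow> 'a::euclidean_space \<Rightarrow> 'a"
  assumes cont: "continuous_on ({0..} \<times> UNIV) (\<lambda>(t, x). \<Phi> t x)"
    and bound: "\<And>t x. t \<ge> 0 \<Longrightarrow> norm (\<Phi> t x) \<le> M"
    and lip: "\<And>t x y. t \<ge> 0 \<Longrightarrow> norm (\<Phi> t x - \<Phi> t y) \<le> L * norm (x - y)" and L: "L > 0"
  shows "\<exists>x. x 0 = x0 \<and> (\<forall>t\<ge>0. (x has_vector_derivative \<Phi> t (x t)) (at t within {0..}))"
proof -
  define \<omega> where "\<omega> = 2 * L"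
  have \<omega>: "\<omega> > 0" using L by (simp add: \<omega>_def)
  have M: "M \<ge> 0" using order.trans[OF norm_ge_zero bound[of 0]] by simp
  define h where "h y s = \<Phi> s (exp (\<omega> * s) *\<^sub>R y s)" for y :: "real \<Rightarrow> 'a" and s
  define U where "U y t = exp (- \<omega> * t) *\<^sub>R (x0 + integral {0..t} (h y))" for y t
  have h_cont: "continuous_on {0..} (h (apply_bcontfun y))" for y
  proof -
    have "continuous_on {0..} (\<lambda>s. (s, exp (\<omega> * s) *\<^sub>R apply_bcontfun y s))"
      by (intro continuous_intros continuous_on_apply_bcontfun)
    then have "continuous_on {0..} (\<lambda>s. (\<lambda>(t, x). \<Phi> t x) (s, exp (\<omega> * s) *\<^sub>R apply_bcontfun y s))"
      by (rule continuous_on_compose2[OF cont]) auto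
    then show ?thesis by (simp add: h_def[abs_def])
  qed
  have h_int: "h (apply_bcontfun y) integrable_on {0..t}" for y t
    by (rule integrable_continuous_real, rule continuous_on_subset[OF h_cont]) auto
  have int_der: "((\<lambda>t. integral {0..t} (h (apply_bcontfun y))) has_vector_derivative h (apply_bcontfun y) t) (at t within {0..})"
    if "t \<ge> 0" for t y
  proof -
    have "((\<lambda>t. integral {0..t} (h (apply_bcontfun y))) has_vector_derivative h (apply_bcontfun y) t) (at t within {0..t+1})"
      by (rule integral_has_vector_derivative, rule continuous_on_subset[OF h_cont]) (use that in auto)
    moreover have "at t within {0..t+1} = at t within {0..}"
      by (rule at_within_nhd[of t "{..<t+1}"]) (use that in auto)
    ultimately show ?thesis by simp
  qed
  have U_cont: "continuous_on {0..} (U (apply_bcontfun y))" for y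
  proof -
    have "continuous_on {0..} (\<lambda>t. integral {0..t} (h (apply_bcontfun y)))"
      by (rule continuous_on_vector_derivative) (use int_der in auto)
    then show ?thesis unfolding U_def by (intro continuous_intros)
  qed
  have U_bound: "norm (U (apply_bcontfun y) t) \<le> norm x0 + M / \<omega>" if t: "t \<ge> 0" for y t
  proof -
    have "norm (integral {0..t} (h (apply_bcontfun y))) \<le> M * t"
      using integral_bound[of 0 t "h (apply_bcontfun y)" M] continuous_on_subset[OF h_cont, of "{0..t}" y] t bound
      by (auto simp: h_def)
    then have "norm (x0 + integral {0..t} (h (apply_bcontfun y))) \<le> norm x0 + M * t"
      using norm_triangle_ineq[of x0 "integral {0..t} (h (apply_bcontfun y))"] by linarith
    then have "norm (U (apply_bcontfun y) t) \<le> exp (- \<omega> * t) * (norm x0 + M * t)"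
      by (simp add: U_def)
    also have "\<dots> = exp (- \<omega> * t) * norm x0 + M / \<omega> * (exp (- \<omega> * t) * (\<omega> * t))"
      using \<omega> by (simp add: algebra_simps)
    also have "\<dots> \<le> 1 * norm x0 + M / \<omega> * 1"
    proof (intro add_mono mult_mono)
      have "exp (- \<omega> * t) * (\<omega> * t) \<le> exp (- \<omega> * t) * exp (\<omega> * t)"
      proof (rule mult_left_mono)
        show "\<omega> * t \<le> exp (\<omega> * t)" using exp_ge_add_one_self[of "\<omega> * t"] by linarith
      qed simp
      then show "exp (- \<omega> * t) * (\<omega> * t) \<le> 1" by (simp add: exp_add[symmetric])
    qed (use t \<omega> M in auto)
    finally show ?thesis by simp
  qed
  define S where "S y = Bcontfun (\<lambda>t. U (apply_bcontfun y) (max 0 t))" for y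
  have S: "apply_bcontfun (S y) = (\<lambda>t. U (apply_bcontfun y) (max 0 t))" for y
    unfolding S_def
  proof (rule Bcontfun_inverse, rule bcontfun_normI)
    show "continuous_on UNIV (\<lambda>t. U (apply_bcontfun y) (max 0 t))"
      by (rule continuous_on_compose2[OF U_cont]) (auto intro!: continuous_intros)
    show "norm (U (apply_bcontfun y) (max 0 t)) \<le> norm x0 + M / \<omega>" for t
      by (rule U_bound) simp
  qed
  have contr: "dist (S y) (S z) \<le> 1 / 2 * dist y z" for y z
  proof (rule dist_bound)
    fix t0 :: real
    define t where "t = max 0 t0"
    have t: "t \<ge> 0" by (simp add: t_def)
    have "norm (integral {0..t} (\<lambda>s. h (apply_bcontfun y) s - h (apply_bcontfun z) s))
        \<le> integral {0..t} (\<lambda>s. L * dist y z * exp (\<omega> * s))"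
    proof (rule integral_norm_bound_integral)
      show "(\<lambda>s. h (apply_bcontfun y) s - h (apply_bcontfun z) s) integrable_on {0..t}"
        by (intro integrable_diff h_int)
      show "(\<lambda>s. L * dist y z * exp (\<omega> * s)) integrable_on {0..t}"
        using has_integral_exp_scaled[OF \<omega> t] by (rule has_integral_integrable)
      fix s assume "s \<in> {0..t}"
      then have "norm (h (apply_bcontfun y) s - h (apply_bcontfun z) s)
          \<le> L * norm (exp (\<omega> * s) *\<^sub>R apply_bcontfun y s - exp (\<omega> * s) *\<^sub>R apply_bcontfun z s)"
        unfolding h_def by (intro lip) auto
      also have "norm (exp (\<omega> * s) *\<^sub>R apply_bcontfun y s - exp (\<omega> * s) *\<^sub>R apply_bcontfun z s)
          = exp (\<omega> * s) * dist (apply_bcontfun y s) (apply_bcontfun z s)"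
        by (simp add: dist_norm flip: scaleR_diff_right)
      also have "\<dots> \<le> exp (\<omega> * s) * dist y z"
        by (intro mult_left_mono dist_bounded) auto
      finally show "norm (h (apply_bcontfun y) s - h (apply_bcontfun z) s) \<le> L * dist y z * exp (\<omega> * s)"
        using L by (simp add: mult.commute mult.left_commute)
    qed
    also have "\<dots> = L * dist y z * (exp (\<omega> * t) - 1) / \<omega>"
      using has_integral_exp_scaled[OF \<omega> t] by (rule integral_unique)
    also have "\<dots> = 1 / 2 * dist y z * (exp (\<omega> * t) - 1)"
      using L by (simp add: \<omega>_def)
    finally have *: "norm (integral {0..t} (h (apply_bcontfun y)) - integral {0..t} (h (apply_bcontfun z)))
        \<le> 1 / 2 * dist y z * (exp (\<omega> * t) - 1)"
      by (subst (asm) integral_diff[OF h_int h_int])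
    have "dist (U (apply_bcontfun y) t) (U (apply_bcontfun z) t)
        = exp (- \<omega> * t) * norm (integral {0..t} (h (apply_bcontfun y)) - integral {0..t} (h (apply_bcontfun z)))"
      by (simp add: U_def dist_norm flip: scaleR_diff_right)
    also have "\<dots> \<le> exp (- \<omega> * t) * (1 / 2 * dist y z * (exp (\<omega> * t) - 1))"
      using * by (intro mult_left_mono) auto
    also have "\<dots> = 1 / 2 * dist y z * (1 - exp (- \<omega> * t))"
      by (simp add: algebra_simps exp_add[symmetric])
    also have "\<dots> \<le> 1 / 2 * dist y z * 1" by (intro mult_left_mono) auto
    finally show "dist (apply_bcontfun (S y) t0) (apply_bcontfun (S z) t0) \<le> 1 / 2 * dist y z"
      by (simp add: S t_def)
  qed
  obtain y where y: "S y = y"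
    using banach_fix_type[of "1/2" S] contr by auto
  define x where "x t = x0 + integral {0..t} (h (apply_bcontfun y))" for t
  have y_eq: "exp (\<omega> * t) *\<^sub>R apply_bcontfun y t = x t" if "t \<ge> 0" for t
  proof -
    have "apply_bcontfun y t = U (apply_bcontfun y) t"
      using fun_cong[OF S[of y], of t] that unfolding y by (simp add: max_absorb2)
    then show ?thesis by (simp add: U_def x_def exp_add[symmetric])
  qed
  have "(x has_vector_derivative \<Phi> t (x t)) (at t within {0..})" if t: "t \<ge> 0" for t
  proof -
    have "(x has_vector_derivative 0 + h (apply_bcontfun y) t) (at t within {0..})"
      unfolding x_def using int_der[OF t] by (intro has_vector_derivative_add has_vector_derivative_const)
    then show ?thesis using y_eq[OF t] by (simp add: h_def)
  qed
  then show ?thesis by (intro exI[of _ x]) (simp add: x_def)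
qed

context slow_fast_system
begin

text \<open>Composing the vector field with the nearest-point projection onto the ball keeps it Lipschitz and makes it
  bounded.\<close>
lemma solution_in_ball_exists:
  assumes \<epsilon>: "0 < \<epsilon>" "\<epsilon> \<le> e"
  shows "\<exists>u v. u 0 = u0 \<and> v 0 = v0 \<and> solution_in_ball \<epsilon> u v"
proof -
  have \<epsilon>e: "\<epsilon> \<in> {0..e}" using \<epsilon> by simp
  have R: "R \<ge> 0" using bar_bound[of 0] norm_ge_zero[of "bar 0"] by linarith
  have L0: "0 < L" using L by simp
  define cut where "cut = closest_point (cball (0 :: (real^'n) \<times> (real^'m)) R)"
  have cut_ball: "norm (cut X) \<le> R" for X
    using closest_point_in_set[of "cball (0 :: (real^'n) \<times> (real^'m)) R" X] R by (simp add: cut_def)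
  have cut_self: "cut X = X" if "norm X \<le> R" for X
    using that by (simp add: cut_def closest_point_self)
  have cut_lip: "norm (cut X - cut Z) \<le> norm (X - Z)" for X Z
    using closest_point_lipschitz[of "cball (0 :: (real^'n) \<times> (real^'m)) R" X Z] R
    by (simp add: cut_def dist_norm)
  define \<Phi> where "\<Phi> t X = (F (cut X) t \<epsilon>, (1 / \<epsilon>) *\<^sub>R G (cut X) t \<epsilon>)" for t X
  define \<Lambda> where "\<Lambda> = L + L / \<epsilon>"
  have \<Lambda>: "\<Lambda> > 0" using L0 \<epsilon> by (simp add: \<Lambda>_def add_pos_pos)
  have split: "norm ((a, (1 / \<epsilon>) *\<^sub>R b) :: (real^'n) \<times> (real^'m)) \<le> \<Lambda> * c"
    if "norm a \<le> L * c" "norm b \<le> L * c" for a b c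
  proof -
    have "norm ((1 / \<epsilon>) *\<^sub>R b) \<le> (1 / \<epsilon>) * (L * c)"
      using that(2) \<epsilon> by (simp add: divide_right_mono)
    then show ?thesis
      using norm_Pair_le[of a "(1 / \<epsilon>) *\<^sub>R b"] that(1) by (simp add: \<Lambda>_def algebra_simps)
  qed
  have diff: "\<Phi> t X - \<Phi> s Z = (F (cut X) t \<epsilon> - F (cut Z) s \<epsilon>, (1 / \<epsilon>) *\<^sub>R (G (cut X) t \<epsilon> - G (cut Z) s \<epsilon>))" for t s X Z
    by (simp add: \<Phi>_def scaleR_diff_right)
  have lip: "norm (\<Phi> t X - \<Phi> s Z) \<le> \<Lambda> * (norm (X - Z) + \<bar>t - s\<bar>)" if "t \<ge> 0" "s \<ge> 0" for t s X Z
  proof -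
    have "norm (\<Phi> t X - \<Phi> s Z) \<le> \<Lambda> * (norm (cut X - cut Z) + \<bar>t - s\<bar>)"
      unfolding diff
      using regular_on_ballD(6)[OF regF cut_ball that(1) \<epsilon>e cut_ball that(2) \<epsilon>e]
        regular_on_ballD(6)[OF regG cut_ball that(1) \<epsilon>e cut_ball that(2) \<epsilon>e]
      by (intro split) simp_all
    also have "\<dots> \<le> \<Lambda> * (norm (X - Z) + \<bar>t - s\<bar>)"
      using cut_lip[of X Z] \<Lambda> by (intro mult_left_mono) auto
    finally show ?thesis .
  qed
  have "\<exists>X. X 0 = (u0, v0) \<and> (\<forall>t\<ge>0. (X has_vector_derivative \<Phi> t (X t)) (at t within {0..}))"
  proof (rule Picard_Lindelof_global)
    have "(2 * \<Lambda>)-lipschitz_on ({0..} \<times> UNIV) (\<lambda>(t, X). \<Phi> t X)"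
    proof (rule lipschitz_onI)
      fix p q :: "real \<times> (real^'n) \<times> (real^'m)" assume p: "p \<in> {0..} \<times> UNIV" and q: "q \<in> {0..} \<times> UNIV"
      have "dist (\<Phi> (fst p) (snd p)) (\<Phi> (fst q) (snd q)) \<le> \<Lambda> * (dist (snd p) (snd q) + dist (fst p) (fst q))"
        using lip[of "fst p" "fst q" "snd p" "snd q"] p q by (auto simp: dist_norm)
      also have "\<dots> \<le> \<Lambda> * (dist p q + dist p q)"
        using \<Lambda> by (intro mult_left_mono add_mono dist_fst_le dist_snd_le) auto
      finally show "dist (case p of (t, X) \<Rightarrow> \<Phi> t X) (case q of (t, X) \<Rightarrow> \<Phi> t X) \<le> 2 * \<Lambda> * dist p q"
        by (simp add: case_prod_beta)
    qed (use \<Lambda> in simp)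
    then show "continuous_on ({0..} \<times> UNIV) (\<lambda>(t, X). \<Phi> t X)" by (rule lipschitz_on_continuous_on)
    show "norm (\<Phi> t X) \<le> \<Lambda> * 1" if "t \<ge> 0" for t X
      unfolding \<Phi>_def
      using regular_on_ballD(1)[OF regF cut_ball that \<epsilon>e] regular_on_ballD(1)[OF regG cut_ball that \<epsilon>e]
      by (intro split) simp_all
    show "norm (\<Phi> t X - \<Phi> t Z) \<le> \<Lambda> * norm (X - Z)" if "t \<ge> 0" for t X Z
      using lip[OF that that, of X Z] by simp
  qed (rule \<Lambda>)
  then obtain X where X: "X 0 = (u0, v0)"
    "\<And>t. t \<ge> 0 \<Longrightarrow> (X has_vector_derivative \<Phi> t (X t)) (at t within {0..})" by blast
  have "solution_in_ball \<epsilon> (\<lambda>t. fst (X t)) (\<lambda>t. snd (X t))"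
    unfolding solution_in_ball_def
  proof (intro exI[of _ "\<lambda>t. fst (\<Phi> t (X t))"] exI[of _ "\<lambda>t. snd (\<Phi> t (X t))"] allI impI conjI)
    fix t :: real assume t: "0 \<le> t"
    show "((\<lambda>t. fst (X t)) has_vector_derivative fst (\<Phi> t (X t))) (at t within {0..})"
      by (rule bounded_linear.has_vector_derivative[OF bounded_linear_fst X(2)[OF t]])
    show "((\<lambda>t. snd (X t)) has_vector_derivative snd (\<Phi> t (X t))) (at t within {0..})"
      by (rule bounded_linear.has_vector_derivative[OF bounded_linear_snd X(2)[OF t]])
    assume "norm (fst (X t), snd (X t)) \<le> R"
    then show "fst (\<Phi> t (X t)) = F (fst (X t), snd (X t)) t \<epsilon>"
      "snd (\<Phi> t (X t)) = (1 / \<epsilon>) *\<^sub>R G (fst (X t), snd (X t)) t \<epsilon>"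
      by (simp_all add: \<Phi>_def cut_self)
  qed
  then show ?thesis using X(1) by (intro exI[of _ "\<lambda>t. fst (X t)"] exI[of _ "\<lambda>t. snd (X t)"]) simp
qed

section \<open>The initial layer and the conclusion\<close>

text \<open>Gronwall's inequality for the distance \<open>w\<close> of \<open>(u, v)\<close> from \<open>(u0, vhat (t / \<epsilon>))\<close>, in the form of a barrier
  \<open>B\<close> with exponential rate \<open>(L + 1) / \<epsilon>\<close>. Since \<open>B \<le> 1\<close> on the layer, a point of contact is in the ball.\<close>
lemma initial_layer:
  assumes vhat: "\<And>\<tau>. \<tau> \<ge> 0 \<Longrightarrow> (vhat has_vector_derivative G (u0, vhat \<tau>) 0 0) (at \<tau> within {0..})"
    and ball: "\<And>\<tau>. \<tau> \<ge> 0 \<Longrightarrow> norm (u0, vhat \<tau>) + 1 \<le> R"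
    and T: "T \<ge> 0" and \<eta>: "\<eta> > 0"
  shows "\<exists>\<epsilon>2>0. \<epsilon>2 \<le> e \<and> (\<forall>\<epsilon> u v t. 0 < \<epsilon> \<and> \<epsilon> \<le> \<epsilon>2 \<and> solution_in_ball \<epsilon> u v \<and>
     u 0 = u0 \<and> v 0 = vhat 0 \<and> 0 \<le> t \<and> t \<le> \<epsilon> * T \<longrightarrow>
     norm (u t - u0) \<le> \<eta> \<and> norm (v t - vhat (t / \<epsilon>)) \<le> \<eta>)"
proof -
  have L0: "0 < L" using L by simp
  define \<mu> where "\<mu> = min \<eta> 1"
  define m where "m = \<mu> / exp ((L + 1) * T)"
  define \<epsilon>2 where "\<epsilon>2 = min e (m / (2 * (L * (2 + T))))"
  have m: "m > 0" using \<eta> by (simp add: m_def \<mu>_def)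
  have LT: "L * (2 + T) > 0" using L0 T by simp
  have \<epsilon>2: "\<epsilon>2 > 0" "\<epsilon>2 \<le> e" using e m LT by (auto simp: \<epsilon>2_def)
  have main: "norm (u t - u0) \<le> \<eta> \<and> norm (v t - vhat (t / \<epsilon>)) \<le> \<eta>"
    if \<epsilon>: "0 < \<epsilon>" "\<epsilon> \<le> \<epsilon>2" and sol: "solution_in_ball \<epsilon> u v" and ic: "u 0 = u0" "v 0 = vhat 0"
    and t: "0 \<le> t" "t \<le> \<epsilon> * T" for \<epsilon> u v t
  proof -
    have \<epsilon>e: "\<epsilon> \<in> {0..e}" using \<epsilon> \<epsilon>2 by auto
    obtain u' v' where u: "\<And>t. t \<ge> 0 \<Longrightarrow> (u has_vector_derivative u' t) (at t within {0..})"
      and v: "\<And>t. t \<ge> 0 \<Longrightarrow> (v has_vector_derivative v' t) (at t within {0..})"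
      and ode: "\<And>t. t \<ge> 0 \<Longrightarrow> norm (u t, v t) \<le> R \<Longrightarrow>
         u' t = F (u t, v t) t \<epsilon> \<and> v' t = (1 / \<epsilon>) *\<^sub>R G (u t, v t) t \<epsilon>"
      using sol unfolding solution_in_ball_def by blast
    define w where "w t = (u t - u0, v t - vhat (t / \<epsilon>))" for t
    define w' where "w' t = (u' t, v' t - (1 / \<epsilon>) *\<^sub>R G (u0, vhat (t / \<epsilon>)) 0 0)" for t
    define B where "B t = m * exp ((L + 1) * (t / \<epsilon>))" for t
    have B_le: "B t \<le> \<mu>" if "t \<le> \<epsilon> * T" for t
    proof -
      have "t / \<epsilon> \<le> T" using that \<epsilon>(1) by (simp add: field_simps)
      then have "(L + 1) * (t / \<epsilon>) \<le> (L + 1) * T" using L0 by (intro mult_left_mono) auto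
      then have "B t \<le> m * exp ((L + 1) * T)" using m by (simp add: B_def)
      also have "\<dots> = \<mu>" by (simp add: m_def)
      finally show ?thesis .
    qed
    have "norm (w t) \<le> B t"
    proof (rule barrier_along_curve[where w = w and B = B and N = norm and C = 1 and a = 0 and b = "\<epsilon> * T"
          and w' = w' and B' = "\<lambda>t. (L + 1) / \<epsilon> * B t"])
      show "norm (x + y) \<le> norm x + norm y" for x y :: "(real^'n) \<times> (real^'m)" by (rule norm_triangle_ineq)
      show "norm x \<le> 1 * norm x" for x :: "(real^'n) \<times> (real^'m)" by simp
      show "norm (w 0) \<le> B 0" using ic m by (simp add: w_def B_def)
      have sub: "{0..\<epsilon> * T} \<subseteq> {0..}" by auto
      show "(w has_vector_derivative w' s) (at s within {0..\<epsilon> * T})" if s: "s \<in> {0..\<epsilon> * T}" for s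
      proof -
        have "((\<lambda>t. t / \<epsilon>) has_vector_derivative (1 / \<epsilon>)) (at s within {0..})"
          unfolding has_real_derivative_iff_has_vector_derivative[symmetric]
          using \<epsilon>(1) by (auto intro!: derivative_eq_intros)
        moreover have "(vhat has_vector_derivative G (u0, vhat (s / \<epsilon>)) 0 0) (at (s / \<epsilon>) within (\<lambda>t. t / \<epsilon>) ` {0..})"
          by (rule has_vector_derivative_within_subset[OF vhat]) (use s \<epsilon> in auto)
        ultimately have "((vhat \<circ> (\<lambda>t. t / \<epsilon>)) has_vector_derivative (1 / \<epsilon>) *\<^sub>R G (u0, vhat (s / \<epsilon>)) 0 0) (at s within {0..})"
          by (rule vector_diff_chain_within)
        then have "((\<lambda>t. vhat (t / \<epsilon>)) has_vector_derivative (1 / \<epsilon>) *\<^sub>R G (u0, vhat (s / \<epsilon>)) 0 0) (at s within {0..})"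
          by (simp add: comp_def)
        then have "(w has_vector_derivative (u' s - 0, v' s - (1 / \<epsilon>) *\<^sub>R G (u0, vhat (s / \<epsilon>)) 0 0)) (at s within {0..})"
          unfolding w_def using u v s
          by (intro has_vector_derivative_Pair has_vector_derivative_diff has_vector_derivative_const) auto
        then show ?thesis
          unfolding w'_def using sub by (auto intro: has_vector_derivative_within_subset)
      qed
      show "(B has_vector_derivative (L + 1) / \<epsilon> * B s) (at s within {0..\<epsilon> * T})" for s
        unfolding B_def has_real_derivative_iff_has_vector_derivative[symmetric]
        using \<epsilon>(1) by (auto intro!: derivative_eq_intros simp: field_simps)
      fix s assume s: "0 \<le> s" "s < \<epsilon> * T" "norm (w s) = B s"
      have small: "norm (w s) \<le> 1" using B_le[of s] s by (simp add: \<mu>_def)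
      have tau: "0 \<le> s / \<epsilon>" using s \<epsilon> by simp
      define X Z where "X = (u s, v s)" and "Z = (u0, vhat (s / \<epsilon>))"
      have XZ: "X - Z = w s" by (simp add: X_def Z_def w_def)
      have ZR: "norm Z \<le> R" using ball[OF tau] by (simp add: Z_def)
      have XR: "norm X \<le> R"
        using norm_triangle_sub[of X Z] ball[OF tau] small unfolding XZ by (simp add: Z_def)
      have w's: "w' s = (F X s \<epsilon>, (1 / \<epsilon>) *\<^sub>R (G X s \<epsilon> - G Z 0 0))"
        using ode[OF s(1)] XR by (simp add: w'_def X_def Z_def scaleR_diff_right)
      have "norm (F X s \<epsilon>) \<le> L" by (rule regular_on_ballD(1)[OF regF XR s(1) \<epsilon>e])
      moreover have "norm (G X s \<epsilon> - G Z 0 0) \<le> L * (norm (w s) + s + \<epsilon>)"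
        using regular_on_ballD(6)[OF regG XR s(1) \<epsilon>e ZR order.refl zero_param] \<epsilon> s by (simp add: XZ)
      moreover have "L * (norm (w s) + s + \<epsilon>) \<le> L * (B s + \<epsilon> * T + \<epsilon>)"
        using s L0 by (intro mult_left_mono) auto
      ultimately have "norm (w' s) \<le> L + (1 / \<epsilon>) * (L * (B s + \<epsilon> * T + \<epsilon>))"
        unfolding w's using norm_Pair_le[of "F X s \<epsilon>" "(1 / \<epsilon>) *\<^sub>R (G X s \<epsilon> - G Z 0 0)"] \<epsilon>(1)
          divide_right_mono[of "norm (G X s \<epsilon> - G Z 0 0)" "L * (B s + \<epsilon> * T + \<epsilon>)" \<epsilon>] by simp
      also have "\<dots> = (L * B s + \<epsilon> * (L * (2 + T))) / \<epsilon>"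
        using \<epsilon>(1) by (simp add: field_simps)
      also have "\<dots> < (L * B s + B s) / \<epsilon>"
      proof (intro divide_strict_right_mono add_strict_left_mono)
        have "\<epsilon> \<le> m / (2 * (L * (2 + T)))" using \<epsilon> by (simp add: \<epsilon>2_def)
        then have "\<epsilon> * (L * (2 + T)) \<le> m / (2 * (L * (2 + T))) * (L * (2 + T))"
          using LT by (intro mult_right_mono) auto
        also have "\<dots> = m / 2" using LT by (simp add: field_simps)
        also have "\<dots> < m" using m by simp
        also have "m * 1 \<le> B s"
          unfolding B_def using m s \<epsilon> L0 by (intro mult_left_mono) auto
        finally show "\<epsilon> * (L * (2 + T)) < B s" by simp
      qed (use \<epsilon> in simp)
      also have "\<dots> = (L + 1) / \<epsilon> * B s" by (simp add: algebra_simps add_divide_distrib)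
      finally have "norm (w' s) < (L + 1) / \<epsilon> * B s" .
      moreover have "norm (w s + h *\<^sub>R w' s) \<le> norm (w s) + h * norm (w' s)" if "0 < h" for h
        using norm_triangle_ineq[of "w s" "h *\<^sub>R w' s"] that by simp
      ultimately show "\<exists>k<(L + 1) / \<epsilon> * B s. \<exists>h0>0. \<forall>h. 0 < h \<and> h \<le> h0 \<longrightarrow>
          norm (w s + h *\<^sub>R w' s) \<le> norm (w s) + h * k"
        using zero_less_one by blast
    qed (use t in auto)
    also have "\<dots> \<le> \<eta>" using B_le[OF t(2)] by (simp add: \<mu>_def)
    finally have "norm (w t) \<le> \<eta>" .
    then show ?thesis
      using norm_fst_le[of "u t - u0" "v t - vhat (t / \<epsilon>)"] norm_snd_le[of "v t - vhat (t / \<epsilon>)" "u t - u0"]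
      by (simp add: w_def)
  qed
  then show ?thesis using \<epsilon>2 by blast
qed

text \<open>The layer ends at \<open>a = \<epsilon> T\<close>. There the deviation is a small multiple of \<open>\<eta>\<close>, from which the stability of
  the slow manifold takes over.\<close>
lemma uniform_tracking:
  assumes vhat: "\<And>\<tau>. \<tau> \<ge> 0 \<Longrightarrow> (vhat has_vector_derivative G (ubar 0, vhat \<tau>) 0 0) (at \<tau> within {0..})"
    and ball: "\<And>\<tau>. \<tau> \<ge> 0 \<Longrightarrow> norm (ubar 0, vhat \<tau>) + 1 \<le> R"
    and lim: "(vhat \<longlongrightarrow> vbar 0) at_top"
    and \<rho>: "\<rho> > 0"
  shows "\<exists>\<epsilon>0>0. \<epsilon>0 \<le> e \<and> (\<forall>\<epsilon> u v t. 0 < \<epsilon> \<and> \<epsilon> \<le> \<epsilon>0 \<and> solution_in_ball \<epsilon> u v \<and>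
     u 0 = ubar 0 \<and> v 0 = vhat 0 \<and> 0 \<le> t \<longrightarrow>
     norm (v t - vbar t - (vhat (t / \<epsilon>) - vbar 0)) \<le> \<rho> \<and> norm (u t - ubar t) \<le> \<rho> \<and> norm (u t, v t) \<le> R)"
proof -
  obtain C r \<epsilon>1 where C: "C \<ge> 1" and r: "r > 0" "r \<le> 1" and \<epsilon>1: "\<epsilon>1 > 0" "\<epsilon>1 \<le> e" and
    stab: "\<And>\<epsilon> a t u v. 0 < \<epsilon> \<Longrightarrow> \<epsilon> \<le> \<epsilon>1 \<Longrightarrow> 0 \<le> a \<Longrightarrow> a \<le> t \<Longrightarrow> solution_in_ball \<epsilon> u v \<Longrightarrow>
      C * (deviation u v a + \<epsilon>) < r \<Longrightarrow> deviation u v t \<le> C * (deviation u v a + \<epsilon>)"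
    using slow_manifold_stability by blast
  obtain B where B: "B \<ge> 1" "\<And>s t. s \<ge> 0 \<Longrightarrow> t \<ge> 0 \<Longrightarrow> norm (bar s - bar t) \<le> B * \<bar>s - t\<bar>"
    using bar_lipschitz by blast
  define \<mu> where "\<mu> = min \<rho> r"
  \<comment> \<open>The deviation plus \<open>\<epsilon>\<close> at the end of the layer is at most \<open>6 \<eta>\<close>, and \<open>C (6 \<eta>) = \<mu> / 2\<close>.\<close>
  define \<eta> where "\<eta> = \<mu> / (12 * C)"
  have \<mu>: "\<mu> > 0" "\<mu> \<le> \<rho>" "\<mu> \<le> r" using \<rho> r by (auto simp: \<mu>_def)
  have C\<eta>: "C * \<eta> = \<mu> / 12" using C by (simp add: \<eta>_def)
  have \<eta>: "\<eta> > 0" using \<mu> C by (simp add: \<eta>_def)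
  have "1 * \<eta> \<le> C * \<eta>" using C \<eta> by (intro mult_right_mono) auto
  then have \<eta>_le: "12 * \<eta> \<le> \<mu>" using C\<eta> by simp
  obtain T0 where T0: "\<And>\<tau>. \<tau> \<ge> T0 \<Longrightarrow> dist (vhat \<tau>) (vbar 0) < \<eta>"
    using tendstoD[OF lim \<eta>] unfolding eventually_at_top_linorder by blast
  define T where "T = max 0 T0"
  have T: "T \<ge> 0" "\<And>\<tau>. \<tau> \<ge> T \<Longrightarrow> norm (vhat \<tau> - vbar 0) \<le> \<eta>"
    using T0 by (auto simp: T_def dist_norm less_imp_le)
  obtain \<epsilon>2 where \<epsilon>2: "\<epsilon>2 > 0" "\<epsilon>2 \<le> e" and layer: "\<And>\<epsilon> u v t. 0 < \<epsilon> \<Longrightarrow> \<epsilon> \<le> \<epsilon>2 \<Longrightarrow>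
     solution_in_ball \<epsilon> u v \<Longrightarrow> u 0 = ubar 0 \<Longrightarrow> v 0 = vhat 0 \<Longrightarrow> 0 \<le> t \<Longrightarrow> t \<le> \<epsilon> * T \<Longrightarrow>
     norm (u t - ubar 0) \<le> \<eta> \<and> norm (v t - vhat (t / \<epsilon>)) \<le> \<eta>"
    using initial_layer[OF vhat ball T(1) \<eta>] by blast
  define \<epsilon>0 where "\<epsilon>0 = min (min \<epsilon>1 \<epsilon>2) (\<eta> / (B * (T + 1)))"
  have BT: "B * (T + 1) > 0" using B T by simp
  have \<epsilon>0: "\<epsilon>0 > 0" "\<epsilon>0 \<le> \<epsilon>1" "\<epsilon>0 \<le> \<epsilon>2" using \<epsilon>1 \<epsilon>2 \<eta> BT by (auto simp: \<epsilon>0_def)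
  have main: "norm (v t - vbar t - (vhat (t / \<epsilon>) - vbar 0)) \<le> \<rho> \<and> norm (u t - ubar t) \<le> \<rho> \<and> norm (u t, v t) \<le> R"
    if \<epsilon>: "0 < \<epsilon>" "\<epsilon> \<le> \<epsilon>0" and sol: "solution_in_ball \<epsilon> u v" and ic: "u 0 = ubar 0" "v 0 = vhat 0"
    and t: "0 \<le> t" for \<epsilon> u v t
  proof -
    have "\<epsilon> \<le> \<eta> / (B * (T + 1))" using \<epsilon> by (simp add: \<epsilon>0_def)
    then have "\<epsilon> * (B * (T + 1)) \<le> \<eta>" using BT by (simp add: field_simps)
    moreover have "\<epsilon> * (B * (T + 1)) = B * (\<epsilon> * T) + B * \<epsilon>" by (simp add: algebra_simps)
    moreover have "1 * \<epsilon> \<le> B * \<epsilon>" using B \<epsilon> by (intro mult_right_mono) auto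
    moreover have "0 \<le> B * (\<epsilon> * T)" using B \<epsilon> T by simp
    ultimately have B\<epsilon>: "B * (\<epsilon> * T) \<le> \<eta>" "\<epsilon> \<le> \<eta>" using \<epsilon>(1) by linarith+
    define a where "a = \<epsilon> * T"
    have a: "0 \<le> a" using \<epsilon> T by (simp add: a_def)
    have drift: "norm (ubar 0 - ubar s) \<le> \<eta>" "norm (vbar s - vbar 0) \<le> \<eta>" if "0 \<le> s" "s \<le> a" for s
    proof -
      have "norm (bar 0 - bar s) \<le> B * s" using B(2)[of 0 s] that by simp
      also have "\<dots> \<le> B * a" using that B by (intro mult_left_mono) auto
      also have "\<dots> \<le> \<eta>" using B\<epsilon> by (simp add: a_def)
      finally have "norm (ubar 0 - ubar s, vbar 0 - vbar s) \<le> \<eta>" by simp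
      then show "norm (ubar 0 - ubar s) \<le> \<eta>" "norm (vbar s - vbar 0) \<le> \<eta>"
        using norm_fst_le[of "ubar 0 - ubar s" "vbar 0 - vbar s"] norm_snd_le[of "vbar 0 - vbar s" "ubar 0 - ubar s"]
        by (auto simp: norm_minus_commute)
    qed
    have layer': "norm (u s - ubar 0) \<le> \<eta>" "norm (v s - vhat (s / \<epsilon>)) \<le> \<eta>" if "0 \<le> s" "s \<le> a" for s
      using layer[OF \<epsilon>(1) _ sol ic that(1)] that(2) \<epsilon>(2) \<epsilon>0(3) by (auto simp: a_def)
    show ?thesis
    proof (cases "t \<le> a")
      case True
      have "norm (u t - ubar t) \<le> norm (u t - ubar 0) + norm (ubar 0 - ubar t)"
        using norm_triangle_ineq[of "u t - ubar 0" "ubar 0 - ubar t"] by simp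
      then have 1: "norm (u t - ubar t) \<le> \<rho>" using layer'(1)[OF t True] drift(1)[OF t True] \<eta>_le \<mu> \<eta> by linarith
      have "v t - vbar t - (vhat (t / \<epsilon>) - vbar 0) = (v t - vhat (t / \<epsilon>)) - (vbar t - vbar 0)" by simp
      then have "norm (v t - vbar t - (vhat (t / \<epsilon>) - vbar 0)) \<le> norm (v t - vhat (t / \<epsilon>)) + norm (vbar t - vbar 0)"
        by (simp only: norm_triangle_ineq4)
      then have 2: "norm (v t - vbar t - (vhat (t / \<epsilon>) - vbar 0)) \<le> \<rho>"
        using layer'(2)[OF t True] drift(2)[OF t True] \<eta>_le \<mu> \<eta> by linarith
      have tau: "0 \<le> t / \<epsilon>" using t \<epsilon> by simp
      have "norm ((u t, v t) - (ubar 0, vhat (t / \<epsilon>))) \<le> norm (u t - ubar 0) + norm (v t - vhat (t / \<epsilon>))"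
        using norm_Pair_le[of "u t - ubar 0" "v t - vhat (t / \<epsilon>)"] by simp
      also have "\<dots> \<le> 1" using layer'[OF t True] \<eta>_le \<mu> r \<eta> by linarith
      finally have "norm (u t, v t) \<le> R"
        using norm_triangle_sub[of "(u t, v t)" "(ubar 0, vhat (t / \<epsilon>))"] ball[OF tau] by linarith
      with 1 2 show ?thesis by blast
    next
      case False
      then have at: "a \<le> t" by simp
      have tail: "norm (vhat (t / \<epsilon>) - vbar 0) \<le> \<eta>"
        using at \<epsilon>(1) by (intro T(2)) (simp add: a_def field_simps)
      have aT: "a / \<epsilon> = T" using \<epsilon>(1) by (simp add: a_def)
      have "norm (u a - ubar a) \<le> norm (u a - ubar 0) + norm (ubar 0 - ubar a)"
        using norm_triangle_ineq[of "u a - ubar 0" "ubar 0 - ubar a"] by simp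
      also have "\<dots> \<le> 2 * \<eta>" using layer'(1)[of a] drift(1)[of a] a by simp
      finally have ua: "norm (u a - ubar a) \<le> 2 * \<eta>" .
      have "v a - vbar a = (v a - vhat (a / \<epsilon>)) + ((vhat T - vbar 0) - (vbar a - vbar 0))"
        by (simp add: aT)
      then have "norm (v a - vbar a) \<le> norm (v a - vhat (a / \<epsilon>)) + norm ((vhat T - vbar 0) - (vbar a - vbar 0))"
        by (simp only: norm_triangle_ineq)
      also have "\<dots> \<le> norm (v a - vhat (a / \<epsilon>)) + (norm (vhat T - vbar 0) + norm (vbar a - vbar 0))"
        by (intro add_left_mono norm_triangle_ineq4)
      also have "\<dots> \<le> 3 * \<eta>" using layer'(2)[of a] drift(2)[of a] a T(2)[of T] by simp
      finally have "deviation u v a + \<epsilon> \<le> 6 * \<eta>" using ua B\<epsilon> by (simp add: deviation_def)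
      then have "C * (deviation u v a + \<epsilon>) \<le> C * (6 * \<eta>)" using C by (intro mult_left_mono) auto
      also have "\<dots> = \<mu> / 2" using C\<eta> by simp
      finally have dev: "C * (deviation u v a + \<epsilon>) \<le> \<mu> / 2" .
      then have "C * (deviation u v a + \<epsilon>) < r" using \<mu> by linarith
      then have "deviation u v t \<le> C * (deviation u v a + \<epsilon>)"
        using stab[OF \<epsilon>(1) _ a at sol] \<epsilon>(2) \<epsilon>0(2) by simp
      with dev have dt: "norm (u t - ubar t) + norm (v t - vbar t) \<le> \<mu> / 2" by (simp add: deviation_def)
      then have 1: "norm (u t - ubar t) \<le> \<rho>" using \<mu> norm_ge_zero[of "v t - vbar t"] by linarith
      have "norm (v t - vbar t - (vhat (t / \<epsilon>) - vbar 0)) \<le> norm (v t - vbar t) + norm (vhat (t / \<epsilon>) - vbar 0)"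
        by (rule norm_triangle_ineq4)
      then have 2: "norm (v t - vbar t - (vhat (t / \<epsilon>) - vbar 0)) \<le> \<rho>"
        using dt tail \<eta>_le \<mu> norm_ge_zero[of "u t - ubar t"] \<eta> by linarith
      have "norm (u t, v t) \<le> R" using near_bar_in_ball[OF t] dt \<mu> r by simp
      with 1 2 show ?thesis by blast
    qed
  qed
  have "\<epsilon>0 \<le> e" using \<epsilon>0 \<epsilon>1 by simp
  then show ?thesis using main \<epsilon>0(1) by blast
qed

end

lemma jacobian_apply:
  fixes h :: "real^'a \<Rightarrow> real^'b"
  assumes "(h has_derivative h') (at x)"
  shows "jacobian h (at x) *v y = h' y"
proof -
  have "frechet_derivative h (at x) = h'"
    using frechet_derivative_at[OF assms] by simp
  then show ?thesis
    unfolding jacobian_def using matrix_works[of h' y] has_derivative_linear[OF assms]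
    by (simp add: matrix_works)
qed

lemma has_derivative_partial_args:
  fixes D :: "('a::real_normed_vector \<times> 'b::real_normed_vector) \<Rightarrow>\<^sub>L 'c::real_normed_vector"
  assumes "(H has_derivative blinfun_apply D) (at (u, v))"
  shows "((\<lambda>u. H (u, v)) has_derivative (\<lambda>x. D (x, 0))) (at u)"
    and "((\<lambda>v. H (u, v)) has_derivative (\<lambda>y. D (0, y))) (at v)"
proof -
  have "((\<lambda>u. (u, v)) has_derivative (\<lambda>x. (x, 0))) (at u)"
    by (intro has_derivative_Pair has_derivative_ident has_derivative_const)
  then show "((\<lambda>u. H (u, v)) has_derivative (\<lambda>x. D (x, 0))) (at u)"
    using assms by (rule has_derivative_compose)
  have "((\<lambda>v. (u, v)) has_derivative (\<lambda>y. (0, y))) (at v)"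
    by (intro has_derivative_Pair has_derivative_ident has_derivative_const)
  then show "((\<lambda>v. H (u, v)) has_derivative (\<lambda>y. D (0, y))) (at v)"
    using assms by (rule has_derivative_compose)
qed

theorem theorem1:
  fixes f :: "real^'n \<Rightarrow> real^'m \<Rightarrow> real \<Rightarrow> real \<Rightarrow> real^'n"
    and g :: "real^'n \<Rightarrow> real^'m \<Rightarrow> real \<Rightarrow> real \<Rightarrow> real^'m"
    and e :: real
    and u0 :: "real^'n" and v0 :: "real^'m"
    and \<phi> :: "real^'n \<Rightarrow> real \<Rightarrow> real^'m"
    and ubar :: "real \<Rightarrow> real^'n"
    and vhat :: "real \<Rightarrow> real^'m"
  assumes A1: "e > 0"
      "C3_C1_bounded e (\<lambda>(u, v) t \<epsilon>. f u v t \<epsilon>)"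
      "C3_C1_bounded e (\<lambda>(u, v) t \<epsilon>. g u v t \<epsilon>)"
    and A2: "\<And>u t. t \<ge> 0 \<Longrightarrow> \<phi> u t isolated_in {v. g u v t 0 = 0}"
      "solves_ivp (\<lambda>t u. f u (\<phi> u t) t 0) u0 ubar"
      "bounded ((\<lambda>t. (ubar t, \<phi> (ubar t) t)) ` {0..})"
      "(\<lambda>t. (ubar t, \<phi> (ubar t) t)) differentiable_on {0..}"
    and A3: "(SUP t\<in>{0..}. ereal (spectral_bound
        (jacobian (\<lambda>v. g (ubar t) v t 0) (at (\<phi> (ubar t) t))))) < 0"
    and A4: "solves_ivp (\<lambda>\<tau> v. g u0 v 0 0) v0 vhat"
      "(vhat \<longlongrightarrow> \<phi> u0 0) at_top"
    and A5: "\<And>t. t \<ge> 0 \<Longrightarrow> (\<lambda>u. \<phi> u t) differentiable (at (ubar t))"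
      "exponential_dichotomy (\<lambda>t.
        jacobian (\<lambda>u. f u (\<phi> (ubar t) t) t 0) (at (ubar t)) +
        jacobian (\<lambda>v. f (ubar t) v t 0) (at (\<phi> (ubar t) t)) **
        jacobian (\<lambda>u. \<phi> u t) (at (ubar t)))"
  shows "\<exists>\<rho>0>0. \<forall>\<rho>. 0 < \<rho> \<and> \<rho> < \<rho>0 \<longrightarrow>
    (\<exists>\<epsilon>\<rho>>0. \<epsilon>\<rho> \<le> e \<and> (\<forall>\<epsilon>. 0 < \<epsilon> \<and> \<epsilon> \<le> \<epsilon>\<rho> \<longrightarrow>
      (\<exists>u v. solves_perturbed f g u0 v0 \<epsilon> u v) \<and>
      (\<forall>u v. solves_perturbed f g u0 v0 \<epsilon> u v \<longrightarrow>
        (\<forall>t\<ge>0. norm (v t - \<phi> (ubar t) t - (vhat (t / \<epsilon>) - \<phi> u0 0)) \<le> \<rho> \<and>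
               norm (u t - ubar t) \<le> \<rho>))))"
proof -
  define vbar where "vbar t = \<phi> (ubar t) t" for t
  define F where "F = (\<lambda>(u, v). f u v)"
  define G where "G = (\<lambda>(u, v). g u v)"
  have F_eq: "F (u, v) t \<epsilon> = f u v t \<epsilon>" and G_eq: "G (u, v) t \<epsilon> = g u v t \<epsilon>" for u v t \<epsilon>
    by (simp_all add: F_def G_def)
  have reg: "C3_C1_bounded e F" "C3_C1_bounded e G"
    using A1(2,3) by (simp_all add: F_def G_def case_prod_beta')
  obtain DF DtF where regF: "\<forall>R\<ge>0. \<exists>L\<ge>1. regular_on_ball e R L F DF DtF"
    using C3_C1_bounded_regular[OF reg(1)] by blast
  obtain DG DtG where regG: "\<forall>R\<ge>0. \<exists>L\<ge>1. regular_on_ball e R L G DG DtG"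
    using C3_C1_bounded_regular[OF reg(2)] by blast

  have ubar0: "ubar 0 = u0"
    and ubar: "\<And>t. t \<ge> 0 \<Longrightarrow> (ubar has_vector_derivative F (ubar t, vbar t) t 0) (at t within {0..})"
    using A2(2) by (auto simp: solves_ivp_def F_eq vbar_def)
  have vhat0: "vhat 0 = v0"
    and vhat: "\<And>\<tau>. \<tau> \<ge> 0 \<Longrightarrow> (vhat has_vector_derivative G (ubar 0, vhat \<tau>) 0 0) (at \<tau> within {0..})"
    using A4(1) by (auto simp: solves_ivp_def G_eq ubar0)
  have root: "G (u, \<phi> u t) t 0 = 0" if "t \<ge> 0" for u t
    using A2(1)[OF that, of u] by (auto simp: isolated_in_def G_eq)
  have vhat_lim: "(vhat \<longlongrightarrow> vbar 0) at_top"
    using A4(2) by (simp add: vbar_def ubar0)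

  obtain b1 where b1: "\<And>t. t \<ge> 0 \<Longrightarrow> norm (ubar t, vbar t) \<le> b1"
    using A2(3) unfolding bounded_iff vbar_def by auto
  have "\<exists>b2. \<forall>\<tau>\<ge>0. norm (vhat \<tau>) \<le> b2"
  proof -
    obtain T0 where T0: "\<And>\<tau>. \<tau> \<ge> T0 \<Longrightarrow> dist (vhat \<tau>) (vbar 0) < 1"
      using tendstoD[OF vhat_lim zero_less_one] unfolding eventually_at_top_linorder by blast
    have "continuous_on {0..} vhat"
      by (rule continuous_on_vector_derivative) (use vhat in auto)
    then have "continuous_on {0..T0} vhat" by (rule continuous_on_subset) auto
    then have "bounded (vhat ` {0..T0})"
      by (intro compact_imp_bounded compact_continuous_image) auto
    then obtain b where b: "\<forall>\<tau>\<in>{0..T0}. norm (vhat \<tau>) \<le> b"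
      unfolding bounded_iff by auto
    have "norm (vhat \<tau>) \<le> max b (norm (vbar 0) + 1)" if "\<tau> \<ge> 0" for \<tau>
    proof (cases "\<tau> \<le> T0")
      case True
      then show ?thesis using b that by (simp add: le_max_iff_disj)
    next
      case False
      then have "norm (vhat \<tau> - vbar 0) < 1" using T0[of \<tau>] by (simp add: dist_norm)
      then show ?thesis using norm_triangle_sub[of "vhat \<tau>" "vbar 0"] by (simp add: le_max_iff_disj)
    qed
    then show ?thesis by blast
  qed
  then obtain b2 where b2: "\<And>\<tau>. \<tau> \<ge> 0 \<Longrightarrow> norm (vhat \<tau>) \<le> b2" by blast
  \<comment> \<open>The ball contains a unit neighbourhood of both the reduced trajectory and the layer solution.\<close>
  define R where "R = b1 + norm u0 + b2 + 1"
  have b_nonneg: "0 \<le> b1" "0 \<le> b2"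
    using order.trans[OF norm_ge_zero b1[of 0]] order.trans[OF norm_ge_zero b2[of 0]] by simp_all
  have R0: "R \<ge> 0" using b_nonneg by (simp add: R_def)
  have bar_bound: "norm (ubar t, vbar t) + 1 \<le> R" if "t \<ge> 0" for t
    using b1[OF that] b_nonneg norm_ge_zero[of u0] unfolding R_def by linarith
  have hat_bound: "norm (ubar 0, vhat \<tau>) + 1 \<le> R" if "\<tau> \<ge> 0" for \<tau>
    using b2[OF that] norm_Pair_le[of "ubar 0" "vhat \<tau>"] b_nonneg unfolding R_def ubar0 by linarith
  obtain LF LG where LF: "LF \<ge> 1" "regular_on_ball e R LF F DF DtF"
    and LG: "LG \<ge> 1" "regular_on_ball e R LG G DG DtG"
    using regF regG R0 by blast
  define L where "L = max LF LG"
  have L: "L \<ge> 1" "regular_on_ball e R L F DF DtF" "regular_on_ball e R L G DG DtG"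
    using LF LG regular_on_ball_mono[OF LF(2), of L] regular_on_ball_mono[OF LG(2), of L] by (auto simp: L_def)

  have "\<exists>vbar'. \<forall>t\<ge>0. (vbar has_vector_derivative vbar' t) (at t within {0..})"
  proof (intro exI allI impI)
    fix t :: real assume "t \<ge> 0"
    then have "(\<lambda>t. (ubar t, vbar t)) differentiable (at t within {0..})"
      using A2(4) by (auto simp: differentiable_on_def vbar_def)
    then have "((\<lambda>t. (ubar t, vbar t)) has_vector_derivative
        vector_derivative (\<lambda>t. (ubar t, vbar t)) (at t within {0..})) (at t within {0..})"
      by (simp add: vector_derivative_works)
    from bounded_linear.has_vector_derivative[OF bounded_linear_snd this]
    show "(vbar has_vector_derivative snd (vector_derivative (\<lambda>t. (ubar t, vbar t)) (at t within {0..}))) (at t within {0..})"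
      by simp
  qed
  then obtain vbar' where vbar: "\<And>t. t \<ge> 0 \<Longrightarrow> (vbar has_vector_derivative vbar' t) (at t within {0..})"
    by blast

  have in_ball: "norm (ubar t, vbar t) \<le> R" if "t \<ge> 0" for t using bar_bound[OF that] by simp
  have zero_e: "0 \<in> {0..e}" using A1(1) by simp
  note derF = has_derivative_partial_args[OF regular_on_ballD(4)[OF L(2) in_ball _ zero_e]]
  note derG = has_derivative_partial_args[OF regular_on_ballD(4)[OF L(3) in_ball _ zero_e]]
  define Gv where "Gv t = jacobian (\<lambda>v. g (ubar t) v t 0) (at (\<phi> (ubar t) t))" for t
  define Q where "Q t = jacobian (\<lambda>u. \<phi> u t) (at (ubar t))" for t
  define P where "P t x = Q t *v x" for t x
  define J where "J t = jacobian (\<lambda>u. f u (\<phi> (ubar t) t) t 0) (at (ubar t)) +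
        jacobian (\<lambda>v. f (ubar t) v t 0) (at (\<phi> (ubar t) t)) ** Q t" for t
  have Gv: "Gv t *v y = DG (ubar t, vbar t) t 0 (0, y)" if "t \<ge> 0" for t y
    using jacobian_apply[OF derG(2)[OF that that], of y] by (simp add: Gv_def vbar_def G_eq)
  have P: "Gv t *v P t x = - DG (ubar t, vbar t) t 0 (x, 0)" if t: "t \<ge> 0" for t x
  proof -
    \<comment> \<open>Implicit differentiation of \<open>G (u, \<phi> u t) t 0 = 0\<close> at \<open>u = ubar t\<close>.\<close>
    let ?D = "blinfun_apply (DG (ubar t, vbar t) t 0)"
    have "((\<lambda>u. \<phi> u t) has_derivative (\<lambda>x. P t x)) (at (ubar t))"
      using A5(1)[OF t] unfolding P_def Q_def jacobian_works .
    then have "((\<lambda>u. (u, \<phi> u t)) has_derivative (\<lambda>x. (x, P t x))) (at (ubar t))"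
      by (intro has_derivative_Pair has_derivative_ident)
    moreover have "((\<lambda>X. G X t 0) has_derivative ?D) (at (ubar t, \<phi> (ubar t) t))"
      using regular_on_ballD(4)[OF L(3) in_ball[OF t] t zero_e] by (simp add: vbar_def)
    ultimately have "((\<lambda>u. G (u, \<phi> u t) t 0) has_derivative (\<lambda>x. ?D (x, P t x))) (at (ubar t))"
      by (rule has_derivative_compose)
    moreover have "(\<lambda>u. G (u, \<phi> u t) t 0) = (\<lambda>u. 0)" using root[OF t] by (simp add: fun_eq_iff)
    ultimately have "((\<lambda>u. 0) has_derivative (\<lambda>x. ?D (x, P t x))) (at (ubar t))" by simp
    then have "(\<lambda>x. ?D (x, P t x)) = (\<lambda>x. 0)"
      by (rule has_derivative_unique) (rule has_derivative_const)
    then have "?D (x, P t x) = 0" by (rule fun_cong)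
    moreover have "?D (x, P t x) = ?D (x, 0) + ?D (0, P t x)" by (simp flip: blinfun.add_right)
    ultimately show ?thesis by (simp add: Gv[OF t] eq_neg_iff_add_eq_0 add.commute)
  qed
  have J: "J t *v x = DF (ubar t, vbar t) t 0 (x, P t x)" if t: "t \<ge> 0" for t x
  proof -
    have "J t *v x = DF (ubar t, vbar t) t 0 (x, 0) + DF (ubar t, vbar t) t 0 (0, P t x)"
      using jacobian_apply[OF derF(1)[OF t t], of x] jacobian_apply[OF derF(2)[OF t t], of "P t x"]
      by (simp add: J_def P_def vbar_def F_eq matrix_vector_mult_add_rdistrib matrix_vector_mul_assoc[symmetric])
    then show ?thesis by (simp flip: blinfun.add_right)
  qed

  have "\<exists>\<kappa>>0. \<forall>t\<ge>0. spectral_bound (Gv t) \<le> - \<kappa>"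
  proof -
    obtain r where r: "(SUP t\<in>{0..}. ereal (spectral_bound (Gv t))) < ereal r" "ereal r < 0"
      using ereal_dense2[OF A3] unfolding Gv_def by blast
    have "spectral_bound (Gv t) \<le> - (- r)" if "t \<ge> 0" for t
    proof -
      have "ereal (spectral_bound (Gv t)) \<le> (SUP t\<in>{0..}. ereal (spectral_bound (Gv t)))"
        using that by (intro SUP_upper) auto
      then have "ereal (spectral_bound (Gv t)) \<le> ereal r" using r(1) by (meson order.trans less_imp_le)
      then show ?thesis by simp
    qed
    moreover have "- r > 0" using r(2) by (simp add: zero_ereal_def)
    ultimately show ?thesis by blast
  qed
  then obtain \<kappa> where \<kappa>: "\<kappa> > 0" "\<And>t. t \<ge> 0 \<Longrightarrow> spectral_bound (Gv t) \<le> - \<kappa>" by blast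

  have "exponential_dichotomy J" using A5(2) unfolding J_def Q_def .
  then obtain Y K \<alpha> where Y: "fundamental_matrix J Y" and K: "K > 0" "\<alpha> > 0"
    "\<And>s t. 0 \<le> s \<Longrightarrow> s \<le> t \<Longrightarrow> onorm ((*v) (Y t ** matrix_inv (Y s))) \<le> K * exp (- \<alpha> * (t - s))"
    unfolding exponential_dichotomy_def by blast

  interpret slow_fast_system F G DF DtF DG DtG e R L ubar vbar vbar' Gv P J Y \<kappa> K \<alpha>
  proof
    show "Re z \<le> - \<kappa>" if "t \<ge> 0" "z \<in> complex_spectrum (Gv t)" for t z
      using Re_le_spectral_bound[OF that(2)] \<kappa>(2)[OF that(1)] by linarith
    show "G (ubar t, vbar t) t 0 = 0" if "t \<ge> 0" for t
      using root[OF that] by (simp add: vbar_def)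
  qed (fact A1(1) L \<kappa>(1) ubar vbar bar_bound Gv P J Y K)+

  have perturbed: "solution_in_ball \<epsilon> u v"
    if \<epsilon>: "0 < \<epsilon>" and sol: "solves_perturbed f g u0 v0 \<epsilon> u v" for \<epsilon> u v
    unfolding solution_in_ball_def
  proof (intro exI[of _ "\<lambda>t. F (u t, v t) t \<epsilon>"] exI[of _ "\<lambda>t. (1 / \<epsilon>) *\<^sub>R G (u t, v t) t \<epsilon>"] allI impI conjI)
    fix t :: real assume t: "0 \<le> t"
    show "(u has_vector_derivative F (u t, v t) t \<epsilon>) (at t within {0..})"
      using sol t by (simp add: solves_perturbed_def F_eq)
    obtain v' where v': "(v has_vector_derivative v') (at t within {0..})" "\<epsilon> *\<^sub>R v' = G (u t, v t) t \<epsilon>"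
      using sol t by (auto simp: solves_perturbed_def G_eq)
    have "v' = (1 / \<epsilon>) *\<^sub>R G (u t, v t) t \<epsilon>" using \<epsilon> by (simp flip: v'(2))
    then show "(v has_vector_derivative (1 / \<epsilon>) *\<^sub>R G (u t, v t) t \<epsilon>) (at t within {0..})"
      using v'(1) by simp
  qed simp_all

  have "\<exists>\<epsilon>\<rho>>0. \<epsilon>\<rho> \<le> e \<and> (\<forall>\<epsilon>. 0 < \<epsilon> \<and> \<epsilon> \<le> \<epsilon>\<rho> \<longrightarrow>
      (\<exists>u v. solves_perturbed f g u0 v0 \<epsilon> u v) \<and>
      (\<forall>u v. solves_perturbed f g u0 v0 \<epsilon> u v \<longrightarrow>
        (\<forall>t\<ge>0. norm (v t - \<phi> (ubar t) t - (vhat (t / \<epsilon>) - \<phi> u0 0)) \<le> \<rho> \<and>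
               norm (u t - ubar t) \<le> \<rho>)))" if \<rho>: "\<rho> > 0" for \<rho>
  proof -
    obtain \<epsilon>0 where \<epsilon>0: "\<epsilon>0 > 0" "\<epsilon>0 \<le> e" and track: "\<And>\<epsilon> u v t. 0 < \<epsilon> \<Longrightarrow> \<epsilon> \<le> \<epsilon>0 \<Longrightarrow>
       solution_in_ball \<epsilon> u v \<Longrightarrow> u 0 = ubar 0 \<Longrightarrow> v 0 = vhat 0 \<Longrightarrow> 0 \<le> t \<Longrightarrow>
       norm (v t - vbar t - (vhat (t / \<epsilon>) - vbar 0)) \<le> \<rho> \<and> norm (u t - ubar t) \<le> \<rho> \<and> norm (u t, v t) \<le> R"
      using uniform_tracking[OF vhat hat_bound vhat_lim \<rho>] by blast
    have "\<exists>u v. solves_perturbed f g u0 v0 \<epsilon> u v" if \<epsilon>: "0 < \<epsilon>" "\<epsilon> \<le> \<epsilon>0" for \<epsilon>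
    proof -
      obtain u v where uv: "u 0 = u0" "v 0 = v0" "solution_in_ball \<epsilon> u v"
        using solution_in_ball_exists[of \<epsilon> u0 v0] \<epsilon> \<epsilon>0 by auto
      obtain u' v' where der: "\<And>t. t \<ge> 0 \<Longrightarrow> (u has_vector_derivative u' t) (at t within {0..})"
        "\<And>t. t \<ge> 0 \<Longrightarrow> (v has_vector_derivative v' t) (at t within {0..})"
        and ode: "\<And>t. t \<ge> 0 \<Longrightarrow> norm (u t, v t) \<le> R \<Longrightarrow>
         u' t = F (u t, v t) t \<epsilon> \<and> v' t = (1 / \<epsilon>) *\<^sub>R G (u t, v t) t \<epsilon>"
        using uv(3) unfolding solution_in_ball_def by blast
      have eq: "u' t = f (u t) (v t) t \<epsilon>" "\<epsilon> *\<^sub>R v' t = g (u t) (v t) t \<epsilon>" if "t \<ge> 0" for t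
        using ode[OF that] track[OF \<epsilon> uv(3) _ _ that] \<epsilon>(1) by (simp_all add: uv(1,2) ubar0 vhat0 F_eq G_eq)
      have "solves_perturbed f g u0 v0 \<epsilon> u v"
        unfolding solves_perturbed_def
      proof (intro conjI allI impI uv(1,2))
        fix t :: real assume t: "0 \<le> t"
        show "(u has_vector_derivative f (u t) (v t) t \<epsilon>) (at t within {0..})"
          using der(1)[OF t] eq(1)[OF t] by simp
        show "\<exists>v'. (v has_vector_derivative v') (at t within {0..}) \<and> \<epsilon> *\<^sub>R v' = g (u t) (v t) t \<epsilon>"
          using der(2)[OF t] eq(2)[OF t] by blast
      qed
      then show ?thesis by blast
    qed
    moreover have "norm (v t - \<phi> (ubar t) t - (vhat (t / \<epsilon>) - \<phi> u0 0)) \<le> \<rho> \<and> norm (u t - ubar t) \<le> \<rho>"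
      if \<epsilon>: "0 < \<epsilon>" "\<epsilon> \<le> \<epsilon>0" and sol: "solves_perturbed f g u0 v0 \<epsilon> u v" and t: "t \<ge> 0" for \<epsilon> u v t
      using track[OF \<epsilon> perturbed[OF \<epsilon>(1) sol] _ _ t] sol
      by (simp add: solves_perturbed_def ubar0 vhat0 vbar_def)
    ultimately show ?thesis using \<epsilon>0 by blast
  qed
  then show ?thesis using zero_less_one by blast
qed

end
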